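(* For every integer $n \geq 97$ there exists a 4-regular matchstick graph with exactly $n$ vertices.
   Context: A matchstick graph is a finite graph drawn in the Euclidean plane such that vertices are distinct points, every edge is a straight line segment of length 1 between its endpoints, and edges do not cross or overlap (two edges intersect at most in a common endpoint). A matchstick graph is 4-regular if every vertex has degree exactly 4. *)

theory Defs
  imports "HOL-Analysis.Analysis"
begin

definition matchstick_graph :: "(real^2) set \<Rightarrow> (real^2) set set \<Rightarrow> bool" where
  "matchstick_graph V E \<longleftrightarrow>
     finite V \<and>
     (\<forall>e\<in>E. \<exists>u v. e = {u, v} \<and> u \<in> V \<and> v \<in> V \<and> u \<noteq> v \<and> dist u v = 1) \<and>
     (\<forall>e\<in>E. \<forall>f\<in>E. e \<noteq> f \<longrightarrow>
        (\<forall>u v x y. e = {u, v} \<longrightarrow> f = {x, y} \<longrightarrow>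
           closed_segment u v \<inter> closed_segment x y \<subseteq> e \<inter> f))"

definition degree :: "(real^2) set set \<Rightarrow> real^2 \<Rightarrow> nat" where
  "degree E v = card {e \<in> E. v \<in> e}"

definition four_regular_matchstick_graph :: "(real^2) set \<Rightarrow> (real^2) set set \<Rightarrow> bool" where
  "four_regular_matchstick_graph V E \<longleftrightarrow>
     matchstick_graph V E \<and> (\<forall>v\<in>V. degree E v = 4)"

end

theory Submission
  imports Defs "HOL-Library.Multiset"
begin

text \<open>
  Call a rigid planar unit-distance graph a body if all its vertices have degree 4, except for three
  corners \<open>a\<close>, \<open>b\<close>, \<open>c\<close> of degree 2. A body on one side of the line \<open>a b\<close>, glued along \<open>a\<close> and \<open>b\<close> to
  its mirror image in that line, is a bar: its only vertices of degree less than 4 are \<open>c\<close> and its mirror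
  image, both of degree 2. Bars can be hinged together end to end to form a closed polygon, which then is
  4-regular; a body with \<open>v\<close> vertices contributes \<open>2 v - 3\<close> vertices to it. We take polygons inscribed in a
  circle, each bar staying inside the sector of the circle that belongs to its side. Bodies with 12,
  16, 19, 21 and 22 vertices, contributing 21, 29, 35, 39 and 41 vertices, suffice: they give a polygon for
  every \<open>n\<close> from 97 to 117, and any number of further 12-vertex bodies can be added.

  The bodies with 12 and 21 vertices consist of triangles and are explicit. The other three contain a
  four-bar linkage with one degree of freedom, which is fixed by one further distance; it is solved by the
  intermediate value theorem, and planarity is read off from decimal approximations.
\<close>

section \<open>Gluing unit-distance graphs\<close>

text \<open>The bars are rigid, so a polygon with prescribed sides can only be closed by choosing
  its circumradius \<open>R\<close>. If the half-angles \<open>arcsin (h / R)\<close> sum to at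
  least pi on the smallest circle that admits all the bars, they sum to exactly pi on some larger
  one. Two things limit how small that circle may be: the longest bar must fit as a chord, and every
  body must stay below the ray from the centre through its corner \<open>c\<close>. The second is a
  slope condition that becomes weaker as \<open>R\<close> grows, so one radius decides it. A small
  circle is filled by few bars but excludes the long ones; hence two starting radii, 4.005 and
  5.005.

  As \<open>2 v - 3\<close> is odd, the parity of \<open>n\<close> is that of the number of bars.
  The 21 vertices of the smallest bar leave 21 residue classes, each covered by a polygon with three
  or four bars.

  Planarity is never checked edge by edge. A body is glued from at most seven convex polygons or
  segments whose interior structure is already known, and any two of these are separated by a line
  that contains at most one common vertex of both.\<close>

definition unit_graph :: "'a::real_normed_vector set \<Rightarrow> 'a set set \<Rightarrow> bool" where
  "unit_graph V E \<longleftrightarrow> finite V \<and>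
     (\<forall>e\<in>E. \<exists>u v. e = {u, v} \<and> u \<in> V \<and> v \<in> V \<and> dist u v = 1) \<and>
     (\<forall>e\<in>E. \<forall>f\<in>E. e \<noteq> f \<longrightarrow> convex hull e \<inter> convex hull f \<subseteq> e \<inter> f)"

definition deg :: "'a set set \<Rightarrow> 'a \<Rightarrow> nat" where
  "deg E v = card {e \<in> E. v \<in> e}"

text \<open>The multiset \<open>M\<close> records the missing degrees: \<open>v\<close> occurs in it \<open>4 - deg v\<close> times.\<close>

definition piece :: "'a::real_normed_vector set \<Rightarrow> nat \<Rightarrow> 'a multiset \<Rightarrow> bool" where
  "piece S n M \<longleftrightarrow> (\<exists>V E. unit_graph V E \<and> (\<Union>e\<in>E. convex hull e) \<subseteq> S \<and> card V = n \<and>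
     (\<forall>v\<in>V. 0 < deg E v \<and> deg E v + count M v = 4) \<and> set_mset M \<subseteq> V)"

lemma piece_mono:
  assumes "piece S n M" "S \<subseteq> T" shows "piece T n M"
proof -
  obtain V E where "unit_graph V E" and S: "(\<Union>e\<in>E. convex hull e) \<subseteq> S" and "card V = n"
     "\<forall>v\<in>V. 0 < deg E v \<and> deg E v + count M v = 4" "set_mset M \<subseteq> V"
    using assms(1) unfolding piece_def by (elim exE conjE)
  moreover have "(\<Union>e\<in>E. convex hull e) \<subseteq> T" using S assms(2) by (rule order_trans)
  ultimately show ?thesis unfolding piece_def by (intro exI conjI)
qed

lemma unit_graphD:
  assumes "unit_graph V E"
  shows "finite V" "\<And>e. e \<in> E \<Longrightarrow> \<exists>u v. e = {u, v} \<and> u \<in> V \<and> v \<in> V \<and> dist u v = 1"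
    "\<And>e f. e \<in> E \<Longrightarrow> f \<in> E \<Longrightarrow> e \<noteq> f \<Longrightarrow> convex hull e \<inter> convex hull f \<subseteq> e \<inter> f"
  using assms by (simp_all add: unit_graph_def)

lemma unit_graph_finite:
  assumes "unit_graph V E"
  shows "finite E" "\<And>e. e \<in> E \<Longrightarrow> e \<subseteq> V"
proof -
  show *: "e \<subseteq> V" if e: "e \<in> E" for e
    using unit_graphD(2)[OF assms e] by auto
  have "E \<subseteq> Pow V" using * by auto
  thus "finite E" using unit_graphD(1)[OF assms] by (simp add: finite_subset)
qed

lemma deg_pos_mem:
  assumes "0 < deg E v" shows "\<exists>e\<in>E. v \<in> e"
proof (rule ccontr)
  assume "\<not> ?thesis"
  hence "{e \<in> E. v \<in> e} = {}" by auto
  hence "card {e \<in> E. v \<in> e} = 0" by (metis card.empty)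
  hence "deg E v = 0" by (simp add: deg_def)
  thus False using assms by simp
qed

text \<open>This is why \<open>piece\<close> demands positive degrees: an isolated vertex could lie
  inside an edge, whereas a vertex on some edge \<open>f\<close> cannot, by the non-crossing
  condition for \<open>e\<close> and \<open>f\<close>.\<close>

lemma unit_graph_vertex_on_edge:
  assumes "unit_graph V E" "0 < deg E p" "e \<in> E" "p \<in> convex hull e"
  shows "p \<in> e"
proof -
  obtain f where f: "f \<in> E" "p \<in> f" using deg_pos_mem[OF assms(2)] by blast
  have "p \<in> convex hull f" using f(2) by (simp add: hull_inc)
  hence "p \<in> convex hull e \<inter> convex hull f" using assms(4) by simp
  moreover have "e = f \<or> convex hull e \<inter> convex hull f \<subseteq> e \<inter> f"
    using unit_graphD(3)[OF assms(1,3) f(1)] by auto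
  ultimately show ?thesis using f(2) by auto
qed

lemma deg_union:
  assumes "finite E1" "finite E2" "E1 \<inter> E2 = {}"
  shows "deg (E1 \<union> E2) v = deg E1 v + deg E2 v"
proof -
  have "{e \<in> E1 \<union> E2. v \<in> e} = {e \<in> E1. v \<in> e} \<union> {e \<in> E2. v \<in> e}" by auto
  moreover have "card \<dots> = card {e \<in> E1. v \<in> e} + card {e \<in> E2. v \<in> e}"
    by (rule card_Un_disjoint) (use assms in auto)
  ultimately show ?thesis by (simp add: deg_def)
qed

lemma deg_outside:
  assumes "unit_graph V E" "v \<notin> V" shows "deg E v = 0"
proof -
  have "{e \<in> E. v \<in> e} = {}" using unit_graph_finite(2)[OF assms(1)] assms(2) by auto
  hence "card {e \<in> E. v \<in> e} = 0" by (metis card.empty)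
  thus ?thesis by (simp add: deg_def)
qed

text \<open>Edges of different pieces meet only in \<open>S1 \<inter> S2\<close>, hence in points of
  \<open>K\<close>; these are vertices of both pieces and therefore endpoints of both edges. A
  merged vertex of degrees d1 and d2 misses 4 - d1 and 4 - d2 before the gluing and 4 - d1 - d2
  after it, which is 4 less than the sum: this is the term
  \<open>repeat_mset 4 (mset K)\<close>.\<close>

lemma piece_glue:
  fixes S1 S2 :: "'a::real_normed_vector set"
  assumes "piece S1 n1 M1" "piece S2 n2 M2" and S: "S1 \<inter> S2 \<subseteq> set K" and d: "distinct K"
    and K: "set K \<subseteq> set_mset M1" "set K \<subseteq> set_mset M2"
    and M: "M1 + M2 = M + repeat_mset 4 (mset K)" and n: "n1 + n2 = n + length K"
  shows "piece (S1 \<union> S2) n M"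
proof -
  obtain V1 E1 where 1: "unit_graph V1 E1" "(\<Union>e\<in>E1. convex hull e) \<subseteq> S1" "card V1 = n1"
     "\<And>v. v \<in> V1 \<Longrightarrow> 0 < deg E1 v \<and> deg E1 v + count M1 v = 4" "set_mset M1 \<subseteq> V1"
    using assms(1) unfolding piece_def by blast
  obtain V2 E2 where 2: "unit_graph V2 E2" "(\<Union>e\<in>E2. convex hull e) \<subseteq> S2" "card V2 = n2"
     "\<And>v. v \<in> V2 \<Longrightarrow> 0 < deg E2 v \<and> deg E2 v + count M2 v = 4" "set_mset M2 \<subseteq> V2"
    using assms(2) unfolding piece_def by blast
  have fV: "finite V1" "finite V2" using unit_graphD(1)[OF 1(1)] unit_graphD(1)[OF 2(1)] by auto
  have VS1: "V1 \<subseteq> S1"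
  proof
    fix v assume "v \<in> V1"
    then obtain e where e: "e \<in> E1" "v \<in> e" using deg_pos_mem[of E1 v] 1(4)[of v] by auto
    have "v \<in> convex hull e" using e(2) by (rule hull_inc)
    thus "v \<in> S1" using 1(2) e(1) by auto
  qed
  have VS2: "V2 \<subseteq> S2"
  proof
    fix v assume "v \<in> V2"
    then obtain e where e: "e \<in> E2" "v \<in> e" using deg_pos_mem[of E2 v] 2(4)[of v] by auto
    have "v \<in> convex hull e" using e(2) by (rule hull_inc)
    thus "v \<in> S2" using 2(2) e(1) by auto
  qed
  have KV: "V1 \<inter> V2 = set K" using VS1 VS2 S K 1(5) 2(5) by blast
  have cross: "convex hull e \<inter> convex hull f \<subseteq> e \<inter> f" if "e \<in> E1" "f \<in> E2" for e f
  proof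
    fix p assume p: "p \<in> convex hull e \<inter> convex hull f"
    hence "p \<in> S1 \<inter> S2" using 1(2) 2(2) that by auto
    hence v: "p \<in> V1" "p \<in> V2" using S KV by auto
    have "p \<in> e" by (rule unit_graph_vertex_on_edge[OF 1(1) _ that(1)]) (use p 1(4)[OF v(1)] in auto)
    moreover have "p \<in> f" by (rule unit_graph_vertex_on_edge[OF 2(1) _ that(2)]) (use p 2(4)[OF v(2)] in auto)
    ultimately show "p \<in> e \<inter> f" by simp
  qed
  have disj: "E1 \<inter> E2 = {}"
  proof (rule ccontr)
    assume "E1 \<inter> E2 \<noteq> {}"
    then obtain e where e: "e \<in> E1" "e \<in> E2" by auto
    then obtain u v where uv: "e = {u, v}" "dist u v = 1" using unit_graphD(2)[OF 1(1) e(1)] by auto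
    \<comment> \<open>A shared edge would meet itself across the two pieces, so its midpoint would
      have to be one of its endpoints.\<close>
    have "midpoint u v \<in> convex hull e" unfolding uv(1) segment_convex_hull[symmetric] by simp
    hence "midpoint u v \<in> e" using cross[OF e] by blast
    thus False using uv by auto
  qed
  have fE: "finite E1" "finite E2" using unit_graph_finite(1) 1(1) 2(1) by auto
  have "unit_graph (V1 \<union> V2) (E1 \<union> E2)"
    unfolding unit_graph_def
  proof (intro conjI ballI impI)
    show "finite (V1 \<union> V2)" using fV by simp
    show "\<exists>u v. e = {u, v} \<and> u \<in> V1 \<union> V2 \<and> v \<in> V1 \<union> V2 \<and> dist u v = 1" if "e \<in> E1 \<union> E2" for e
      using that unit_graphD(2)[OF 1(1), of e] unit_graphD(2)[OF 2(1), of e] by auto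
    show "convex hull e \<inter> convex hull f \<subseteq> e \<inter> f" if "e \<in> E1 \<union> E2" "f \<in> E1 \<union> E2" "e \<noteq> f" for e f
    proof -
      consider "e \<in> E1" "f \<in> E1" | "e \<in> E2" "f \<in> E2" | "e \<in> E1" "f \<in> E2" | "e \<in> E2" "f \<in> E1"
        using \<open>e \<in> E1 \<union> E2\<close> \<open>f \<in> E1 \<union> E2\<close> by blast
      thus ?thesis
      proof cases
        case 1 thus ?thesis using unit_graphD(3)[OF \<open>unit_graph V1 E1\<close>] \<open>e \<noteq> f\<close> by simp
      next
        case 2 thus ?thesis using unit_graphD(3)[OF \<open>unit_graph V2 E2\<close>] \<open>e \<noteq> f\<close> by simp
      next
        case 3 thus ?thesis by (rule cross)
      next
        case 4 thus ?thesis using cross[of f e] by (simp add: Int_commute)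
      qed
    qed
  qed
  moreover have "(\<Union>e\<in>E1 \<union> E2. convex hull e) \<subseteq> S1 \<union> S2" using 1(2) 2(2) by blast
  moreover have "card (V1 \<union> V2) = n"
    using card_Un_Int[OF fV] KV 1(3) 2(3) n distinct_card[OF d] by simp
  moreover have "0 < deg (E1 \<union> E2) v \<and> deg (E1 \<union> E2) v + count M v = 4" if "v \<in> V1 \<union> V2" for v
  proof -
    have c: "count M1 v + count M2 v = count M v + 4 * count (mset K) v"
      using arg_cong[OF M, of "\<lambda>X. count X v"] by simp
    have ck: "count (mset K) v = (if v \<in> set K then 1 else 0)"
      using d distinct_count_atmost_1[of K] by simp
    have vK: "v \<in> set K \<longleftrightarrow> v \<in> V1 \<and> v \<in> V2" unfolding KV[symmetric] by simp
    have vV: "v \<in> V1 \<or> v \<in> V2" using that by simp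
    consider "v \<in> V1" "v \<in> V2" "v \<in> set K" | "v \<in> V1" "v \<notin> V2" "v \<notin> set K" | "v \<notin> V1" "v \<in> V2" "v \<notin> set K"
      using vK vV by argo
    thus ?thesis
    proof cases
      case A: 1
      thus ?thesis using 1(4)[OF A(1)] 2(4)[OF A(2)] c ck by (simp add: deg_union[OF fE disj])
    next
      case A: 2
      have "count M2 v = 0" using A(2) subsetD[OF 2(5), of v] by (simp only: count_eq_zero_iff) auto
      thus ?thesis using 1(4)[OF A(1)] c ck A deg_outside[OF 2(1) A(2)]
        by (simp add: deg_union[OF fE disj])
    next
      case A: 3
      have "count M1 v = 0" using A(1) subsetD[OF 1(5), of v] by (simp only: count_eq_zero_iff) auto
      thus ?thesis using 2(4)[OF A(2)] c ck A deg_outside[OF 1(1) A(1)]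
        by (simp add: deg_union[OF fE disj])
    qed
  qed
  moreover have "set_mset M \<subseteq> V1 \<union> V2"
  proof -
    have "set_mset M \<subseteq> set_mset (M1 + M2)" unfolding M by simp
    thus ?thesis using 1(5) 2(5) by auto
  qed
  ultimately show ?thesis unfolding piece_def by blast
qed

text \<open>Because non-crossing is expressed by \<open>convex hull e\<close>, any isometry that
  commutes with hulls preserves it. Translations, rotations, conjugation and the passage from
  \<open>complex\<close> to \<open>real ^ 2\<close> are all instances.\<close>

lemma piece_image:
  fixes f :: "'a::real_normed_vector \<Rightarrow> 'b::real_normed_vector"
  assumes "piece S n M" and d: "\<And>x y. dist (f x) (f y) = dist x y"
    and h: "\<And>A. f ` (convex hull A) = convex hull (f ` A)"
  shows "piece (f ` S) n (image_mset f M)"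
proof -
  obtain V E where 1: "unit_graph V E" "(\<Union>e\<in>E. convex hull e) \<subseteq> S" "card V = n"
     "\<And>v. v \<in> V \<Longrightarrow> 0 < deg E v \<and> deg E v + count M v = 4" "set_mset M \<subseteq> V"
    using assms(1) unfolding piece_def by blast
  have inj: "inj f" by (rule injI) (metis d dist_eq_0_iff)
  have "unit_graph (f ` V) ((`) f ` E)" unfolding unit_graph_def
  proof (intro conjI ballI impI)
    show "finite (f ` V)" using unit_graphD(1)[OF 1(1)] by simp
    show "\<exists>u v. e = {u, v} \<and> u \<in> f ` V \<and> v \<in> f ` V \<and> dist u v = 1" if "e \<in> (`) f ` E" for e
    proof -
      obtain e' where e': "e' \<in> E" "e = f ` e'" using \<open>e \<in> (`) f ` E\<close> by blast
      then obtain u v where "e' = {u, v}" "u \<in> V" "v \<in> V" "dist u v = 1" using unit_graphD(2)[OF 1(1) e'(1)] by auto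
      thus ?thesis using e' d by (intro exI[of _ "f u"] exI[of _ "f v"]) auto
    qed
    show "convex hull e \<inter> convex hull g \<subseteq> e \<inter> g" if "e \<in> (`) f ` E" "g \<in> (`) f ` E" "e \<noteq> g" for e g
    proof -
      obtain e' g' where e': "e' \<in> E" "e = f ` e'" "g' \<in> E" "g = f ` g'"
        using \<open>e \<in> (`) f ` E\<close> \<open>g \<in> (`) f ` E\<close> by blast
      hence "e' \<noteq> g'" using \<open>e \<noteq> g\<close> by auto
      hence "convex hull e' \<inter> convex hull g' \<subseteq> e' \<inter> g'" using unit_graphD(3)[OF 1(1) e'(1) e'(3)] by simp
      hence "f ` (convex hull e' \<inter> convex hull g') \<subseteq> f ` (e' \<inter> g')" by (rule image_mono)
      thus ?thesis using e' by (simp add: h[symmetric] image_Int[OF inj])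
    qed
  qed
  moreover have "(\<Union>e\<in>(`) f ` E. convex hull e) \<subseteq> f ` S"
    using 1(2) by (auto simp: h[symmetric])
  moreover have "card (f ` V) = n" using 1(3) inj by (simp add: card_image inj_on_subset)
  moreover have "0 < deg ((`) f ` E) v \<and> deg ((`) f ` E) v + count (image_mset f M) v = 4" if v: "v \<in> f ` V" for v
  proof -
    obtain x where x: "x \<in> V" "v = f x" using v by blast
    have mem: "v \<in> f ` e \<longleftrightarrow> x \<in> e" for e unfolding x(2) by (rule inj_image_mem_iff[OF inj])
    have "{e \<in> (`) f ` E. v \<in> e} = (`) f ` {e \<in> E. x \<in> e}" using mem by blast
    hence "deg ((`) f ` E) v = deg E x" unfolding deg_def
      by (simp add: card_image inj_image_eq_iff[OF inj] inj_on_def)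
    moreover have "count (image_mset f M) v = count M x" unfolding x(2)
      by (induction M) (auto simp: inj_eq[OF inj])
    ultimately show ?thesis using 1(4)[OF x(1)] by simp
  qed
  moreover have "set_mset (image_mset f M) \<subseteq> f ` V" using 1(5) by auto
  ultimately show ?thesis unfolding piece_def by blast
qed

lemma piece_translate: "piece S n M \<Longrightarrow> piece ((+) a ` S) n (image_mset ((+) a) M)"
  by (rule piece_image) (auto simp: convex_hull_translation)

lemma piece_linear_image:
  assumes "piece S n M" "linear f" "\<And>x. norm (f x) = norm x"
  shows "piece (f ` S) n (image_mset f M)"
proof (rule piece_image[OF assms(1)])
  show "dist (f x) (f y) = dist x y" for x y
    using assms(3)[of "x - y"] by (simp add: dist_norm linear_diff[OF assms(2)])
  show "f ` (convex hull A) = convex hull (f ` A)" for A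
    by (rule convex_hull_linear_image[OF assms(2)])
qed

section \<open>Triangles and triangulated strips\<close>

text \<open>An open half-space together with one point \<open>s\<close> of its boundary is still
  convex. So inequalities at the vertices can certify that two hulls touch in exactly one vertex,
  where strict separation is impossible.\<close>

lemma hull_beyond_point:
  fixes w s :: "'a::real_inner"
  assumes "\<And>x. x \<in> P \<Longrightarrow> x = s \<or> 0 < w \<bullet> (x - s)" and y: "y \<in> convex hull P"
  shows "y = s \<or> 0 < w \<bullet> (y - s)"
proof -
  let ?T = "{y. y = s \<or> 0 < w \<bullet> (y - s)}"
  have "convex ?T"
  proof (rule convexI)
    fix x y u v assume *: "x \<in> ?T" "y \<in> ?T" "0 \<le> u" "0 \<le> v" "u + v = (1::real)"
    have s: "s = u *\<^sub>R s + v *\<^sub>R s" using *(5) by (metis scaleR_add_left scaleR_one)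
    have eq: "u *\<^sub>R x + v *\<^sub>R y - s = u *\<^sub>R (x - s) + v *\<^sub>R (y - s)"
      by (subst (1) s) (simp add: algebra_simps)
    have w: "w \<bullet> (u *\<^sub>R x + v *\<^sub>R y - s) = u * (w \<bullet> (x - s)) + v * (w \<bullet> (y - s))"
      unfolding eq by (simp add: inner_add_right)
    show "u *\<^sub>R x + v *\<^sub>R y \<in> ?T"
    proof (cases "u = 0 \<or> v = 0")
      case True thus ?thesis using * by auto
    next
      case False
      hence uv: "0 < u" "0 < v" using * by auto
      consider "x = s" "y = s" | "x = s" "0 < w \<bullet> (y - s)" | "0 < w \<bullet> (x - s)" "y = s"
        | "0 < w \<bullet> (x - s)" "0 < w \<bullet> (y - s)" using *(1,2) by auto
      thus ?thesis
      proof cases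
        case 1 thus ?thesis using s by simp
      next
        case 2 thus ?thesis using uv w by simp
      next
        case 3 thus ?thesis using uv w by simp
      next
        case 4 thus ?thesis using uv w by (simp add: add_pos_pos)
      qed
    qed
  qed
  moreover have "P \<subseteq> ?T" using assms(1) by auto
  ultimately have "convex hull P \<subseteq> ?T" by (simp add: hull_minimal)
  thus ?thesis using y by auto
qed

lemma hull_meet_point:
  fixes w s :: "'a::real_inner"
  assumes "\<And>x. x \<in> P \<Longrightarrow> x = s \<or> 0 < w \<bullet> (x - s)" "\<And>x. x \<in> Q \<Longrightarrow> x = s \<or> w \<bullet> (x - s) < 0"
  shows "convex hull P \<inter> convex hull Q \<subseteq> {s}"
proof
  fix y assume y: "y \<in> convex hull P \<inter> convex hull Q"
  have "y = s \<or> 0 < w \<bullet> (y - s)" by (rule hull_beyond_point[OF assms(1)]) (use y in auto)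
  moreover have "y = s \<or> 0 < (- w) \<bullet> (y - s)"
    by (rule hull_beyond_point[of Q]) (use assms(2) y in auto)
  ultimately show "y \<in> {s}" by auto
qed

lemma hull_disjoint:
  fixes w :: "'a::real_inner"
  assumes "\<And>x. x \<in> P \<Longrightarrow> c < w \<bullet> x" "\<And>x. x \<in> Q \<Longrightarrow> w \<bullet> x < c"
  shows "convex hull P \<inter> convex hull Q = {}"
proof -
  have "convex hull P \<subseteq> {x. c < w \<bullet> x}"
    by (rule hull_minimal) (use assms(1) in \<open>auto simp: convex_halfspace_gt\<close>)
  moreover have "convex hull Q \<subseteq> {x. w \<bullet> x < c}"
    by (rule hull_minimal) (use assms(2) in \<open>auto simp: convex_halfspace_lt\<close>)
  ultimately show ?thesis by fastforce
qed

lemma piece_glue_point: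
  assumes "piece S1 n1 M1" "piece S2 n2 M2" "S1 \<inter> S2 \<subseteq> {k}" "k \<in># M1" "k \<in># M2"
    and "M1 + M2 = M + {#k, k, k, k#}" "n1 + n2 = Suc n"
  shows "piece (S1 \<union> S2) n M"
  by (rule piece_glue[OF assms(1,2), of "[k]"]) (use assms in \<open>auto simp: numeral_eq_Suc\<close>)

lemma piece_glue_two:
  assumes "piece S1 n1 M1" "piece S2 n2 M2" "S1 \<inter> S2 \<subseteq> {k, l}" "k \<noteq> l"
    and "k \<in># M1" "k \<in># M2" "l \<in># M1" "l \<in># M2"
    and "M1 + M2 = M + {#k, k, k, k, l, l, l, l#}" "n1 + n2 = Suc (Suc n)"
  shows "piece (S1 \<union> S2) n M"
  by (rule piece_glue[OF assms(1,2), of "[k, l]"])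
     (use assms in \<open>auto simp: numeral_eq_Suc add_mset_commute\<close>)

text \<open>Two unit vectors at 60 degrees, in either orientation. All inner products are then 1 or
  1/2, which reduces the separation checks for triangles and strips to rational arithmetic in any
  inner product space.\<close>

definition frame :: "'a::real_inner \<Rightarrow> 'a \<Rightarrow> bool" where
  "frame v w \<longleftrightarrow> norm v = 1 \<and> norm w = 1 \<and> norm (v - w) = 1"

lemma frameD:
  assumes "frame v w"
  shows "v \<bullet> v = 1" "w \<bullet> w = 1" "v \<bullet> w = 1/2" "w \<bullet> v = 1/2" "norm v = 1" "norm w = 1"
    "norm (w - v) = 1" "v \<noteq> 0" "w \<noteq> 0" "v \<noteq> w"
proof -
  have n: "norm v = 1" "norm w = 1" "norm (v - w) = 1" using assms by (auto simp: frame_def)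
  show vv: "v \<bullet> v = 1" "w \<bullet> w = 1" using n by (simp_all add: norm_eq_1)
  have "(v - w) \<bullet> (v - w) = 1" using n by (simp add: norm_eq_1)
  hence "v \<bullet> v - 2 * (v \<bullet> w) + w \<bullet> w = 1" by (simp add: inner_diff inner_commute algebra_simps)
  thus "v \<bullet> w = 1/2" using vv by simp
  thus "w \<bullet> v = 1/2" by (simp add: inner_commute)
  show "norm v = 1" "norm w = 1" "norm (w - v) = 1" using n by (simp_all add: norm_minus_commute)
  show "v \<noteq> 0" "w \<noteq> 0" "v \<noteq> w" using n by auto
qed

lemma piece_edge:
  fixes a b :: "'a::real_normed_vector"
  assumes "norm (b - a) = 1"
  shows "piece (convex hull {a, b}) 2 {#a, a, a, b, b, b#}"
proof -
  have ab: "a \<noteq> b" using assms by auto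
  have "{e. e = {a, b} \<and> a \<in> e} = {{a, b}}" "{e. e = {a, b} \<and> b \<in> e} = {{a, b}}" by auto
  hence "deg {{a, b}} a = 1" "deg {{a, b}} b = 1" by (simp_all add: deg_def)
  thus ?thesis unfolding piece_def unit_graph_def
    using ab assms by (intro exI[of _ "{a, b}"] exI[of _ "{{a, b}}"]) (auto simp: dist_norm norm_minus_commute)
qed

lemma piece_triangle:
  assumes "frame v w" "b = a + v" "c = a + w"
  shows "piece (convex hull {a, b, c}) 3 {#a, a, b, b, c, c#}"
proof -
  note f = frameD[OF assms(1)]
  have "piece (convex hull {a, b} \<union> convex hull {b, c}) 3 {#a, a, a, b, b, c, c, c#}"
  proof (rule piece_glue_point[OF piece_edge piece_edge, where k = b])
    show "convex hull {a, b} \<inter> convex hull {b, c} \<subseteq> {b}"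
      by (rule hull_meet_point[where w = "- w"]) (auto simp: assms(2,3) inner_simps f)
  qed (auto simp: assms f add_mset_commute)
  hence "piece ((convex hull {a, b} \<union> convex hull {b, c}) \<union> convex hull {a, c}) 3 {#a, a, b, b, c, c#}"
  proof (rule piece_glue_two[OF _ piece_edge, where k = a and l = c])
    have "convex hull {a, b} \<inter> convex hull {a, c} \<subseteq> {a}"
      by (rule hull_meet_point[where w = "v - w"]) (auto simp: assms(2,3) inner_simps f)
    moreover have "convex hull {b, c} \<inter> convex hull {a, c} \<subseteq> {c}"
      by (rule hull_meet_point[where w = "v"]) (auto simp: assms(2,3) inner_simps f)
    ultimately show "(convex hull {a, b} \<union> convex hull {b, c}) \<inter> convex hull {a, c} \<subseteq> {a, c}" by auto
  qed (auto simp: assms f add_mset_commute)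
  thus ?thesis by (rule piece_mono) (auto intro: subsetD[OF hull_mono, rotated])
qed

lemma hull_subset_hull: "A \<subseteq> convex hull B \<Longrightarrow> convex hull A \<subseteq> convex hull B"
  by (simp add: hull_minimal)

lemma double_mem_hull:
  fixes p q x :: "'a::real_vector"
  assumes "p \<in> convex hull A" "q \<in> convex hull A" "2 *\<^sub>R x = p + q"
  shows "x \<in> convex hull A"
proof -
  have "2 *\<^sub>R x = 2 *\<^sub>R midpoint p q" unfolding assms(3) by (simp add: midpoint_def)
  hence "x = midpoint p q" by simp
  moreover have "closed_segment p q \<subseteq> convex hull A"
    by (rule closed_segment_subset[OF assms(1,2) convex_convex_hull])
  ultimately show ?thesis using midpoint_in_closed_segment by auto
qed

text \<open>Only the three corner triangles are glued; their inner sides already form the middle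
  triangle. Each midpoint lies in two of them and so has degree 4.\<close>

lemma piece_triangle2:
  assumes "frame v w" "b = a + 2 *\<^sub>R v" "c = a + 2 *\<^sub>R w"
  shows "piece (convex hull {a, b, c}) 6 {#a, a, b, b, c, c#}"
proof -
  note f = frameD[OF assms(1)]
  define x where "x = a + v"
  define y where "y = a + w"
  define z where "z = a + v + w"
  note d = assms(2,3) x_def y_def z_def
  have "piece (convex hull {a, x, y} \<union> convex hull {x, b, z}) 5 {#a, a, y, y, b, b, z, z#}"
  proof (rule piece_glue_point[OF piece_triangle piece_triangle, where k = x])
    show "convex hull {a, x, y} \<inter> convex hull {x, b, z} \<subseteq> {x}"
      by (rule hull_meet_point[where w = "- v"]) (auto simp: d inner_simps f scaleR_2)
    show "frame v w" "frame v w" by fact+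
  qed (auto simp: d scaleR_2 add_mset_commute)
  hence "piece ((convex hull {a, x, y} \<union> convex hull {x, b, z}) \<union> convex hull {y, z, c}) 6 {#a, a, b, b, c, c#}"
  proof (rule piece_glue_two[OF _ piece_triangle, where k = y and l = z])
    show "frame v w" by fact
    have "convex hull {a, x, y} \<inter> convex hull {y, z, c} \<subseteq> {y}"
      by (rule hull_meet_point[where w = "- w"]) (auto simp: d inner_simps f scaleR_2)
    moreover have "convex hull {x, b, z} \<inter> convex hull {y, z, c} \<subseteq> {z}"
      by (rule hull_meet_point[where w = "v - w"]) (auto simp: d inner_simps f scaleR_2)
    ultimately show "(convex hull {a, x, y} \<union> convex hull {x, b, z}) \<inter> convex hull {y, z, c} \<subseteq> {y, z}" by auto
  qed (use f in \<open>auto simp: d scaleR_2 add_mset_commute\<close>)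
  moreover have "x \<in> convex hull {a, b, c}" "y \<in> convex hull {a, b, c}" "z \<in> convex hull {a, b, c}"
    by (rule double_mem_hull[of a _ b], auto simp: hull_inc d algebra_simps scaleR_2)
       (rule double_mem_hull[of a _ c], auto simp: hull_inc d algebra_simps scaleR_2,
        rule double_mem_hull[of b _ c], auto simp: hull_inc d algebra_simps scaleR_2)
  ultimately show ?thesis
    by (elim piece_mono) (intro Un_least hull_subset_hull, auto simp: hull_inc)
qed

text \<open>A trapezoid with bases 2 and 1: two triangles that share the midpoint of the long base,
  and the short base as an extra edge. The ends of the short base have degree 3, which leaves room
  for one arm of the linkage at each.\<close>

lemma piece_strip5:
  assumes "frame v w" "b = a + 2 *\<^sub>R v" "x = a + w" "y = x + v"
  shows "piece (convex hull {a, b, y, x}) 5 {#a, a, b, b, x, y#}"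
proof -
  note f = frameD[OF assms(1)]
  define m where "m = a + v"
  note d = assms(2-4) m_def
  have "piece (convex hull {a, m, x} \<union> convex hull {m, b, y}) 5 {#a, a, x, x, b, b, y, y#}"
  proof (rule piece_glue_point[OF piece_triangle piece_triangle, where k = m])
    show "convex hull {a, m, x} \<inter> convex hull {m, b, y} \<subseteq> {m}"
      by (rule hull_meet_point[where w = "- v"]) (auto simp: d inner_simps f scaleR_2)
    show "frame v w" "frame v w" by fact+
  qed (auto simp: d scaleR_2 add_mset_commute algebra_simps)
  hence "piece ((convex hull {a, m, x} \<union> convex hull {m, b, y}) \<union> convex hull {x, y}) 5 {#a, a, b, b, x, y#}"
  proof (rule piece_glue_two[OF _ piece_edge, where k = x and l = y])
    have "convex hull {a, m, x} \<inter> convex hull {x, y} \<subseteq> {x}"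
      by (rule hull_meet_point[where w = "- w"]) (auto simp: d inner_simps f scaleR_2)
    moreover have "convex hull {m, b, y} \<inter> convex hull {x, y} \<subseteq> {y}"
      by (rule hull_meet_point[where w = "v - w"]) (auto simp: d inner_simps f scaleR_2)
    ultimately show "(convex hull {a, m, x} \<union> convex hull {m, b, y}) \<inter> convex hull {x, y} \<subseteq> {x, y}" by auto
  qed (use f in \<open>auto simp: d scaleR_2 add_mset_commute\<close>)
  moreover have "m \<in> convex hull {a, b, y, x}"
    by (rule double_mem_hull[of a _ b]) (auto simp: hull_inc d algebra_simps scaleR_2)
  ultimately show ?thesis
    by (elim piece_mono) (intro Un_least hull_subset_hull, auto simp: hull_inc)
qed

lemma piece_strip7:
  assumes "frame v w" "b = a + 3 *\<^sub>R v" "x = a + w" "y = x + 2 *\<^sub>R v"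
  shows "piece (convex hull {a, b, y, x}) 7 {#a, a, b, b, x, y#}"
proof -
  note f = frameD[OF assms(1)]
  define m where "m = a + 2 *\<^sub>R v"
  define z where "z = x + v"
  have d: "m = a + v + v" "z = a + w + v" "b = a + v + v + v" "x = a + w" "y = a + w + v + v"
    using assms(2-4) scaleR_add_left[of 2 1 v] by (auto simp: m_def z_def scaleR_2 algebra_simps)
  have "piece (convex hull {a, m, z, x} \<union> convex hull {m, b, y}) 7 {#a, a, x, z, b, b, y, y#}"
  proof (rule piece_glue_point[OF piece_strip5 piece_triangle, where k = m])
    show "convex hull {a, m, z, x} \<inter> convex hull {m, b, y} \<subseteq> {m}"
      by (rule hull_meet_point[where w = "- v"]) (auto simp: d inner_simps f scaleR_2)
    show "frame v w" "frame v w" by fact+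
  qed (auto simp: d scaleR_2 add_mset_commute algebra_simps)
  hence "piece ((convex hull {a, m, z, x} \<union> convex hull {m, b, y}) \<union> convex hull {z, y}) 7 {#a, a, b, b, x, y#}"
  proof (rule piece_glue_two[OF _ piece_edge, where k = z and l = y])
    have "convex hull {a, m, z, x} \<inter> convex hull {z, y} \<subseteq> {z}"
      by (rule hull_meet_point[where w = "- w"]) (auto simp: d inner_simps f scaleR_2)
    moreover have "convex hull {m, b, y} \<inter> convex hull {z, y} \<subseteq> {y}"
      by (rule hull_meet_point[where w = "v - w"]) (auto simp: d inner_simps f scaleR_2)
    ultimately show "(convex hull {a, m, z, x} \<union> convex hull {m, b, y}) \<inter> convex hull {z, y} \<subseteq> {z, y}" by auto
  qed (use f in \<open>auto simp: d scaleR_2 add_mset_commute\<close>)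
  moreover have z: "z \<in> convex hull {a, b, y, x}"
    by (rule double_mem_hull[of x _ y]) (auto simp: hull_inc d algebra_simps scaleR_2)
  \<comment> \<open>\<open>m\<close> divides the base of length 3 in the ratio 2 : 1, hence the
    explicit weights in place of a midpoint argument.\<close>
  moreover have "m \<in> convex hull {a, b, y, x}"
  proof -
    have "m = (1/3) *\<^sub>R a + (2/3) *\<^sub>R b"
    proof -
      have "3 *\<^sub>R m = 3 *\<^sub>R ((1/3) *\<^sub>R a + (2/3) *\<^sub>R b)"
        using scaleR_add_left[of 1 2 a] by (simp add: assms(2) m_def algebra_simps)
      thus ?thesis by simp
    qed
    thus ?thesis using convexD[OF convex_convex_hull, of a "{a,b,y,x}" b "1/3" "2/3"]
      by (simp add: hull_inc)
  qed
  ultimately show ?thesis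
    by (elim piece_mono) (intro Un_least hull_subset_hull, auto simp: hull_inc)
qed

section \<open>Bars in sectors of a circle\<close>

text \<open>The last clause allows contact with the two bounding rays only on the circle of radius
  \<open>R\<close>, and \<open>0 < r\<close> excludes the centre. Sets in adjacent sectors can
  therefore meet only in the hinge between them.\<close>

definition in_sector :: "real \<Rightarrow> real \<Rightarrow> real \<Rightarrow> complex set \<Rightarrow> bool" where
  "in_sector R a b S \<longleftrightarrow>
     (\<forall>p\<in>S. \<exists>r t. 0 < r \<and> a \<le> t \<and> t \<le> b \<and> p = rcis r t \<and> (t = a \<or> t = b \<longrightarrow> r = R))"

text \<open>\<open>n\<close> is one less than the number of vertices, which makes it additive:
  joining two chains identifies one hinge. Closing a chain identifies two, so a closed polygon has
  exactly the sum of these numbers as its vertex count.\<close>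

definition fan :: "real \<Rightarrow> real \<Rightarrow> nat \<Rightarrow> bool" where
  "fan R \<alpha> n \<longleftrightarrow> (\<exists>S. piece S (Suc n) {#rcis R 0, rcis R 0, rcis R \<alpha>, rcis R \<alpha>#} \<and> in_sector R 0 \<alpha> S)"

lemma cis_mult_rcis: "cis a * rcis r t = rcis r (a + t)"
  by (simp add: rcis_def cis_mult[symmetric] mult_ac)

lemma linear_cis_mult: "linear (\<lambda>z. cis a * z)"
  by (rule linearI) (simp_all add: algebra_simps)

lemma piece_rotate: "piece S n M \<Longrightarrow> piece ((\<lambda>z. cis a * z) ` S) n (image_mset (\<lambda>z. cis a * z) M)"
  by (erule piece_linear_image[OF _ linear_cis_mult]) (simp add: norm_mult)

lemma in_sector_rotate:
  assumes "in_sector R a b S" shows "in_sector R (c + a) (c + b) ((\<lambda>z. cis c * z) ` S)"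
  unfolding in_sector_def
proof
  fix p assume "p \<in> (\<lambda>z. cis c * z) ` S"
  then obtain q where q: "q \<in> S" "p = cis c * q" by blast
  then obtain r t where "0 < r" "a \<le> t" "t \<le> b" "q = rcis r t" "t = a \<or> t = b \<longrightarrow> r = R"
    using assms unfolding in_sector_def by blast
  thus "\<exists>r t. 0 < r \<and> c + a \<le> t \<and> t \<le> c + b \<and> p = rcis r t \<and> (t = c + a \<or> t = c + b \<longrightarrow> r = R)"
    using q by (intro exI[of _ r] exI[of _ "c + t"]) (auto simp: cis_mult_rcis)
qed

lemma rcis_eq_imp:
  assumes "rcis r t = rcis r' t'" "0 < r" "0 < r'" "0 \<le> t' - t" "t' - t \<le> 2 * pi"
  shows "r = r'" "t' = t \<or> t' = t + 2 * pi"
proof -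
  have "cmod (rcis r t) = cmod (rcis r' t')" using assms(1) by simp
  thus r: "r = r'" using assms(2,3) by simp
  hence "cis t = cis t'" using assms by (simp add: rcis_def)
  hence "cis (t' - t) = 1" by (simp add: cis_divide[symmetric])
  hence "Re (cis (t' - t)) = 1" by simp
  hence "cos (t' - t) = 1" by simp
  then obtain k :: int where k: "t' - t = real_of_int k * 2 * pi" using cos_one_2pi_int by blast
  have "k \<ge> 0"
  proof (rule ccontr)
    assume "\<not> k \<ge> 0"
    hence "real_of_int k \<le> - 1" by linarith
    hence "real_of_int k * (2 * pi) \<le> (- 1) * (2 * pi)" by (intro mult_right_mono) auto
    thus False using k assms(4) pi_gt_zero by simp
  qed
  moreover have "k \<le> 1"
  proof (rule ccontr)
    assume "\<not> k \<le> 1"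
    hence "real_of_int k \<ge> 2" by linarith
    hence "real_of_int k * (2 * pi) \<ge> 2 * (2 * pi)" by (intro mult_right_mono) auto
    thus False using k assms(5) pi_gt_zero by simp
  qed
  ultimately have "k = 0 \<or> k = 1" by linarith
  thus "t' = t \<or> t' = t + 2 * pi" using k by auto
qed

text \<open>The arguments of a common point differ by 0 or by a full turn. In the first case both
  are \<open>\<alpha>\<close>, in the second they are 0 and \<open>2 * pi\<close>; on these rays the
  radius is forced to be \<open>R\<close>.\<close>

lemma sectors_meet:
  assumes "in_sector R 0 \<alpha> S" "in_sector R \<alpha> \<beta> T" "0 < \<alpha>" "\<alpha> < \<beta>" "\<beta> \<le> 2 * pi" "p \<in> S" "p \<in> T"
  shows "p = rcis R \<alpha> \<or> p = rcis R 0 \<and> \<beta> = 2 * pi"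
proof -
  obtain r t where 1: "0 < r" "0 \<le> t" "t \<le> \<alpha>" "p = rcis r t" "t = 0 \<or> t = \<alpha> \<longrightarrow> r = R"
    using assms(1,6) unfolding in_sector_def by blast
  obtain r' t' where 2: "0 < r'" "\<alpha> \<le> t'" "t' \<le> \<beta>" "p = rcis r' t'" "t' = \<alpha> \<or> t' = \<beta> \<longrightarrow> r' = R"
    using assms(2,7) unfolding in_sector_def by blast
  have "t' = t \<or> t' = t + 2 * pi"
    using rcis_eq_imp(2)[of r t r' t'] 1 2 assms by auto
  thus ?thesis
  proof
    assume "t' = t"
    hence "t = \<alpha>" using 1(3) 2(2) by simp
    thus ?thesis using 1(4,5) by simp
  next
    assume "t' = t + 2 * pi"
    hence "t = 0" "\<beta> = 2 * pi" using 1(2) 2(3) assms(5) by auto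
    thus ?thesis using 1(4,5) by simp
  qed
qed

lemma rcis_neq:
  assumes "0 < R" "0 < \<alpha>" "\<alpha> < 2 * pi" shows "rcis R 0 \<noteq> rcis R \<alpha>"
proof
  assume "rcis R 0 = rcis R \<alpha>"
  thus False using rcis_eq_imp(2)[of R 0 R \<alpha>] assms by auto
qed

lemma fan_append:
  assumes "fan R \<alpha> m" "fan R \<beta> n" "0 < \<alpha>" "0 < \<beta>" "\<alpha> + \<beta> < 2 * pi" "0 < R"
  shows "fan R (\<alpha> + \<beta>) (m + n)"
proof -
  obtain S where S: "piece S (Suc m) {#rcis R 0, rcis R 0, rcis R \<alpha>, rcis R \<alpha>#}" "in_sector R 0 \<alpha> S"
    using assms(1) unfolding fan_def by blast
  obtain T where T: "piece T (Suc n) {#rcis R 0, rcis R 0, rcis R \<beta>, rcis R \<beta>#}" "in_sector R 0 \<beta> T"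
    using assms(2) unfolding fan_def by blast
  let ?T = "(\<lambda>z. cis \<alpha> * z) ` T"
  have T1: "piece ?T (Suc n) {#rcis R \<alpha>, rcis R \<alpha>, rcis R (\<alpha> + \<beta>), rcis R (\<alpha> + \<beta>)#}"
    using piece_rotate[OF T(1), of \<alpha>] by (simp add: cis_mult_rcis del: rcis_zero_arg)
  have T2: "in_sector R \<alpha> (\<alpha> + \<beta>) ?T" using in_sector_rotate[OF T(2), of \<alpha>] by simp
  have "S \<inter> ?T \<subseteq> {rcis R \<alpha>}" using sectors_meet[OF S(2) T2] assms by auto
  hence "piece (S \<union> ?T) (Suc (m + n)) {#rcis R 0, rcis R 0, rcis R (\<alpha> + \<beta>), rcis R (\<alpha> + \<beta>)#}"
    by (rule piece_glue_point[OF S(1) T1]) (auto simp: add_mset_commute)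
  moreover have "in_sector R 0 (\<alpha> + \<beta>) (S \<union> ?T)"
    unfolding in_sector_def
  proof
    fix p assume "p \<in> S \<union> ?T"
    thus "\<exists>r t. 0 < r \<and> 0 \<le> t \<and> t \<le> \<alpha> + \<beta> \<and> p = rcis r t \<and> (t = 0 \<or> t = \<alpha> + \<beta> \<longrightarrow> r = R)"
    proof
      assume "p \<in> S"
      then obtain r t where "0 < r" "0 \<le> t" "t \<le> \<alpha>" "p = rcis r t" "t = 0 \<or> t = \<alpha> \<longrightarrow> r = R"
        using S(2) unfolding in_sector_def by blast
      thus ?thesis using assms by (intro exI[of _ r] exI[of _ t]) auto
    next
      assume "p \<in> ?T"
      then obtain r t where "0 < r" "\<alpha> \<le> t" "t \<le> \<alpha> + \<beta>" "p = rcis r t" "t = \<alpha> \<or> t = \<alpha> + \<beta> \<longrightarrow> r = R"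
        using T2 unfolding in_sector_def by blast
      thus ?thesis using assms by (intro exI[of _ r] exI[of _ t]) auto
    qed
  qed
  ultimately show ?thesis unfolding fan_def by blast
qed

lemma fan_close:
  assumes "fan R \<alpha> m" "fan R \<beta> n" "0 < \<alpha>" "0 < \<beta>" "\<alpha> + \<beta> = 2 * pi" "0 < R"
  shows "\<exists>S :: complex set. piece S (m + n) {#}"
proof -
  obtain S where S: "piece S (Suc m) {#rcis R 0, rcis R 0, rcis R \<alpha>, rcis R \<alpha>#}" "in_sector R 0 \<alpha> S"
    using assms(1) unfolding fan_def by blast
  obtain T where T: "piece T (Suc n) {#rcis R 0, rcis R 0, rcis R \<beta>, rcis R \<beta>#}" "in_sector R 0 \<beta> T"
    using assms(2) unfolding fan_def by blast
  let ?T = "(\<lambda>z. cis \<alpha> * z) ` T"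
  have "rcis R (2 * pi) = rcis R 0" by (simp add: rcis_def)
  hence T1: "piece ?T (Suc n) {#rcis R \<alpha>, rcis R \<alpha>, rcis R 0, rcis R 0#}"
    using piece_rotate[OF T(1), of \<alpha>] assms(5) by (simp add: cis_mult_rcis del: rcis_zero_arg)
  have T2: "in_sector R \<alpha> (\<alpha> + \<beta>) ?T" using in_sector_rotate[OF T(2), of \<alpha>] by simp
  have "S \<inter> ?T \<subseteq> {rcis R \<alpha>, rcis R 0}" using sectors_meet[OF S(2) T2] assms by auto
  moreover have "rcis R \<alpha> \<noteq> rcis R 0" using rcis_neq[of R \<alpha>] assms by auto
  ultimately have "piece (S \<union> ?T) (m + n) {#}"
    by (rule piece_glue_two[OF S(1) T1]) (auto simp: add_mset_commute)
  thus ?thesis by blast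
qed

lemma fan_list:
  assumes "L \<noteq> []" "\<And>\<phi> c. (\<phi>, c) \<in> set L \<Longrightarrow> 0 < \<phi> \<and> fan R (2 * \<phi>) c" "sum_list (map fst L) < pi" "0 < R"
  shows "fan R (2 * sum_list (map fst L)) (sum_list (map snd L)) \<and> 0 < sum_list (map fst L)"
  using assms
proof (induction L)
  case Nil thus ?case by simp
next
  case (Cons x L)
  obtain \<phi> c where x: "x = (\<phi>, c)" by fastforce
  have f: "0 < \<phi>" "fan R (2 * \<phi>) c" using Cons.prems(2)[of \<phi> c] x by auto
  show ?case
  proof (cases "L = []")
    case True thus ?thesis using f x by simp
  next
    case False
    have "fan R (2 * sum_list (map fst L)) (sum_list (map snd L)) \<and> 0 < sum_list (map fst L)"
      by (rule Cons.IH[OF False]) (use Cons.prems f x in auto)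
    moreover have "2 * \<phi> + 2 * sum_list (map fst L) < 2 * pi" using Cons.prems(3) x by simp
    ultimately have "fan R (2 * \<phi> + 2 * sum_list (map fst L)) (c + sum_list (map snd L))"
      "0 < sum_list (map fst L)"
      using fan_append[OF f(2)] f(1) Cons.prems(4) by auto
    thus ?thesis using f(1) x by (simp add: distrib_left)
  qed
qed

text \<open>The first bar is set aside: the others form an open chain of total half-angle less than
  pi, and the first bar closes it at both ends.\<close>

lemma ring_closed:
  assumes "\<And>\<phi> c. (\<phi>, c) \<in> set L \<Longrightarrow> 0 < \<phi> \<and> \<phi> < pi \<and> fan R (2 * \<phi>) c" "sum_list (map fst L) = pi" "0 < R"
  shows "\<exists>S :: complex set. piece S (sum_list (map snd L)) {#}"
proof -
  have "L \<noteq> []" using assms(2) by auto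
  then obtain \<phi> c L' where L: "L = (\<phi>, c) # L'" by (metis list.exhaust prod.exhaust)
  have f: "0 < \<phi>" "\<phi> < pi" "fan R (2 * \<phi>) c" using assms(1)[of \<phi> c] L by auto
  have "L' \<noteq> []" using assms(2) f L by auto
  hence "fan R (2 * sum_list (map fst L')) (sum_list (map snd L')) \<and> 0 < sum_list (map fst L')"
    by (rule fan_list) (use assms f L in auto)
  thus ?thesis using fan_close[OF f(3), of "2 * sum_list (map fst L')"] f assms(2,3) L by simp
qed

text \<open>The side lengths \<open>2 h\<close> determine the circumradius; it is found by continuity in \<open>s = 1 / R\<close>.\<close>

lemma ring_exists:
  assumes "0 < R0" "\<And>h c. (h, c) \<in> set L \<Longrightarrow> 0 < h \<and> h < R0 \<and> (\<forall>R\<ge>R0. fan R (2 * arcsin (h / R)) c)"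
    and "pi \<le> (\<Sum>(h, c)\<leftarrow>L. arcsin (h / R0))"
  shows "\<exists>S :: complex set. piece S (sum_list (map snd L)) {#}"
proof -
  define g where "g s = (\<Sum>(h, c)\<leftarrow>L. arcsin (h * s))" for s
  have bound: "0 \<le> h * s \<and> h * s < 1" if "(h, c) \<in> set L" "0 \<le> s" "s \<le> 1 / R0" for h c s
  proof -
    have h: "0 < h" "h < R0" using assms(2)[OF that(1)] by auto
    have "h * s \<le> h * (1 / R0)" using that h by (intro mult_left_mono) auto
    also have "\<dots> < 1" using h assms(1) by simp
    finally show ?thesis using that h by simp
  qed
  have "continuous_on {0..1 / R0} (\<lambda>s. \<Sum>(h, c)\<leftarrow>L'. arcsin (h * s))" if "set L' \<subseteq> set L" for L'
    using that
  proof (induction L')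
    case Nil thus ?case by simp
  next
    case (Cons x L')
    obtain h c where x: "x = (h, c)" by fastforce
    have "continuous_on {0..1 / R0} (\<lambda>s. arcsin (h * s))"
      by (rule continuous_on_arcsin) (use bound[of h c] Cons.prems x in \<open>force intro!: continuous_intros\<close>)+
    thus ?case using Cons x by (auto intro!: continuous_on_add)
  qed
  hence "continuous_on {0..1 / R0} g" unfolding g_def by auto
  \<comment> \<open>\<open>s = 0\<close> stands for an infinite circle, where all angles vanish; on
    the circle of radius \<open>R0\<close> the bars fill at least a full turn.\<close>
  moreover have g0: "g 0 = 0" unfolding g_def by (induction L) auto
  moreover have "pi \<le> g (1 / R0)" using assms(3) by (simp add: g_def)
  ultimately obtain s where s: "0 \<le> s" "s \<le> 1 / R0" "g s = pi"
    using IVT'[of g 0 pi "1 / R0"] assms(1) by auto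
  have "s \<noteq> 0" using s(3) g0 by auto
  hence s0: "0 < s" using s by simp
  define R where "R = 1 / s"
  have R: "R0 \<le> R" "s = 1 / R" "0 < R"
    using s s0 assms(1) by (auto simp: R_def field_simps)
  have "\<exists>S :: complex set. piece S (sum_list (map snd (map (\<lambda>(h, c). (arcsin (h / R), c)) L))) {#}"
  proof (rule ring_closed)
    fix \<phi> c assume "(\<phi>, c) \<in> set (map (\<lambda>(h, c). (arcsin (h / R), c)) L)"
    then obtain h where h: "(h, c) \<in> set L" "\<phi> = arcsin (h / R)" by auto
    have b: "0 < h / R" "h / R < 1" using bound[OF h(1) s(1,2)] assms(2)[OF h(1)] R by auto
    have "0 < \<phi>" using arcsin_less_mono[of 0 "h / R"] b by (simp add: h(2))
    moreover have "\<phi> \<le> pi / 2" using arcsin_bounded[of "h / R"] b by (simp add: h(2))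
    hence "\<phi> < pi" using pi_gt_zero by linarith
    ultimately show "0 < \<phi> \<and> \<phi> < pi \<and> fan R (2 * \<phi>) c"
      using assms(2)[OF h(1)] R(1) h(2) by simp
  next
    have "map fst (map (\<lambda>(h, c). (arcsin (h / R), c)) L) = map (\<lambda>(h, c). arcsin (h * s)) L"
      by (auto simp: R(2))
    thus "sum_list (map fst (map (\<lambda>(h, c). (arcsin (h / R), c)) L)) = pi"
      using s(3) unfolding g_def by (simp only:)
  qed (rule R(3))
  moreover have "map snd (map (\<lambda>(h, c). (arcsin (h / R), c)) L) = map snd L" by auto
  ultimately show ?thesis by (simp only:)
qed

text \<open>In the half-plane above the axis \<open>a b\<close>, the last condition keeps the body inside the sector between the
  axis and the ray through \<open>c\<close> whenever the tangent of its angle is at most \<open>\<tau>\<close>.\<close>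

definition body :: "nat \<Rightarrow> real \<Rightarrow> real \<Rightarrow> bool" where
  "body n h \<tau> \<longleftrightarrow> (\<exists>S a b c. piece S n {#a, a, b, b, c, c#} \<and> a \<noteq> b \<and> Im a = 0 \<and> Im b = 0 \<and> Im c = h \<and>
     (\<forall>z\<in>S. (z = a \<or> z = b \<or> 0 < Im z) \<and> (z = c \<or> Im z < h \<and> Im z - h < \<tau> * (Re z - Re c))))"

lemma linear_cnj: "linear cnj"
  by (rule linearI) simp_all

text \<open>The circle is centred at the origin and the axis \<open>a b\<close> lies on the real
  line, so conjugation produces the other half of the bar. As \<open>Im c = R * sin \<phi>\<close>
  already holds, a shift along the axis suffices to bring \<open>c\<close> to the point of the
  circle with argument \<open>\<phi>\<close>.\<close>

lemma fan_of_body: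
  assumes "body n h \<tau>" "0 < \<phi>" "\<phi> < pi / 2" "0 < R" "h = R * sin \<phi>" "tan \<phi> \<le> \<tau>"
  shows "fan R (2 * \<phi>) (2 * n - 3)"
proof -
  obtain S a b c where S: "piece S n {#a, a, b, b, c, c#}" and ab: "a \<noteq> b" "Im a = 0" "Im b = 0" "Im c = h"
    and in_S: "\<And>z. z \<in> S \<Longrightarrow> (z = a \<or> z = b \<or> 0 < Im z) \<and> (z = c \<or> Im z < h \<and> Im z - h < \<tau> * (Re z - Re c))"
    using assms(1) unfolding body_def by blast
  define d where "d = complex_of_real (R * cos \<phi> - Re c)"
  define S1 where "S1 = (+) d ` S"
  define S2 where "S2 = cnj ` S1"
  let ?a = "d + a" and ?b = "d + b"
  have h: "0 < h" using assms sin_gt_zero2[of \<phi>] by simp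
  have dc: "d + c = rcis R \<phi>" using ab assms(5) by (simp add: d_def complex_eq_iff)
  have cc: "cnj (rcis R \<phi>) = rcis R (- \<phi>)" by (simp add: complex_eq_iff)
  have p1: "piece S1 n {#?a, ?a, ?b, ?b, rcis R \<phi>, rcis R \<phi>#}"
    using piece_translate[OF S, of d] unfolding S1_def by (simp add: dc)
  have real: "cnj ?a = ?a" "cnj ?b = ?b" using ab by (auto simp: complex_eq_iff d_def)
  have p2: "piece S2 n {#?a, ?a, ?b, ?b, rcis R (- \<phi>), rcis R (- \<phi>)#}"
    using piece_linear_image[OF p1 linear_cnj] unfolding S2_def by (simp add: real[simplified] cc)
  have pos: "z = ?a \<or> z = ?b \<or> 0 < Im z" if zS: "z \<in> S1" for z
  proof -
    obtain y where y: "y \<in> S" "z = d + y" using zS unfolding S1_def by blast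
    have "Im d = 0" by (simp add: d_def)
    thus ?thesis using in_S[OF y(1)] y(2) by auto
  qed
  have meet: "S1 \<inter> S2 \<subseteq> {?a, ?b}"
  proof
    fix z assume z: "z \<in> S1 \<inter> S2"
    hence "z = ?a \<or> z = ?b \<or> 0 < Im z" using pos by auto
    moreover have "z = ?a \<or> z = ?b \<or> Im z < 0"
    proof -
      obtain y where y: "y \<in> S1" "z = cnj y" using z unfolding S2_def by blast
      show ?thesis using pos[OF y(1)] real unfolding y(2) by auto
    qed
    ultimately show "z \<in> {?a, ?b}" by auto
  qed
  \<comment> \<open>This keeps the natural-number subtraction in \<open>2 * n - 3\<close> from
    truncating.\<close>
  have "Suc (Suc 0) \<le> n"
  proof -
    obtain V E where "unit_graph V E" "card V = n" "set_mset {#a, a, b, b, c, c#} \<subseteq> V"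
      using S unfolding piece_def by blast
    hence "card {a, b} \<le> n" using card_mono[of V "{a, b}"] unit_graphD(1) by auto
    thus ?thesis using ab by simp
  qed
  hence "n + n = Suc (Suc (Suc (2 * n - 3)))" by simp
  hence p: "piece (S1 \<union> S2) (Suc (2 * n - 3)) {#rcis R (- \<phi>), rcis R (- \<phi>), rcis R \<phi>, rcis R \<phi>#}"
    by (intro piece_glue_two[OF p1 p2 meet]) (use ab in \<open>auto simp: add_mset_commute\<close>)
  have polar: "\<exists>r t. 0 < r \<and> 0 \<le> t \<and> t \<le> \<phi> \<and> z = rcis r t \<and> (t = \<phi> \<longrightarrow> r = R)" if z: "z \<in> S1" for z
  proof (cases "z = rcis R \<phi>")
    case True thus ?thesis using assms by (intro exI[of _ R] exI[of _ \<phi>]) auto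
  next
    case False
    obtain y where y: "y \<in> S" "z = d + y" using z unfolding S1_def by blast
    have "y \<noteq> c" using False y dc by auto
    hence *: "Im z < h" "Im z - h < \<tau> * (Re z - R * cos \<phi>)" using in_S[OF y(1)] y(2) by (auto simp: d_def)
    have t0: "0 < cos \<phi>" "0 < tan \<phi>" using assms by (auto intro!: cos_gt_zero tan_gt_zero)
    have im: "0 \<le> Im z" using pos[OF z] ab by (auto simp: d_def)
    \<comment> \<open>To the right of \<open>c\<close> the bound \<open>Im z < h\<close> is enough;
      to the left of it, replacing \<open>\<tau>\<close> by the smaller slope
      \<open>tan \<phi>\<close> weakens the condition. Thus a body with a large
      \<open>\<tau>\<close> fits into many sectors.\<close>
    have "Im z - h < tan \<phi> * (Re z - R * cos \<phi>)"
    proof (cases "R * cos \<phi> \<le> Re z")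
      case True
      hence "0 \<le> tan \<phi> * (Re z - R * cos \<phi>)" using t0 by simp
      thus ?thesis using * by linarith
    next
      case False
      hence "\<tau> * (Re z - R * cos \<phi>) \<le> tan \<phi> * (Re z - R * cos \<phi>)"
        using assms(6) by (intro mult_right_mono_neg) auto
      thus ?thesis using * by linarith
    qed
    \<comment> \<open>The line of slope \<open>tan \<phi>\<close> through the shifted
      \<open>c\<close> passes through the centre, so the inequality says that the argument of
      \<open>z\<close> is below \<open>\<phi>\<close>.\<close>
    moreover have "tan \<phi> * (R * cos \<phi>) = h" using t0 assms(5) by (simp add: tan_def)
    ultimately have lt: "Im z < tan \<phi> * Re z" by (simp add: algebra_simps)
    hence re: "0 < Re z" using im t0 zero_less_mult_pos[of "tan \<phi>" "Re z"] by linarith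
    define t where "t = arctan (Im z / Re z)"
    have zt: "z = rcis (cmod z) t" using rcis_cmod_Arg[of z] arg_conv_arctan[OF re] by (simp add: t_def)
    have "Im z / Re z < tan \<phi>" using lt re by (simp add: field_simps)
    hence "t < arctan (tan \<phi>)" unfolding t_def by (rule arctan_monotone)
    also have "arctan (tan \<phi>) = \<phi>" using assms by (intro arctan_tan) auto
    finally have "t < \<phi>" .
    moreover have "0 \<le> t" unfolding t_def using im re by simp
    moreover have "0 < cmod z" using re by auto
    ultimately show ?thesis using zt by (intro exI[of _ "cmod z"] exI[of _ t]) auto
  qed
  have "in_sector R (- \<phi>) \<phi> (S1 \<union> S2)"
    unfolding in_sector_def
  proof
    fix p assume "p \<in> S1 \<union> S2"
    thus "\<exists>r t. 0 < r \<and> - \<phi> \<le> t \<and> t \<le> \<phi> \<and> p = rcis r t \<and> (t = - \<phi> \<or> t = \<phi> \<longrightarrow> r = R)"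
    proof
      assume "p \<in> S1"
      then obtain r t where "0 < r" "0 \<le> t" "t \<le> \<phi>" "p = rcis r t" "t = \<phi> \<longrightarrow> r = R" using polar by blast
      thus ?thesis using assms(2) by (intro exI[of _ r] exI[of _ t]) auto
    next
      assume "p \<in> S2"
      then obtain r t where "0 < r" "0 \<le> t" "t \<le> \<phi>" "p = cnj (rcis r t)" "t = \<phi> \<longrightarrow> r = R"
        using polar unfolding S2_def by blast
      thus ?thesis using assms(2)
        by (intro exI[of _ r] exI[of _ "-t"]) (auto simp: complex_eq_iff)
    qed
  qed
  \<comment> \<open>The bar is symmetric about the real axis; a rotation by \<open>\<phi>\<close>
    moves its sector to start at angle 0, as \<open>fan\<close> expects.\<close>
  from in_sector_rotate[OF this, of \<phi>] piece_rotate[OF p, of \<phi>] show ?thesis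
    unfolding fan_def by (intro exI[of _ "(\<lambda>z. cis \<phi> * z) ` (S1 \<union> S2)"]) (simp add: cis_mult_rcis del: rcis_zero_arg)
qed

section \<open>Numerical criteria for bars and polygons\<close>

lemma sin_le_taylor:
  fixes x :: real
  assumes "0 \<le> x"
  shows "sin x \<le> x - x ^ 3 / 6 + x ^ 5 / 120 - x ^ 7 / 5040 + x ^ 9 / 362880"
proof -
  have "{..<9} = {0, 1, 2, 3, 4, 5, 6, 7, 8 :: nat}" by auto
  hence "(\<Sum>m<9. sin_coeff m * x ^ m) = x - x ^ 3 / 6 + x ^ 5 / 120 - x ^ 7 / 5040"
    by (simp add: sin_coeff_def fact_numeral)
  moreover have "inverse (fact 9) * \<bar>x\<bar> ^ 9 = x ^ 9 / 362880"
    using assms by (simp add: fact_numeral)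
  ultimately show ?thesis using Maclaurin_sin_bound[of x 9] by linarith
qed

text \<open>\<open>link R\<^sub>0 c \<theta>\<close>: a bar contributing \<open>c\<close> vertices that fits into every circle of radius at least \<open>R\<^sub>0\<close>
  and spans at least the half-angle \<open>\<theta>\<close> in the smallest of them.\<close>

definition link :: "real \<Rightarrow> nat \<Rightarrow> real \<Rightarrow> bool" where
  "link R0 c \<theta> \<longleftrightarrow> (\<exists>h. 0 < h \<and> h < R0 \<and> (\<forall>R\<ge>R0. fan R (2 * arcsin (h / R)) c) \<and> \<theta> \<le> arcsin (h / R0))"

text \<open>With \<open>s = h / R\<close>, the requirement
  \<open>tan (arcsin s) \<le> \<tau>\<close> is equivalent to
  \<open>s^2 * (1 + \<tau>^2) \<le> \<tau>^2\<close>. Its left side decreases with \<open>R\<close>,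
  so the premise for the upper bound \<open>u\<close> of \<open>h\<close> at \<open>R0\<close>
  covers all larger circles.\<close>

lemma link_of_body:
  assumes "body n h \<tau>" "0 < l" "l \<le> h" "h \<le> u" "u < R0" "0 < \<tau>" "u\<^sup>2 * (1 + \<tau>\<^sup>2) \<le> (\<tau> * R0)\<^sup>2"
    and "0 \<le> \<theta>" "\<theta> \<le> 3 / 2" "R0 * (\<theta> - \<theta> ^ 3 / 6 + \<theta> ^ 5 / 120 - \<theta> ^ 7 / 5040 + \<theta> ^ 9 / 362880) \<le> l"
  shows "link R0 (2 * n - 3) \<theta>"
  unfolding link_def
proof (intro exI[of _ h] conjI allI impI)
  show h: "0 < h" "h < R0" using assms by auto
  fix R assume R: "R0 \<le> R"
  have hR: "0 < h / R" "h / R < 1" using h R by auto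
  let ?s = "h / R"
  have "?s\<^sup>2 * (1 + \<tau>\<^sup>2) \<le> \<tau>\<^sup>2"
  proof -
    have "h\<^sup>2 * (1 + \<tau>\<^sup>2) \<le> u\<^sup>2 * (1 + \<tau>\<^sup>2)" using assms h by (intro mult_right_mono power_mono) auto
    also have "\<dots> \<le> (\<tau> * R0)\<^sup>2" by (rule assms)
    also have "\<dots> \<le> (\<tau> * R)\<^sup>2" using R assms h by (intro power_mono mult_left_mono) auto
    finally have "h\<^sup>2 * (1 + \<tau>\<^sup>2) \<le> \<tau>\<^sup>2 * R\<^sup>2" by (simp add: power_mult_distrib)
    thus ?thesis using R h by (simp add: power_divide divide_le_eq)
  qed
  hence le: "?s\<^sup>2 \<le> \<tau>\<^sup>2 * (1 - ?s\<^sup>2)" by (simp add: algebra_simps)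
  have s1: "0 < 1 - ?s\<^sup>2" using hR by (simp add: power_strict_mono[of ?s 1 2, simplified])
  have "tan (arcsin ?s) = ?s / sqrt (1 - ?s\<^sup>2)" using hR by (simp add: tan_def sin_arcsin cos_arcsin)
  also have "\<dots> \<le> \<tau>"
  proof -
    have "?s = sqrt (?s\<^sup>2)" using hR(1) by (simp only: real_sqrt_abs abs_of_pos)
    also have "\<dots> \<le> sqrt (\<tau>\<^sup>2 * (1 - ?s\<^sup>2))" using le by (simp only: real_sqrt_le_iff)
    also have "\<dots> = \<tau> * sqrt (1 - ?s\<^sup>2)" using assms(6) by (simp add: real_sqrt_mult)
    finally show ?thesis using s1 by (simp only: divide_le_eq real_sqrt_gt_0_iff if_True)
  qed
  finally have tan: "tan (arcsin ?s) \<le> \<tau>" .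
  have "arcsin 0 < arcsin ?s" "arcsin ?s < arcsin 1" using arcsin_less_arcsin[of 0 ?s] arcsin_less_arcsin[of ?s 1] hR by auto
  thus "fan R (2 * arcsin ?s) (2 * n - 3)"
  proof (intro fan_of_body[OF assms(1)])
    have "sin (arcsin ?s) = ?s" using hR by (intro sin_arcsin) auto
    thus "h = R * sin (arcsin ?s)" using R h by simp
  qed (use tan R h in auto)
next
  have R0: "0 < R0" using assms by linarith
  \<comment> \<open>The bound \<open>\<theta> \<le> arcsin (h / R0)\<close> is turned into
    \<open>R0 * sin \<theta> \<le> l\<close>, and the sine into its Taylor polynomial with the
    remainder term \<open>x ^ 9 / 9!\<close> added, so that only rational arithmetic
    remains.\<close>
  hence "R0 * sin \<theta> \<le> l" using mult_left_mono[OF sin_le_taylor[OF assms(8)], of R0] assms(10) by linarith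
  hence "sin \<theta> \<le> l / R0" using R0 by (simp add: pos_le_divide_eq mult.commute)
  also have "\<dots> \<le> h / R0" using assms by (simp add: divide_right_mono)
  finally have s: "sin \<theta> \<le> h / R0" .
  have "\<theta> = arcsin (sin \<theta>)" using assms(8,9) pi_gt3 by (intro arcsin_sin[symmetric]) auto
  also have "\<dots> \<le> arcsin (h / R0)" using s assms by (intro arcsin_le_arcsin) auto
  finally show "\<theta> \<le> arcsin (h / R0)" .
qed

lemma ring_of_links:
  assumes "0 < R0" "\<And>c \<theta>. (c, \<theta>) \<in> set L \<Longrightarrow> link R0 c \<theta>" "3.1416 \<le> sum_list (map snd L)"
  shows "\<exists>S :: complex set. piece S (sum_list (map fst L)) {#}"
proof -
  define H where "H p = (SOME h. 0 < h \<and> h < R0 \<and> (\<forall>R\<ge>R0. fan R (2 * arcsin (h / R)) (fst p)) \<and> snd p \<le> arcsin (h / R0))" for p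
  have H: "0 < H p \<and> H p < R0 \<and> (\<forall>R\<ge>R0. fan R (2 * arcsin (H p / R)) (fst p)) \<and> snd p \<le> arcsin (H p / R0)"
    if "p \<in> set L" for p
    unfolding H_def by (rule someI_ex) (use assms(2)[of "fst p" "snd p"] that in \<open>simp add: link_def\<close>)
  have "\<exists>S :: complex set. piece S (sum_list (map snd (map (\<lambda>p. (H p, fst p)) L))) {#}"
  proof (rule ring_exists[OF assms(1)])
    show "0 < h \<and> h < R0 \<and> (\<forall>R\<ge>R0. fan R (2 * arcsin (h / R)) c)" if "(h, c) \<in> set (map (\<lambda>p. (H p, fst p)) L)" for h c
      using that H by auto
    have "sum_list (map snd L) \<le> sum_list (map (\<lambda>p. arcsin (H p / R0)) L)"
      by (rule sum_list_mono) (use H in auto)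
    thus "pi \<le> (\<Sum>(h, c)\<leftarrow>map (\<lambda>p. (H p, fst p)) L. arcsin (h / R0))"
      using assms(3) pi_less_4 pi_approx by (simp add: comp_def)
  qed
  thus ?thesis by (simp add: comp_def)
qed

text \<open>The geometry is carried out in \<open>complex\<close>, where rotations are
  multiplications; this isometry moves the finished graph to the plane of the statement.\<close>

definition to_vec :: "complex \<Rightarrow> real ^ 2" where
  "to_vec z = (\<chi> i. if i = 1 then Re z else Im z)"

lemma piece_to_vec:
  assumes "piece S n M" shows "piece (to_vec ` S) n (image_mset to_vec M)"
proof (rule piece_linear_image[OF assms])
  show "linear to_vec" by (rule linearI) (simp_all add: to_vec_def vec_eq_iff)
  show "norm (to_vec x) = norm x" for x
    by (simp add: norm_vec_def L2_set_def sum_2 to_vec_def cmod_def)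
qed

section \<open>Approximate positions and a four-bar linkage\<close>

text \<open>Every vertex is known up to a small error; the separation conditions below are then
  inequalities between decimal numbers.\<close>

definition near :: "complex \<Rightarrow> real \<Rightarrow> real \<Rightarrow> real \<Rightarrow> bool" where
  "near z a b e \<longleftrightarrow> \<bar>Re z - a\<bar> \<le> e \<and> \<bar>Im z - b\<bar> \<le> e"

lemma near_mono: "near z a b e \<Longrightarrow> \<bar>a - a'\<bar> + e \<le> e' \<Longrightarrow> \<bar>b - b'\<bar> + e \<le> e' \<Longrightarrow> near z a' b' e'"
  unfolding near_def by linarith

lemma near_real: "near (of_real a) a 0 0"
  by (simp add: near_def)

lemma near_numeral: "near (numeral k) (numeral k) 0 0" "near 1 1 0 0" "near 0 0 0 0"
  by (simp_all add: near_def)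

lemma near_add: "near x a b e \<Longrightarrow> near y c d f \<Longrightarrow> near (x + y) (a + c) (b + d) (e + f)"
  unfolding near_def by auto

lemma near_diff: "near x a b e \<Longrightarrow> near y c d f \<Longrightarrow> near (x - y) (a - c) (b - d) (e + f)"
  unfolding near_def by auto

lemma near_minus: "near x a b e \<Longrightarrow> near (- x) (- a) (- b) e"
  unfolding near_def by auto

lemma near_cnj: "near x a b e \<Longrightarrow> near (cnj x) a (- b) e"
  unfolding near_def by auto

lemma near_scale2: "near x a b e \<Longrightarrow> near (2 * x) (2 * a) (2 * b) (2 * e)"
  unfolding near_def by auto

lemma near_ii: "near x a b e \<Longrightarrow> near (\<i> * x) (- b) a e"
  unfolding near_def by auto

lemma approx_mult:
  fixes x y :: real
  assumes "\<bar>x - a\<bar> \<le> e" "\<bar>y - b\<bar> \<le> f"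
  shows "\<bar>x * y - a * b\<bar> \<le> \<bar>a\<bar> * f + \<bar>b\<bar> * e + e * f"
proof -
  have "x * y - a * b = a * (y - b) + b * (x - a) + (x - a) * (y - b)" by (simp add: algebra_simps)
  hence "\<bar>x * y - a * b\<bar> \<le> \<bar>a * (y - b)\<bar> + \<bar>b * (x - a)\<bar> + \<bar>(x - a) * (y - b)\<bar>" by linarith
  also have "\<dots> = \<bar>a\<bar> * \<bar>y - b\<bar> + \<bar>b\<bar> * \<bar>x - a\<bar> + \<bar>x - a\<bar> * \<bar>y - b\<bar>" by (simp add: abs_mult)
  also have "\<dots> \<le> \<bar>a\<bar> * f + \<bar>b\<bar> * e + e * f"
    using assms by (intro add_mono mult_left_mono mult_mono) auto
  finally show ?thesis .
qed

lemma approx_add_diff: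
  fixes x y :: real
  assumes "\<bar>x - a\<bar> \<le> e" "\<bar>y - b\<bar> \<le> f"
  shows "\<bar>a - b - p\<bar> + (e + f) \<le> g \<Longrightarrow> \<bar>x - y - p\<bar> \<le> g"
    "\<bar>a + b - p\<bar> + (e + f) \<le> g \<Longrightarrow> \<bar>x + y - p\<bar> \<le> g"
  using assms by linarith+

text \<open>\<open>p\<close> and \<open>q\<close> may be rounded values: the premises add the
  rounding error to the propagated one, which keeps the decimals short along a chain of
  computations.\<close>

lemma near_mult:
  assumes "near x a b e" "near y c d f"
    and "\<bar>a * c - b * d - p\<bar> + ((\<bar>a\<bar> + \<bar>b\<bar>) * f + (\<bar>c\<bar> + \<bar>d\<bar>) * e + 2 * e * f) \<le> g"
    and "\<bar>a * d + b * c - q\<bar> + ((\<bar>a\<bar> + \<bar>b\<bar>) * f + (\<bar>c\<bar> + \<bar>d\<bar>) * e + 2 * e * f) \<le> g"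
  shows "near (x * y) p q g"
proof -
  have n: "\<bar>Re x - a\<bar> \<le> e" "\<bar>Im x - b\<bar> \<le> e" "\<bar>Re y - c\<bar> \<le> f" "\<bar>Im y - d\<bar> \<le> f"
    using assms(1,2) by (auto simp: near_def)
  have eq: "(\<bar>a\<bar> + \<bar>b\<bar>) * f + (\<bar>c\<bar> + \<bar>d\<bar>) * e + 2 * e * f
    = (\<bar>a\<bar> * f + \<bar>c\<bar> * e + e * f) + (\<bar>b\<bar> * f + \<bar>d\<bar> * e + e * f)"
    "(\<bar>a\<bar> + \<bar>b\<bar>) * f + (\<bar>c\<bar> + \<bar>d\<bar>) * e + 2 * e * f
    = (\<bar>a\<bar> * f + \<bar>d\<bar> * e + e * f) + (\<bar>b\<bar> * f + \<bar>c\<bar> * e + e * f)"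
    by (simp_all add: algebra_simps)
  show ?thesis unfolding near_def times_complex.sel
    by (intro conjI approx_add_diff(1)[OF approx_mult[OF n(1,3)] approx_mult[OF n(2,4)]]
          approx_add_diff(2)[OF approx_mult[OF n(1,4)] approx_mult[OF n(2,3)]])
       (use assms(3,4) in \<open>simp_all only: eq\<close>)
qed

text \<open>The proposed quotient is verified by multiplying back: its error times \<open>y\<close>
  is at most \<open>2 * k\<close> in modulus, while \<open>cmod y\<close> is at least
  \<open>m\<close>.\<close>

lemma near_divide:
  assumes "near x a b e" "near y c d f" "0 < m" "m \<le> \<bar>c\<bar> - f"
    and "\<bar>p * c - q * d - a\<bar> + (e + (\<bar>p\<bar> + \<bar>q\<bar>) * f) \<le> k"
    and "\<bar>p * d + q * c - b\<bar> + (e + (\<bar>p\<bar> + \<bar>q\<bar>) * f) \<le> k" and "2 * k \<le> m * g"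
  shows "near (x / y) p q g"
proof -
  define z where "z = x / y - Complex p q"
  have my: "m \<le> cmod y" using assms(2,4) abs_Re_le_cmod[of y] unfolding near_def by linarith
  hence y: "y \<noteq> 0" using assms(3) by auto
  have zy: "z * y = x - Complex p q * y" using y by (simp add: z_def algebra_simps)
  have "near (Complex p q) p q 0" by (simp add: near_def)
  have pq: "\<bar>Re (Complex p q * y) - (p * c - q * d)\<bar> \<le> (\<bar>p\<bar> + \<bar>q\<bar>) * f"
      "\<bar>Im (Complex p q * y) - (p * d + q * c)\<bar> \<le> (\<bar>p\<bar> + \<bar>q\<bar>) * f"
    using near_mult[OF \<open>near (Complex p q) p q 0\<close> assms(2),
        of "p * c - q * d" "(\<bar>p\<bar> + \<bar>q\<bar>) * f" "p * d + q * c"]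
    by (simp_all add: near_def del: times_complex.sel)
  have "\<bar>Re (z * y)\<bar> \<le> k" "\<bar>Im (z * y)\<bar> \<le> k"
    unfolding zy minus_complex.sel using pq assms(1,5,6) unfolding near_def by linarith+
  hence "cmod (z * y) \<le> 2 * k" using cmod_le[of "z * y"] by linarith
  hence "cmod z * cmod y \<le> m * g" using assms(7) by (simp add: norm_mult)
  moreover have "m * cmod z \<le> cmod z * cmod y" using my by (metis mult.commute mult_left_mono norm_ge_zero)
  ultimately have "m * cmod z \<le> m * g" by linarith
  hence "cmod z \<le> g" using assms(3) by simp
  hence "\<bar>Re z\<bar> \<le> g" "\<bar>Im z\<bar> \<le> g" using abs_Re_le_cmod[of z] abs_Im_le_cmod[of z] by linarith+
  thus ?thesis by (simp add: near_def z_def)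
qed

lemma near_inner_pos:
  assumes "near x a b e" "near s c d f"
    and "(\<bar>p\<bar> + \<bar>q\<bar>) * (e + f) < p * (a - c) + q * (b - d)"
  shows "0 < Complex p q \<bullet> (x - s)"
proof -
  have n: "\<bar>Re (x - s) - (a - c)\<bar> \<le> e + f" "\<bar>Im (x - s) - (b - d)\<bar> \<le> e + f"
    using assms(1,2) by (auto simp: near_def)
  have "\<bar>p * (Re (x - s) - (a - c))\<bar> \<le> \<bar>p\<bar> * (e + f)" "\<bar>q * (Im (x - s) - (b - d))\<bar> \<le> \<bar>q\<bar> * (e + f)"
    using n by (auto simp: abs_mult intro!: mult_left_mono)
  hence "p * (a - c) + q * (b - d) - (\<bar>p\<bar> + \<bar>q\<bar>) * (e + f) \<le> p * Re (x - s) + q * Im (x - s)"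
    unfolding right_diff_distrib distrib_right by linarith
  thus ?thesis using assms(3) by (simp add: inner_complex_def)
qed

lemma near_inner_neg:
  assumes "near x a b e" "near s c d f"
    and "(\<bar>p\<bar> + \<bar>q\<bar>) * (f + e) < p * (c - a) + q * (d - b)"
  shows "Complex p q \<bullet> (x - s) < 0"
  using near_inner_pos[OF assms(2,1,3)] by (simp add: inner_diff_right)

lemma near_inner_gt:
  assumes "near x a b e" "(\<bar>p\<bar> + \<bar>q\<bar>) * e < p * a + q * b - c"
  shows "c < Complex p q \<bullet> x"
proof -
  have "\<bar>p * (Re x - a)\<bar> \<le> \<bar>p\<bar> * e" "\<bar>q * (Im x - b)\<bar> \<le> \<bar>q\<bar> * e"
    using assms(1) by (auto simp: near_def abs_mult intro!: mult_left_mono)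
  thus ?thesis using assms(2) unfolding inner_complex_def right_diff_distrib distrib_right
    by (simp add: abs_le_iff)
qed

lemma near_inner_lt:
  assumes "near x a b e" "(\<bar>p\<bar> + \<bar>q\<bar>) * e < c - (p * a + q * b)"
  shows "Complex p q \<bullet> x < c"
  using near_inner_gt[of x a b e "- p" "- q" "- c"] assms by (simp add: inner_complex_def)

text \<open>Separating directions can be picked as exact small vectors. The normal of a body's axis
  is determined by the body and known only approximately, so its own error \<open>g\<close> enters
  here.\<close>

lemma near_inner_pos':
  assumes "near w p q g" "near x a b e" "near s c d f"
    and "(\<bar>p\<bar> + \<bar>q\<bar>) * (e + f) + g * (\<bar>a - c\<bar> + \<bar>b - d\<bar> + 2 * (e + f)) < p * (a - c) + q * (b - d)"
  shows "0 < w \<bullet> (x - s)"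
proof -
  have n: "\<bar>Re (x - s) - (a - c)\<bar> \<le> e + f" "\<bar>Im (x - s) - (b - d)\<bar> \<le> e + f"
    using assms(2,3) by (auto simp: near_def)
  have w: "\<bar>Re w - p\<bar> \<le> g" "\<bar>Im w - q\<bar> \<le> g" using assms(1) by (auto simp: near_def)
  have "(\<bar>p\<bar> * (e + f) + \<bar>a - c\<bar> * g + g * (e + f)) + (\<bar>q\<bar> * (e + f) + \<bar>b - d\<bar> * g + g * (e + f))
    < p * (a - c) + q * (b - d)"
    using assms(4) by (simp add: algebra_simps)
  moreover have "p * (a - c) - (\<bar>p\<bar> * (e + f) + \<bar>a - c\<bar> * g + g * (e + f)) \<le> Re w * Re (x - s)"
    using approx_mult[OF w(1) n(1)] by linarith
  moreover have "q * (b - d) - (\<bar>q\<bar> * (e + f) + \<bar>b - d\<bar> * g + g * (e + f)) \<le> Im w * Im (x - s)"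
    using approx_mult[OF w(2) n(2)] by linarith
  ultimately show ?thesis unfolding inner_complex_def by linarith
qed

lemmas near_pos = near_inner_pos[THEN disjI2]
  and near_neg = near_inner_neg[THEN disjI2]
  and near_pos' = near_inner_pos'[THEN disjI2]

lemma near_norm_less:
  assumes "near x a b e" "(\<bar>a\<bar> + e)\<^sup>2 + (\<bar>b\<bar> + e)\<^sup>2 \<le> s\<^sup>2" "0 \<le> s" shows "cmod x \<le> s"
proof -
  have "\<bar>Re x\<bar> \<le> \<bar>a\<bar> + e" "\<bar>Im x\<bar> \<le> \<bar>b\<bar> + e" using assms(1) by (auto simp: near_def)
  hence "(Re x)\<^sup>2 \<le> (\<bar>a\<bar> + e)\<^sup>2" "(Im x)\<^sup>2 \<le> (\<bar>b\<bar> + e)\<^sup>2" by (auto intro!: abs_le_square_iff[THEN iffD1])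
  hence "(cmod x)\<^sup>2 \<le> s\<^sup>2" using assms(2) unfolding cmod_power2 by linarith
  thus ?thesis using assms(3) by (rule power2_le_imp_le)
qed

lemma near_norm_greater:
  assumes "near x a b e" "e \<le> \<bar>a\<bar>" "e \<le> \<bar>b\<bar>" "s\<^sup>2 \<le> (\<bar>a\<bar> - e)\<^sup>2 + (\<bar>b\<bar> - e)\<^sup>2" shows "s \<le> cmod x"
proof -
  have "\<bar>a\<bar> - e \<le> \<bar>Re x\<bar>" "\<bar>b\<bar> - e \<le> \<bar>Im x\<bar>" using assms(1) by (auto simp: near_def)
  hence "(\<bar>a\<bar> - e)\<^sup>2 \<le> (Re x)\<^sup>2" "(\<bar>b\<bar> - e)\<^sup>2 \<le> (Im x)\<^sup>2"
    using assms(2,3) by (auto intro!: abs_le_square_iff[THEN iffD1])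
  hence "s\<^sup>2 \<le> (cmod x)\<^sup>2" using assms(4) unfolding cmod_power2 by linarith
  thus ?thesis by (rule power2_le_imp_le) simp
qed

lemma sqrt_between:
  assumes "0 \<le> l" "l\<^sup>2 \<le> x" "x \<le> u\<^sup>2" "0 \<le> u" shows "l \<le> sqrt x" "sqrt x \<le> u"
  using assms by (auto simp: real_le_rsqrt intro: real_le_lsqrt)

section \<open>Fixed directions and the linkage\<close>

definition \<omega> :: complex where "\<omega> = Complex (1 / 2) (sqrt 3 / 2)"
text \<open>\<open>2 * \<zeta>\<close> is the apex of the isosceles triangle with base from 0 to 1
  and legs of length 2, and \<open>\<omega>\<close> is the rotation by 60 degrees. Together they
  describe all triangles attached to such an apex.\<close>

definition \<zeta> :: complex where "\<zeta> = Complex (1 / 4) (sqrt 15 / 4)"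

lemma norm_\<omega>: "cmod \<omega> = 1" "cmod (1 - \<omega>) = 1" "cmod (1 - cnj \<omega>) = 1"
  by (simp_all add: \<omega>_def cmod_def power_divide)

lemma norm_\<zeta>: "cmod \<zeta> = 1"
  by (simp add: \<zeta>_def cmod_def power_divide)

lemma near_\<omega>: "near \<omega> 0.5 0.8660254038 (1 / 10 ^ 9)"
proof -
  have "1.7320508074 \<le> sqrt 3" "sqrt 3 \<le> 1.7320508077"
    by (rule sqrt_between[of "1.7320508074" 3 "1.7320508077"]; simp add: power2_eq_square)+
  thus ?thesis unfolding near_def \<omega>_def complex.sel abs_le_iff by (intro conjI; simp)
qed

lemma near_\<zeta>: "near \<zeta> 0.25 0.9682458366 (1 / 10 ^ 9)"
proof -
  have "3.8729833461 \<le> sqrt 15" "sqrt 15 \<le> 3.8729833463"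
    by (rule sqrt_between[of "3.8729833461" 15 "3.8729833463"]; simp add: power2_eq_square)+
  thus ?thesis unfolding near_def \<zeta>_def complex.sel abs_le_iff by (intro conjI; simp)
qed

lemma frame_\<omega>: "cmod u = 1 \<Longrightarrow> frame u (u * \<omega>)" "cmod u = 1 \<Longrightarrow> frame u (u * cnj \<omega>)"
proof -
  assume u: "cmod u = 1"
  have "u - u * \<omega> = u * (1 - \<omega>)" "u - u * cnj \<omega> = u * (1 - cnj \<omega>)" by (simp_all add: algebra_simps)
  hence "cmod (u - u * \<omega>) = 1" "cmod (u - u * cnj \<omega>) = 1" using u norm_\<omega> by (simp_all only: norm_mult)
  thus "frame u (u * \<omega>)" "frame u (u * cnj \<omega>)" using u norm_\<omega> by (auto simp: frame_def norm_mult)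
qed

text \<open>A four-bar linkage: the bars \<open>arm1 t\<close> and \<open>arm1 t + arm2 s t - 2\<close> of length 1 join the ends of a
  bar of length 2 on the real axis to the ends of the bar \<open>arm2 s t\<close> of length 1; the sign \<open>s\<close>
  selects one of its two branches.\<close>

definition arm1 :: "real \<Rightarrow> complex" where
  "arm1 t = Complex t (sqrt (1 - t\<^sup>2))"

text \<open>Let \<open>D = 2 - arm1 t\<close>, so that \<open>5 - 4 * t\<close> is its squared
  length. An isosceles triangle with legs 1 over \<open>D\<close> has height
  \<open>knee t * cmod D\<close>, because \<open>knee t\<close> equals
  \<open>sqrt (1 / (5 - 4 * t) - 1 / 4)\<close>. Below, \<open>arm2 s t\<close> is
  \<open>D * Complex (1 / 2) (- s * knee t)\<close>. The triangle exists for
  \<open>1 / 4 < t\<close>, where \<open>D\<close> is shorter than 2.\<close>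

definition knee :: "real \<Rightarrow> real" where
  "knee t = sqrt ((4 * t - 1) / (5 - 4 * t)) / 2"

definition arm2 :: "real \<Rightarrow> real \<Rightarrow> complex" where
  "arm2 s t = Complex (1 - t / 2 - s * sqrt (1 - t\<^sup>2) * knee t) (s * (t - 2) * knee t - sqrt (1 - t\<^sup>2) / 2)"

text \<open>With \<open>D = 2 - arm1 t\<close>, both \<open>arm2 s t\<close> and
  \<open>arm2 s t - D\<close> are \<open>D\<close> times a number with real part 1/2 or -1/2 and
  imaginary part \<open>- s * knee t\<close>. Their squared modulus is the product computed in
  \<open>key\<close>.\<close>

lemma norm_arms:
  assumes "1 / 4 < t" "t < 1" "s\<^sup>2 = 1"
  shows "cmod (arm1 t) = 1" "cmod (arm2 s t) = 1" "cmod (arm1 t + arm2 s t - 2) = 1"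
proof -
  define y where "y = sqrt (1 - t\<^sup>2)"
  define g where "g = knee t"
  have t2: "t\<^sup>2 < 1" using power_strict_mono[of t 1 2] assms by simp
  have y: "y\<^sup>2 = 1 - t\<^sup>2" unfolding y_def using t2 by simp
  have g: "g\<^sup>2 = (4 * t - 1) / (4 * (5 - 4 * t))" unfolding g_def knee_def using assms by (simp add: power_divide)
  have m: "(2 - t)\<^sup>2 + y\<^sup>2 = 5 - 4 * t" unfolding y by (simp add: power2_eq_square algebra_simps)
  have key: "((2 - t)\<^sup>2 + y\<^sup>2) * (1 / 4 + g\<^sup>2) = 1"
    unfolding m g using assms by (simp add: field_simps)
  have "(cmod (arm1 t))\<^sup>2 = 1" unfolding cmod_power2 arm1_def using y by (simp add: y_def)
  thus "cmod (arm1 t) = 1" by (simp add: power2_eq_1_iff)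
       (use norm_ge_zero[of "arm1 t"] in linarith)
  have "(cmod (arm2 s t))\<^sup>2 = ((2 - t) / 2 - s * y * g)\<^sup>2 + (s * (t - 2) * g - y / 2)\<^sup>2"
    unfolding cmod_power2 arm2_def y_def g_def by (simp add: diff_divide_distrib)
  also have "\<dots> = ((2 - t)\<^sup>2 + y\<^sup>2) * (1 / 4 + s\<^sup>2 * g\<^sup>2)"
    by (simp add: power2_eq_square field_simps)
  also have "\<dots> = 1" using key assms(3) by simp
  finally have "(cmod (arm2 s t))\<^sup>2 = 1" .
  thus "cmod (arm2 s t) = 1" by (simp add: power2_eq_1_iff)
       (use norm_ge_zero[of "arm2 s t"] in linarith)
  have "(cmod (arm1 t + arm2 s t - 2))\<^sup>2 = ((t - 2) / 2 - s * y * g)\<^sup>2 + (s * (t - 2) * g + y / 2)\<^sup>2"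
    unfolding cmod_power2 arm1_def arm2_def y_def g_def by (simp add: field_simps)
  also have "\<dots> = ((2 - t)\<^sup>2 + y\<^sup>2) * (1 / 4 + s\<^sup>2 * g\<^sup>2)"
    by (simp add: power2_eq_square field_simps)
  also have "\<dots> = 1" using key assms(3) by simp
  finally have "(cmod (arm1 t + arm2 s t - 2))\<^sup>2 = 1" .
  thus "cmod (arm1 t + arm2 s t - 2) = 1" by (simp add: power2_eq_1_iff)
       (use norm_ge_zero[of "arm1 t + arm2 s t - 2"] in linarith)
qed

text \<open>On the interval \<open>sqrt (1 - t^2)\<close> decreases and \<open>knee\<close>
  increases, so each bound is needed at one end only; squaring removes the roots.\<close>

lemma arm_bounds:
  assumes "1 / 4 < t0" "t0 \<le> t" "t \<le> t1" "t1 < 1"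
    and "0 \<le> yl" "yl\<^sup>2 \<le> 1 - t1\<^sup>2" "1 - t0\<^sup>2 \<le> yu\<^sup>2" "0 \<le> yu"
    and "0 \<le> gl" "4 * gl\<^sup>2 * (5 - 4 * t0) \<le> 4 * t0 - 1" "4 * t1 - 1 \<le> 4 * gu\<^sup>2 * (5 - 4 * t1)" "0 \<le> gu"
  shows "yl \<le> sqrt (1 - t\<^sup>2)" "sqrt (1 - t\<^sup>2) \<le> yu" "gl \<le> knee t" "knee t \<le> gu"
proof -
  have "t0\<^sup>2 \<le> t\<^sup>2" "t\<^sup>2 \<le> t1\<^sup>2" using assms by (auto intro!: power_mono)
  hence "yl\<^sup>2 \<le> 1 - t\<^sup>2" "1 - t\<^sup>2 \<le> yu\<^sup>2" using assms(6,7) by linarith+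
  thus "yl \<le> sqrt (1 - t\<^sup>2)" "sqrt (1 - t\<^sup>2) \<le> yu"
    using sqrt_between[OF assms(5) _ _ assms(8)] by blast+
  let ?x = "(4 * t - 1) / (5 - 4 * t)"
  have "(4 * t0 - 1) / (5 - 4 * t0) \<le> ?x" using assms by (intro frac_le) auto
  moreover have "(2 * gl)\<^sup>2 \<le> (4 * t0 - 1) / (5 - 4 * t0)"
    using assms by (simp add: le_divide_eq power_mult_distrib)
  moreover have "?x \<le> (4 * t1 - 1) / (5 - 4 * t1)" using assms by (intro frac_le) auto
  moreover have "(4 * t1 - 1) / (5 - 4 * t1) \<le> (2 * gu)\<^sup>2"
    using assms by (simp add: divide_le_eq power_mult_distrib)
  ultimately have "(2 * gl)\<^sup>2 \<le> ?x" "?x \<le> (2 * gu)\<^sup>2" by linarith+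
  hence "2 * gl \<le> sqrt ?x" "sqrt ?x \<le> 2 * gu"
    using sqrt_between[of "2 * gl" ?x "2 * gu"] assms(9,12) by simp_all
  thus "gl \<le> knee t" "knee t \<le> gu" unfolding knee_def by simp_all
qed

lemma abs_chain: "\<bar>x - y\<bar> \<le> d \<Longrightarrow> \<bar>y - a\<bar> + d \<le> e \<Longrightarrow> \<bar>x - a\<bar> \<le> e" for x y a :: real
  by linarith

lemma near_arm1:
  assumes "t0 \<le> t" "t \<le> t1" "yl \<le> sqrt (1 - t\<^sup>2)" "sqrt (1 - t\<^sup>2) \<le> yu"
    and "a - e \<le> t0" "t1 \<le> a + e" "b - e \<le> yl" "yu \<le> b + e"
  shows "near (arm1 t) a b e"
  using assms by (auto simp: near_def arm1_def)

lemma near_arm2: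
  assumes "t0 \<le> t" "t \<le> t1" "t1 < 1" "0 \<le> yl" "yl \<le> sqrt (1 - t\<^sup>2)" "sqrt (1 - t\<^sup>2) \<le> yu"
    and "0 \<le> gl" "gl \<le> knee t" "knee t \<le> gu" and s: "s = 1 \<or> s = -1"
    and "\<bar>(1 - t0 / 2 - s * (yl * gl)) - a\<bar> + ((t1 / 2 - t0 / 2) + (yu * gu - yl * gl)) \<le> e"
    and "\<bar>(- s * ((2 - t1) * gl) - yl / 2) - b\<bar> + (((2 - t0) * gu - (2 - t1) * gl) + (yu / 2 - yl / 2)) \<le> e"
  shows "near (arm2 s t) a b e"
proof -
  define y where "y = sqrt (1 - t\<^sup>2)"
  define g where "g = knee t"
  have yg: "0 \<le> yl" "yl \<le> y" "y \<le> yu" "0 \<le> gl" "gl \<le> g" "g \<le> gu" using assms by (auto simp: y_def g_def)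
  have 1: "yl * gl \<le> y * g" "y * g \<le> yu * gu" using yg by (auto intro!: mult_mono)
  have 2: "(2 - t1) * gl \<le> (2 - t) * g" "(2 - t) * g \<le> (2 - t0) * gu"
    using yg assms(1-3) by (auto intro!: mult_mono)
  have r: "Re (arm2 s t) = 1 - t / 2 - s * (y * g)" "Im (arm2 s t) = - s * ((2 - t) * g) - y / 2"
    by (simp_all add: arm2_def y_def g_def algebra_simps)
  have A: "\<bar>(1 - t / 2 - s * (y * g)) - (1 - t0 / 2 - s * (yl * gl))\<bar> \<le> (t1 / 2 - t0 / 2) + (yu * gu - yl * gl)"
    using s
  proof
    assume s: "s = 1" show ?thesis unfolding s using 1 assms(1,2) by (intro abs_leI; linarith)
  next
    assume s: "s = - 1" show ?thesis unfolding s using 1 assms(1,2) by (intro abs_leI; linarith)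
  qed
  have B: "\<bar>(- s * ((2 - t) * g) - y / 2) - (- s * ((2 - t1) * gl) - yl / 2)\<bar>
      \<le> ((2 - t0) * gu - (2 - t1) * gl) + (yu / 2 - yl / 2)"
    using s
  proof
    assume s: "s = 1" show ?thesis unfolding s using 2 yg(2,3) by (intro abs_leI; linarith)
  next
    assume s: "s = - 1" show ?thesis unfolding s using 2 yg(2,3) by (intro abs_leI; linarith)
  qed
  show ?thesis unfolding near_def r
    by (rule conjI[OF abs_chain[OF A assms(11)] abs_chain[OF B assms(12)]])
qed

text \<open>The linkage is closed by a bar from \<open>- \<omega>\<close> to the point \<open>arm1 t + arm2 s t * q\<close>.\<close>

lemma linkage_exists:
  assumes "1 / 4 < t0" "t0 \<le> t1" "t1 < 1"
    and "cmod (arm1 t0 + arm2 s t0 * q + \<omega>) \<le> l \<and> l \<le> cmod (arm1 t1 + arm2 s t1 * q + \<omega>) \<or>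
      l \<le> cmod (arm1 t0 + arm2 s t0 * q + \<omega>) \<and> cmod (arm1 t1 + arm2 s t1 * q + \<omega>) \<le> l"
  shows "\<exists>t. t0 \<le> t \<and> t \<le> t1 \<and> cmod (arm1 t + arm2 s t * q + \<omega>) = l"
proof -
  have "continuous_on {t0..t1} knee" unfolding knee_def
    by (intro continuous_intros) (use assms in auto)
  hence "continuous_on {t0..t1} (\<lambda>t. cmod (arm1 t + arm2 s t * q + \<omega>))"
    unfolding arm1_def arm2_def Complex_eq by (intro continuous_intros) auto
  thus ?thesis using assms(2,4)
    IVT'[of "\<lambda>t. cmod (arm1 t + arm2 s t * q + \<omega>)" t0 l t1]
    IVT2'[of "\<lambda>t. cmod (arm1 t + arm2 s t * q + \<omega>)" t1 l t0] by blast
qed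

text \<open>\<open>N\<close> is normal to the axis through \<open>a\<close> and \<open>b\<close> on which the body will be reflected.\<close>

definition admissible :: "complex \<Rightarrow> complex \<Rightarrow> complex \<Rightarrow> real \<Rightarrow> complex \<Rightarrow> complex set \<Rightarrow> bool" where
  "admissible a b c \<tau> N P \<longleftrightarrow>
     (\<forall>z\<in>P. (z = a \<or> z = b \<or> 0 < N \<bullet> (z - a)) \<and>
       (z = c \<or> 0 < N \<bullet> (c - z) \<and> 0 < (of_real \<tau> * (b - a) - N) \<bullet> (z - c)))"

text \<open>Each clause of \<open>admissible\<close> describes an open half-plane with at most one
  boundary point added, so it passes from the vertices to the hull. \<open>s\<close> is the end of
  the axis at which this convex part is allowed to touch the axis.\<close>

lemma admissible_hull:
  assumes "s = a \<or> s = b" "N \<bullet> (b - a) = 0"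
    and "\<forall>x\<in>P. x = s \<or> 0 < N \<bullet> (x - s)"
    and "\<forall>x\<in>P. x = c \<or> 0 < (- N) \<bullet> (x - c)"
    and "\<forall>x\<in>P. x = c \<or> 0 < (of_real \<tau> * (b - a) - N) \<bullet> (x - c)"
  shows "admissible a b c \<tau> N (convex hull P)"
  unfolding admissible_def
proof
  fix z assume z: "z \<in> convex hull P"
  have 1: "z = s \<or> 0 < N \<bullet> (z - s)" by (rule hull_beyond_point[OF _ z]) (use assms(3) in auto)
  have 2: "z = c \<or> 0 < (- N) \<bullet> (z - c)" by (rule hull_beyond_point[OF _ z]) (use assms(4) in blast)
  have 3: "z = c \<or> 0 < (of_real \<tau> * (b - a) - N) \<bullet> (z - c)"
    by (rule hull_beyond_point[OF _ z]) (use assms(5) in blast)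
  have "N \<bullet> (z - s) = N \<bullet> (z - a)" using assms(1,2) by (auto simp: inner_diff_right)
  moreover have "(- N) \<bullet> (z - c) = N \<bullet> (c - z)" by (simp add: inner_diff_right)
  ultimately show "(z = a \<or> z = b \<or> 0 < N \<bullet> (z - a)) \<and>
       (z = c \<or> 0 < N \<bullet> (c - z) \<and> 0 < (of_real \<tau> * (b - a) - N) \<bullet> (z - c))"
    using 1 2 3 assms(1) by auto
qed

lemma admissible_Un: "admissible a b c \<tau> N P \<Longrightarrow> admissible a b c \<tau> N Q \<Longrightarrow> admissible a b c \<tau> N (P \<union> Q)"
  unfolding admissible_def by blast

text \<open>The rigid motion \<open>g\<close> sends \<open>a\<close> to 0 and \<open>b\<close> to
  the positive real axis. Since that direction points away from the centre of the circle in the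
  finished polygon, the order of \<open>a\<close> and \<open>b\<close> matters; this version treats
  a body to the left of the line from \<open>a\<close> to \<open>b\<close>.\<close>

lemma body_of_admissible:
  assumes S: "piece S n {#a, a, b, b, c, c#}" and ab: "a \<noteq> b"
    and ad: "admissible a b c \<tau> (\<i> * (b - a)) S"
    and "l * cmod (b - a) \<le> (\<i> * (b - a)) \<bullet> (c - a)" "(\<i> * (b - a)) \<bullet> (c - a) \<le> u * cmod (b - a)"
  shows "\<exists>h. body n h \<tau> \<and> l \<le> h \<and> h \<le> u"
proof -
  define m where "m = cmod (b - a)"
  define v where "v = cnj (b - a) / of_real m"
  have m: "0 < m" using ab by (simp add: m_def)
  define g where "g z = v * (z - a)" for z
  have nv: "cmod v = 1" using m by (simp add: v_def norm_divide) (simp add: m_def norm_minus_commute flip: complex_cnj_diff)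
  have im: "Im (g z) = ((\<i> * (b - a)) \<bullet> (z - a)) / m" for z
    by (simp add: g_def v_def inner_complex_def field_simps)
  have re: "Re (g z) = ((b - a) \<bullet> (z - a)) / m" for z
    by (simp add: g_def v_def inner_complex_def field_simps)
  have lin: "linear (\<lambda>z. v * z)" by (rule linearI) (simp_all add: algebra_simps)
  have p: "piece (g ` S) n (image_mset g {#a, a, b, b, c, c#})"
  proof -
    have "piece ((\<lambda>z. v * z) ` (+) (- a) ` S) n (image_mset (\<lambda>z. v * z) (image_mset ((+) (- a)) {#a, a, b, b, c, c#}))"
      by (rule piece_linear_image[OF piece_translate[OF S] lin]) (simp add: norm_mult nv)
    moreover have "(\<lambda>z. v * z) ` (+) (- a) ` S = g ` S" by (simp add: image_image g_def)
    ultimately show ?thesis by (simp add: g_def)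
  qed
  have inj: "g x = g y \<longleftrightarrow> x = y" for x y using nv by (auto simp: g_def)
  let ?h = "Im (g c)"
  have "body n ?h \<tau>" unfolding body_def
  proof (intro exI conjI ballI)
    show "piece (g ` S) n {#g a, g a, g b, g b, g c, g c#}" using p by simp
    show "g a \<noteq> g b" using ab inj by simp
    show "Im (g a) = 0" "Im (g b) = 0" by (simp_all add: im inner_complex_def algebra_simps)
  next
    fix w assume "w \<in> g ` S"
    then obtain z where z: "z \<in> S" "w = g z" by blast
    have 0: "(z = a \<or> z = b \<or> 0 < (\<i> * (b - a)) \<bullet> (z - a)) \<and>
       (z = c \<or> 0 < (\<i> * (b - a)) \<bullet> (c - z) \<and> 0 < (of_real \<tau> * (b - a) - \<i> * (b - a)) \<bullet> (z - c))"
      using ad z(1) unfolding admissible_def by blast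
    have 1: "Im (g c) - Im w = ((\<i> * (b - a)) \<bullet> (c - z)) / m"
      unfolding z(2) im by (simp add: diff_divide_distrib[symmetric] inner_diff_right)
    have 2: "\<tau> * (Re w - Re (g c)) - (Im w - Im (g c)) = ((of_real \<tau> * (b - a) - \<i> * (b - a)) \<bullet> (z - c)) / m"
      unfolding z(2) im re using m by (simp add: inner_complex_def field_simps)
    show "w = g a \<or> w = g b \<or> 0 < Im w" using 0 m unfolding z(2) inj im by auto
    show "w = g c \<or> Im w < ?h \<and> Im w - ?h < \<tau> * (Re w - Re (g c))"
    proof (cases "z = c")
      case True thus ?thesis using z by simp
    next
      case False
      hence "0 < Im (g c) - Im w" "0 < \<tau> * (Re w - Re (g c)) - (Im w - Im (g c))"
        unfolding 1 2 using 0 m by auto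
      thus ?thesis by auto
    qed
  qed (rule refl)
  moreover have "l \<le> ?h" "?h \<le> u" using assms(4,5) m unfolding im m_def[symmetric]
    by (auto simp: pos_le_divide_eq pos_divide_le_eq)
  ultimately show ?thesis by blast
qed

text \<open>A body to the right of its directed axis is first reflected by conjugation.\<close>

lemma body_of_admissible':
  assumes S: "piece S n {#a, a, b, b, c, c#}" and ab: "a \<noteq> b"
    and ad: "admissible a b c \<tau> (- (\<i> * (b - a))) S"
    and "l * cmod (b - a) \<le> (- (\<i> * (b - a))) \<bullet> (c - a)" "(- (\<i> * (b - a))) \<bullet> (c - a) \<le> u * cmod (b - a)"
  shows "\<exists>h. body n h \<tau> \<and> l \<le> h \<and> h \<le> u"
proof -
  have c: "(\<i> * (cnj b - cnj a)) \<bullet> (cnj x - cnj y) = (- (\<i> * (b - a))) \<bullet> (x - y)" for x y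
    by (simp add: inner_complex_def algebra_simps)
  have c2: "(of_real \<tau> * (cnj b - cnj a) - \<i> * (cnj b - cnj a)) \<bullet> (cnj x - cnj y) =
      (of_real \<tau> * (b - a) - (- (\<i> * (b - a)))) \<bullet> (x - y)" for x y
    by (simp add: inner_complex_def algebra_simps)
  have eq: "cnj x = cnj y \<longleftrightarrow> x = y" for x y by simp
  show ?thesis
  proof (rule body_of_admissible[where S = "cnj ` S" and a = "cnj a" and b = "cnj b" and c = "cnj c"])
    show "piece (cnj ` S) n {#cnj a, cnj a, cnj b, cnj b, cnj c, cnj c#}"
      using piece_linear_image[OF S linear_cnj] by simp
    show "cnj a \<noteq> cnj b" using ab by simp
    show "admissible (cnj a) (cnj b) (cnj c) \<tau> (\<i> * (cnj b - cnj a)) (cnj ` S)"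
      using ad unfolding admissible_def by (simp only: ball_simps c c2 eq)
    show "l * cmod (cnj b - cnj a) \<le> (\<i> * (cnj b - cnj a)) \<bullet> (cnj c - cnj a)"
      "(\<i> * (cnj b - cnj a)) \<bullet> (cnj c - cnj a) \<le> u * cmod (cnj b - cnj a)"
      unfolding c using assms(4,5) by (simp_all flip: complex_cnj_diff)
  qed
qed

section \<open>Five bodies\<close>

text \<open>These forms turn a condition on an explicit vertex set into one premise per vertex. A
  separation certificate can then be assembled by composing facts, which leaves only inequalities
  between decimals.\<close>

lemma ball_pos:
  fixes w s :: "'a::real_inner"
  assumes "a = s \<or> 0 < w \<bullet> (a - s)" "b = s \<or> 0 < w \<bullet> (b - s)"
  shows "\<forall>x\<in>{a, b}. x = s \<or> 0 < w \<bullet> (x - s)"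
    "c = s \<or> 0 < w \<bullet> (c - s) \<Longrightarrow> \<forall>x\<in>{a, b, c}. x = s \<or> 0 < w \<bullet> (x - s)"
    "c = s \<or> 0 < w \<bullet> (c - s) \<Longrightarrow> d = s \<or> 0 < w \<bullet> (d - s) \<Longrightarrow>
      \<forall>x\<in>{a, b, c, d}. x = s \<or> 0 < w \<bullet> (x - s)"
  using assms by simp_all

lemma ball_neg:
  fixes w s :: "'a::real_inner"
  assumes "a = s \<or> w \<bullet> (a - s) < 0" "b = s \<or> w \<bullet> (b - s) < 0"
  shows "\<forall>x\<in>{a, b}. x = s \<or> w \<bullet> (x - s) < 0"
    "c = s \<or> w \<bullet> (c - s) < 0 \<Longrightarrow> \<forall>x\<in>{a, b, c}. x = s \<or> w \<bullet> (x - s) < 0"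
    "c = s \<or> w \<bullet> (c - s) < 0 \<Longrightarrow> d = s \<or> w \<bullet> (d - s) < 0 \<Longrightarrow>
      \<forall>x\<in>{a, b, c, d}. x = s \<or> w \<bullet> (x - s) < 0"
  using assms by simp_all

lemma ball_gt:
  fixes w :: "'a::real_inner"
  assumes "k < w \<bullet> a" "k < w \<bullet> b"
  shows "\<forall>x\<in>{a, b}. k < w \<bullet> x" "k < w \<bullet> c \<Longrightarrow> \<forall>x\<in>{a, b, c}. k < w \<bullet> x"
    "k < w \<bullet> c \<Longrightarrow> k < w \<bullet> d \<Longrightarrow> \<forall>x\<in>{a, b, c, d}. k < w \<bullet> x"
  using assms by simp_all

lemma ball_lt:
  fixes w :: "'a::real_inner"
  assumes "w \<bullet> a < k" "w \<bullet> b < k"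
  shows "\<forall>x\<in>{a, b}. w \<bullet> x < k" "w \<bullet> c < k \<Longrightarrow> \<forall>x\<in>{a, b, c}. w \<bullet> x < k"
    "w \<bullet> c < k \<Longrightarrow> w \<bullet> d < k \<Longrightarrow> \<forall>x\<in>{a, b, c, d}. w \<bullet> x < k"
  using assms by simp_all

lemma hull_meet_point':
  fixes w s :: "'a::real_inner"
  assumes "\<forall>x\<in>P. x = s \<or> 0 < w \<bullet> (x - s)" "\<forall>x\<in>Q. x = s \<or> w \<bullet> (x - s) < 0"
  shows "convex hull P \<inter> convex hull Q \<subseteq> {s}"
  by (rule hull_meet_point) (use assms in blast)+

lemma hull_disjoint':
  fixes w :: "'a::real_inner"
  assumes "\<forall>x\<in>P. c < w \<bullet> x" "\<forall>x\<in>Q. w \<bullet> x < c"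
  shows "convex hull P \<inter> convex hull Q = {}"
  by (rule hull_disjoint) (use assms in blast)+

lemma admissible_hull':
  assumes "s = a \<or> s = b" "N \<bullet> (b - a) = 0" "N' = - N" "L = of_real \<tau> * (b - a) - N"
    and "\<forall>x\<in>P. x = s \<or> 0 < N \<bullet> (x - s)"
    and "\<forall>x\<in>P. x = c \<or> 0 < N' \<bullet> (x - c)"
    and "\<forall>x\<in>P. x = c \<or> 0 < L \<bullet> (x - c)"
  shows "admissible a b c \<tau> N (convex hull P)"
  by (rule admissible_hull[OF assms(1,2,5)]) (use assms(6,7) in \<open>simp_all only: assms(3,4)\<close>)

lemma near_arms:
  assumes "t0 \<le> t" "t \<le> t1" "1 / 4 < t0" "t1 < 1"
    and "0 \<le> yl" "yl\<^sup>2 \<le> 1 - t1\<^sup>2" "1 - t0\<^sup>2 \<le> yu\<^sup>2" "0 \<le> yu"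
    and "0 \<le> gl" "4 * gl\<^sup>2 * (5 - 4 * t0) \<le> 4 * t0 - 1" "4 * t1 - 1 \<le> 4 * gu\<^sup>2 * (5 - 4 * t1)" "0 \<le> gu"
    and "s = 1 \<or> s = -1"
    and "a - e \<le> t0" "t1 \<le> a + e" "b - e \<le> yl" "yu \<le> b + e"
    and "\<bar>(1 - t0 / 2 - s * (yl * gl)) - c\<bar> + ((t1 / 2 - t0 / 2) + (yu * gu - yl * gl)) \<le> f"
    and "\<bar>(- s * ((2 - t1) * gl) - yl / 2) - d\<bar> + (((2 - t0) * gu - (2 - t1) * gl) + (yu / 2 - yl / 2)) \<le> f"
  shows "near (arm1 t) a b e" "near (arm2 s t) c d f"
proof -
  note k = arm_bounds[OF assms(3,1,2,4-12)]
  show "near (arm1 t) a b e" by (rule near_arm1[OF assms(1,2) k(1,2) assms(14-17)])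
  show "near (arm2 s t) c d f"
    by (rule near_arm2[OF assms(1,2,4,5) k(1,2) assms(9) k(3,4) assms(13,18,19)])
qed

text \<open>The height over the axis is \<open>w \<bullet> (x - s)\<close> divided by
  \<open>cmod w\<close>; the rational bounds \<open>k\<close> and \<open>m\<close> for this modulus
  avoid both the quotient and the root.\<close>

lemma height_bounds:
  assumes "near w p q g" "near x a b e" "near s c d f"
    and E: "(\<bar>p\<bar> + \<bar>q\<bar>) * (e + f) + g * (\<bar>a - c\<bar> + \<bar>b - d\<bar> + 2 * (e + f)) \<le> E"
    and "(\<bar>p\<bar> + g)\<^sup>2 + (\<bar>q\<bar> + g)\<^sup>2 \<le> m\<^sup>2" "0 \<le> m"
    and "g \<le> \<bar>p\<bar>" "g \<le> \<bar>q\<bar>" "k\<^sup>2 \<le> (\<bar>p\<bar> - g)\<^sup>2 + (\<bar>q\<bar> - g)\<^sup>2"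
    and "0 \<le> l" "0 \<le> u" "l * m + E \<le> p * (a - c) + q * (b - d)" "p * (a - c) + q * (b - d) + E \<le> u * k"
  shows "l * cmod w \<le> w \<bullet> (x - s)" "w \<bullet> (x - s) \<le> u * cmod w"
proof -
  have n: "\<bar>Re (x - s) - (a - c)\<bar> \<le> e + f" "\<bar>Im (x - s) - (b - d)\<bar> \<le> e + f"
    using assms(2,3) by (auto simp: near_def)
  have w: "\<bar>Re w - p\<bar> \<le> g" "\<bar>Im w - q\<bar> \<le> g" using assms(1) by (auto simp: near_def)
  have E': "(\<bar>p\<bar> * (e + f) + \<bar>a - c\<bar> * g + g * (e + f)) + (\<bar>q\<bar> * (e + f) + \<bar>b - d\<bar> * g + g * (e + f)) \<le> E"
    using E by (simp add: algebra_simps)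
  have "\<bar>w \<bullet> (x - s) - (p * (a - c) + q * (b - d))\<bar> \<le> E"
    unfolding inner_complex_def using approx_mult[OF w(1) n(1)] approx_mult[OF w(2) n(2)] E' by linarith
  moreover have "l * cmod w \<le> l * m"
    using near_norm_less[OF assms(1,5,6)] assms(10) by (intro mult_left_mono)
  moreover have "u * k \<le> u * cmod w"
    using near_norm_greater[OF assms(1,7-9)] assms(11) by (intro mult_left_mono)
  ultimately show "l * cmod w \<le> w \<bullet> (x - s)" "w \<bullet> (x - s) \<le> u * cmod w"
    using assms(12,13) by linarith+
qed

lemma norm_ii_diff: "cmod (\<i> * (b - a)) = cmod (b - a)" "cmod (- (\<i> * (b - a))) = cmod (b - a)"
  by (simp_all add: norm_mult)

lemma inner_ii: "(\<i> * z) \<bullet> z = 0" "(- (\<i> * z)) \<bullet> z = 0"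
  by (simp_all add: inner_complex_def)

lemma near_neq:
  assumes "near x a b e" "near y c d f"
  shows "e + f < \<bar>a - c\<bar> \<Longrightarrow> x \<noteq> y" "e + f < \<bar>b - d\<bar> \<Longrightarrow> x \<noteq> y"
  using assms unfolding near_def by (intro notI; simp; linarith)+

lemma cnj_\<omega>: "cnj \<omega> = 1 - \<omega>" and cnj_\<zeta>: "cnj \<zeta> = 1 / 2 - \<zeta>"
  by (simp_all add: \<omega>_def \<zeta>_def complex_eq_iff)

text \<open>An isosceles triangle with legs 2 over a base \<open>d\<close> has height k times the
  length of \<open>d\<close>, where \<open>k = sqrt (4 / (cmod d)^2 - 1 / 4)\<close>. The bounds
  follow by squaring.\<close>

lemma apex_bounds:
  assumes "l \<le> cmod d" "cmod d \<le> u" "0 < l" "0 \<le> kl" "0 \<le> ku"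
    and "u\<^sup>2 * (1 / 4 + kl\<^sup>2) \<le> 4" "4 \<le> l\<^sup>2 * (1 / 4 + ku\<^sup>2)" "u\<^sup>2 \<le> 16"
  shows "kl \<le> sqrt (4 / (cmod d)\<^sup>2 - 1 / 4)" "sqrt (4 / (cmod d)\<^sup>2 - 1 / 4) \<le> ku"
    "(cmod d)\<^sup>2 * (1 / 4 + (sqrt (4 / (cmod d)\<^sup>2 - 1 / 4))\<^sup>2) = 4"
proof -
  have sq: "l\<^sup>2 \<le> (cmod d)\<^sup>2" "(cmod d)\<^sup>2 \<le> u\<^sup>2" using assms by (auto intro!: power_mono)
  have d: "0 < (cmod d)\<^sup>2" using assms by auto
  have "(cmod d)\<^sup>2 * (1 / 4 + kl\<^sup>2) \<le> u\<^sup>2 * (1 / 4 + kl\<^sup>2)" using sq by (intro mult_right_mono) auto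
  hence 1: "kl\<^sup>2 \<le> 4 / (cmod d)\<^sup>2 - 1 / 4" using d assms(6) by (simp add: field_simps)
  have "l\<^sup>2 * (1 / 4 + ku\<^sup>2) \<le> (cmod d)\<^sup>2 * (1 / 4 + ku\<^sup>2)" using sq by (intro mult_right_mono) auto
  hence 2: "4 / (cmod d)\<^sup>2 - 1 / 4 \<le> ku\<^sup>2" using d assms(7) by (simp add: field_simps)
  show "kl \<le> sqrt (4 / (cmod d)\<^sup>2 - 1 / 4)" "sqrt (4 / (cmod d)\<^sup>2 - 1 / 4) \<le> ku"
    using sqrt_between[OF assms(4) 1 2 assms(5)] by auto
  have "0 \<le> 4 / (cmod d)\<^sup>2 - 1 / 4" using 1 zero_le_power2[of kl] by linarith
  thus "(cmod d)\<^sup>2 * (1 / 4 + (sqrt (4 / (cmod d)\<^sup>2 - 1 / 4))\<^sup>2) = 4" using d by simp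
qed

lemma apex_distances:
  assumes "(cmod (x - r))\<^sup>2 * (1 / 4 + k\<^sup>2) = 4"
  defines "v \<equiv> r + of_real 0.5 * (x - r) + of_real k * (\<i> * (x - r))"
  shows "cmod (v - x) = 2" "cmod (v - r) = 2"
proof -
  have "v - x = Complex (- 1 / 2) k * (x - r)" "v - r = Complex (1 / 2) k * (x - r)"
    by (simp_all add: v_def complex_eq_iff field_simps)
  hence "(cmod (v - x))\<^sup>2 = 4" "(cmod (v - r))\<^sup>2 = 4"
    using assms(1) by (simp_all add: norm_mult power_mult_distrib cmod_power2 power_divide mult.commute)
  thus "cmod (v - x) = 2" "cmod (v - r) = 2"
    using power2_eq_imp_eq[of "cmod (v - x)" 2] power2_eq_imp_eq[of "cmod (v - r)" 2] by simp_all
qed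

text \<open>Two triangles of side 2 and one of side 1, attached to the sides of a triangle with sides 2, 2, 1.\<close>

lemma body12: "\<exists>h. body 12 h 2 \<and> 2.936 \<le> h \<and> h \<le> 2.937"
proof -
  define z0 where "z0 = (0::complex)"
  have n_z0: "near z0 0 0 0"
    unfolding z0_def by (rule near_mono[OF near_numeral(3)]) simp_all
  define z1 where "z1 = (1::complex)"
  have n_z1: "near z1 1 0 0"
    unfolding z1_def by (rule near_mono[OF near_numeral(2)]) simp_all
  \<comment> \<open>\<open>z0\<close>, \<open>z1\<close>, \<open>w\<close> are the corners of the
    inner triangle with sides 1, 2, 2; \<open>x\<close>, \<open>y\<close>, \<open>r\<close> will be
    the outer corners of the triangles on its sides.\<close>
  define w where "w = 2 * \<zeta>"
  have n_w: "near w 0.5 1.936492 0.0000004"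
    unfolding w_def by (rule near_mono[OF near_scale2[OF near_\<zeta>]]) simp_all
  define zo where "zo = \<zeta> * \<omega>"
  have n_zo: "near zo (-0.7135255) 0.7006293 0.0000001"
    unfolding zo_def by (rule near_mult[OF near_\<zeta> near_\<omega>]) simp_all
  define x where "x = 2 * zo"
  have n_x: "near x (-1.427051) 1.401259 0.0000006"
    unfolding x_def by (rule near_mono[OF near_scale2[OF n_zo]]) simp_all
  define zc where "zc = cnj \<zeta> * cnj \<omega>"
  have n_zc: "near zc (-0.7135255) (-0.7006293) 0.0000001"
    unfolding zc_def by (rule near_mult[OF near_cnj[OF near_\<zeta>] near_cnj[OF near_\<omega>]]) simp_all
  \<comment> \<open>As \<open>1 - 2 * cnj \<zeta> = 2 * \<zeta>\<close>, the vector
    \<open>- 2 * cnj \<zeta>\<close> leads from \<open>z1\<close> to \<open>w\<close>; turned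
    clockwise by 60 degrees it leads to the outer corner \<open>y\<close>.\<close>
  define y where "y = ((1::complex) - 2 * zc)"
  have n_y: "near y 2.427051 1.401259 0.0000006"
    unfolding y_def by (rule near_mono[OF near_diff[OF near_numeral(2) near_scale2[OF n_zc]]]) simp_all
  define r where "r = cnj \<omega>"
  have n_r: "near r 0.5 (-0.866025) 0.0000005"
    unfolding r_def by (rule near_mono[OF near_cnj[OF near_\<omega>]]) simp_all
  have fr: "frame (- cnj \<zeta>) (- cnj \<zeta> * cnj \<omega>)" by (rule frame_\<omega>) (simp add: norm_\<zeta>)
  have fr1: "frame 1 (1 * cnj \<omega>)" by (rule frame_\<omega>) simp
  define H0 where "H0 = convex hull {z0, z1, r}"
  have p0: "piece H0 3 {#z0, z0, z1, z1, r, r#}" unfolding H0_def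
    by (rule piece_triangle[OF fr1]) (simp_all add: z0_def z1_def w_def x_def y_def r_def zo_def zc_def cnj_\<omega> cnj_\<zeta> scaleR_conv_of_real algebra_simps)
  define H1 where "H1 = convex hull {z0, w, x}"
  have p1: "piece H1 6 {#z0, z0, w, w, x, x#}" unfolding H1_def
    by (rule piece_triangle2[OF frame_\<omega>(1)[OF norm_\<zeta>]]) (simp_all add: z0_def z1_def w_def x_def y_def r_def zo_def zc_def cnj_\<omega> cnj_\<zeta> scaleR_conv_of_real algebra_simps)
  define H2 where "H2 = convex hull {z1, w, y}"
  have p2: "piece H2 6 {#z1, z1, w, w, y, y#}" unfolding H2_def
    by (rule piece_triangle2[OF fr]) (simp_all add: z0_def z1_def w_def x_def y_def r_def zo_def zc_def cnj_\<omega> cnj_\<zeta> scaleR_conv_of_real algebra_simps)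
  \<comment> \<open>Here and below the direction is a small integer vector for which the decimal
    positions are separated by more than their errors.\<close>
  have i0_1: "H0 \<inter> H1 \<subseteq> {z0}" unfolding H0_def H1_def
    by (rule hull_meet_point'[where w = "Complex 4 (-3)", OF
      ball_pos(2)[OF disjI1[OF refl] near_pos[OF n_z1 n_z0] near_pos[OF n_r n_z0]]
      ball_neg(2)[OF disjI1[OF refl] near_neg[OF n_w n_z0] near_neg[OF n_x n_z0]]]) simp_all
  have m1: "H0 \<inter> H1 \<subseteq> {z0}"
    using i0_1 by blast
  have g1: "piece (H0 \<union> H1) 8 {#r, r, w, w, x, x, z1, z1#}"
    by (rule piece_glue_point[OF p0 p1 m1]) (simp_all add: add_mset_commute)
  have i0_2: "H0 \<inter> H2 \<subseteq> {z1}" unfolding H0_def H2_def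
    by (rule hull_meet_point'[where w = "Complex (-4) (-3)", OF
      ball_pos(2)[OF near_pos[OF n_z0 n_z1] disjI1[OF refl] near_pos[OF n_r n_z1]]
      ball_neg(2)[OF disjI1[OF refl] near_neg[OF n_w n_z1] near_neg[OF n_y n_z1]]]) simp_all
  have i1_2: "H1 \<inter> H2 \<subseteq> {w}" unfolding H1_def H2_def
    by (rule hull_meet_point'[where w = "Complex (-5) 0", OF
      ball_pos(2)[OF near_pos[OF n_z0 n_w] disjI1[OF refl] near_pos[OF n_x n_w]]
      ball_neg(2)[OF near_neg[OF n_z1 n_w] disjI1[OF refl] near_neg[OF n_y n_w]]]) simp_all
  have m2: "(H0 \<union> H1) \<inter> H2 \<subseteq> {z1, w}"
    using i0_2 i1_2 by blast
  have neq2: "z1 \<noteq> w" by (rule near_neq(1)[OF n_z1 n_w]) simp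
  have g2: "piece (H0 \<union> H1 \<union> H2) 12 {#r, r, x, x, y, y#}"
    by (rule piece_glue_two[OF g1 p2 m2 neq2]) (simp_all add: add_mset_commute)
  define N where "N = (\<i> * (y - r))"
  have n_N: "near N (-2.26728) 1.92705 0.000006"
    unfolding N_def by (rule near_mono[OF near_ii[OF near_diff[OF n_y n_r]]]) simp_all
  define N' where "N' = (- N)"
  have n_N': "near N' 2.26728 (-1.92705) 0.000006"
    unfolding N'_def by (rule near_mono[OF near_minus[OF n_N]]) simp_all
  have n_tD: "near ((complex_of_real 2) * (y - r)) 3.854102 4.534568 0.000003"
    by (rule near_mult[OF near_real[of "2"] near_diff[OF n_y n_r]]) simp_all
  \<comment> \<open>\<open>L\<close> is normal to the line through the corner \<open>x\<close> that
    has slope 2, the value of \<open>\<tau>\<close>, relative to the axis.\<close>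
  define L where "L = (((complex_of_real 2) * (y - r)) - N)"
  have n_L: "near L 6.12138 2.60752 0.000011"
    unfolding L_def by (rule near_mono[OF near_diff[OF n_tD n_N]]) simp_all
  have N0: "N \<bullet> (y - r) = 0" unfolding N_def by (rule inner_ii)
  have a0: "admissible r y x 2 N H0" unfolding H0_def
    by (rule admissible_hull'[OF disjI1[OF refl] N0 N'_def L_def
      ball_pos(2)[OF near_pos'[OF n_N n_z0 n_r] near_pos'[OF n_N n_z1 n_r] disjI1[OF refl]]
      ball_pos(2)[OF near_pos'[OF n_N' n_z0 n_x] near_pos'[OF n_N' n_z1 n_x] near_pos'[OF n_N' n_r n_x]]
      ball_pos(2)[OF near_pos'[OF n_L n_z0 n_x] near_pos'[OF n_L n_z1 n_x] near_pos'[OF n_L n_r n_x]]]) simp_all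
  have a1: "admissible r y x 2 N H1" unfolding H1_def
    by (rule admissible_hull'[OF disjI1[OF refl] N0 N'_def L_def
      ball_pos(2)[OF near_pos'[OF n_N n_z0 n_r] near_pos'[OF n_N n_w n_r] near_pos'[OF n_N n_x n_r]]
      ball_pos(2)[OF near_pos'[OF n_N' n_z0 n_x] near_pos'[OF n_N' n_w n_x] disjI1[OF refl]]
      ball_pos(2)[OF near_pos'[OF n_L n_z0 n_x] near_pos'[OF n_L n_w n_x] disjI1[OF refl]]]) simp_all
  have a2: "admissible r y x 2 N H2" unfolding H2_def
    by (rule admissible_hull'[OF disjI2[OF refl] N0 N'_def L_def
      ball_pos(2)[OF near_pos'[OF n_N n_z1 n_y] near_pos'[OF n_N n_w n_y] disjI1[OF refl]]
      ball_pos(2)[OF near_pos'[OF n_N' n_z1 n_x] near_pos'[OF n_N' n_w n_x] near_pos'[OF n_N' n_y n_x]]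
      ball_pos(2)[OF near_pos'[OF n_L n_z1 n_x] near_pos'[OF n_L n_w n_x] near_pos'[OF n_L n_y n_x]]]) simp_all
  have ad: "admissible r y x 2 N (H0 \<union> H1 \<union> H2)"
    by (intro admissible_Un a0 a1 a2)
  have hb: "2.936 * cmod N \<le> N \<bullet> (x - r)" "N \<bullet> (x - r) \<le> 2.937 * cmod N"
    using height_bounds[OF n_N n_x n_r, where E = "0.0001" and m = "2.9756" and k = "2.97557" and l = "2.936" and u = "2.937"] by (simp_all add: power2_eq_square)
  have ab: "r \<noteq> y" by (rule near_neq(1)[OF n_r n_y]) simp
  have "piece (H0 \<union> H1 \<union> H2) 12 {#r, r, y, y, x, x#}" using g2 by (simp add: add_mset_commute)
  from body_of_admissible[OF this ab ad[unfolded N_def] hb[unfolded N_def norm_ii_diff]] show ?thesis .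
qed

text \<open>A copy of the body with 12 vertices and two triangles of side 2, attached to the sides of a triangle;
  the first of these sides joins the corners \<open>x\<close> and \<open>r\<close> of the copy.\<close>

lemma body21: "\<exists>h. body 21 h 5 \<and> 4.891 \<le> h \<and> h \<le> 4.896"
proof -
  define z0 where "z0 = (0::complex)"
  have n_z0: "near z0 0 0 0"
    unfolding z0_def by (rule near_mono[OF near_numeral(3)]) simp_all
  define z1 where "z1 = (1::complex)"
  have n_z1: "near z1 1 0 0"
    unfolding z1_def by (rule near_mono[OF near_numeral(2)]) simp_all
  define w where "w = 2 * \<zeta>"
  have n_w: "near w 0.5 1.936492 0.0000004"
    unfolding w_def by (rule near_mono[OF near_scale2[OF near_\<zeta>]]) simp_all
  define zo where "zo = \<zeta> * \<omega>"
  have n_zo: "near zo (-0.7135255) 0.7006293 0.0000001"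
    unfolding zo_def by (rule near_mult[OF near_\<zeta> near_\<omega>]) simp_all
  define x where "x = 2 * zo"
  have n_x: "near x (-1.427051) 1.401259 0.0000006"
    unfolding x_def by (rule near_mono[OF near_scale2[OF n_zo]]) simp_all
  define zc where "zc = cnj \<zeta> * cnj \<omega>"
  have n_zc: "near zc (-0.7135255) (-0.7006293) 0.0000001"
    unfolding zc_def by (rule near_mult[OF near_cnj[OF near_\<zeta>] near_cnj[OF near_\<omega>]]) simp_all
  define y where "y = ((1::complex) - 2 * zc)"
  have n_y: "near y 2.427051 1.401259 0.0000006"
    unfolding y_def by (rule near_mono[OF near_diff[OF near_numeral(2) near_scale2[OF n_zc]]]) simp_all
  define r where "r = cnj \<omega>"
  have n_r: "near r 0.5 (-0.866025) 0.0000005"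
    unfolding r_def by (rule near_mono[OF near_cnj[OF near_\<omega>]]) simp_all
  have fr: "frame (- cnj \<zeta>) (- cnj \<zeta> * cnj \<omega>)" by (rule frame_\<omega>) (simp add: norm_\<zeta>)
  have fr1: "frame 1 (1 * cnj \<omega>)" by (rule frame_\<omega>) simp
  define d where "d = (x - r)"
  have n_d: "near d (-1.92705) 2.26728 0.000006"
    unfolding d_def by (rule near_mono[OF near_diff[OF n_x n_r]]) simp_all
  have d_less: "cmod d \<le> 2.9756" by (rule near_norm_less[OF n_d]) (simp_all add: power2_eq_square)
  have d_greater: "2.97556 \<le> cmod d" by (rule near_norm_greater[OF n_d]) (simp_all add: power2_eq_square)
  \<comment> \<open>The inner triangle has the base from \<open>r\<close> to \<open>x\<close> and
    two legs of length 2; \<open>k\<close> is the ratio of its height to its base, and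
    \<open>v\<close> below is its apex.\<close>
  define k where "k = sqrt (4 / (cmod d)\<^sup>2 - 1 / 4)"
  note k_props = apex_bounds[OF d_greater d_less, of "0.44917" "0.44921", folded k_def]
  have kb: "0.44917 \<le> k" "k \<le> 0.44921" using k_props(1,2) by (simp_all add: power2_eq_square)
  have k: "(cmod d)\<^sup>2 * (1 / 4 + k\<^sup>2) = 4" using k_props(3) by (simp add: power2_eq_square)
  have n_k: "near (complex_of_real k) 0.44919 0 0.00002" using kb unfolding near_def abs_le_iff complex_of_real_def complex.sel by (intro conjI; simp)
  define dk where "dk = complex_of_real k * (\<i> * d)"
  have n_dk: "near dk (-1.01844) (-0.86561) 0.00009"
    unfolding dk_def by (rule near_mult[OF n_k near_ii[OF n_d]]) simp_all
  define dh where "dh = (complex_of_real 0.5) * d"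
  have n_dh: "near dh (-0.96352) 1.13364 0.00001"
    unfolding dh_def by (rule near_mult[OF near_real[of "0.5"] n_d]) simp_all
  define v where "v = ((r + dh) + dk)"
  have n_v: "near v (-1.48196) (-0.598) 0.000106"
    unfolding v_def by (rule near_mono[OF near_add[OF near_add[OF n_r n_dh] n_dk]]) simp_all
  have vx: "cmod (v - x) = 2" "cmod (v - r) = 2"
    using apex_distances[OF k[unfolded d_def]] by (simp_all add: v_def dh_def dk_def d_def)
  define c1 where "c1 = (v - x) * cnj \<omega>"
  have n_c1: "near c1 (-1.75886) (-0.95208) 0.00015"
    unfolding c1_def by (rule near_mult[OF near_diff[OF n_v n_x] near_cnj[OF near_\<omega>]]) simp_all
  define s where "s = (x + c1)"
  have n_s: "near s (-3.185911) 0.449179 0.0001506"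
    unfolding s_def by (rule near_mono[OF near_add[OF n_x n_c1]]) simp_all
  define c2 where "c2 = (v - r) * \<omega>"
  have n_c2: "near c2 (-1.2231) (-1.58242) 0.00016"
    unfolding c2_def by (rule near_mult[OF near_diff[OF n_v n_r] near_\<omega>]) simp_all
  define q where "q = (r + c2)"
  have n_q: "near q (-0.7231) (-2.448445) 0.0001605"
    unfolding q_def by (rule near_mono[OF near_add[OF n_r n_c2]]) simp_all
  have fx: "frame ((v - x) / 2) (((v - x) / 2) * cnj \<omega>)" by (rule frame_\<omega>) (use vx in \<open>simp add: norm_mult norm_divide norm_\<zeta>\<close>)
  have fq: "frame ((v - r) / 2) (((v - r) / 2) * \<omega>)" by (rule frame_\<omega>) (use vx in \<open>simp add: norm_mult norm_divide norm_\<zeta>\<close>)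
  define H0 where "H0 = convex hull {z0, z1, r}"
  have p0: "piece H0 3 {#z0, z0, z1, z1, r, r#}" unfolding H0_def
    by (rule piece_triangle[OF fr1]) (simp_all add: z0_def z1_def w_def x_def y_def r_def zo_def zc_def cnj_\<omega> cnj_\<zeta> scaleR_conv_of_real algebra_simps)
  define H1 where "H1 = convex hull {z0, w, x}"
  have p1: "piece H1 6 {#z0, z0, w, w, x, x#}" unfolding H1_def
    by (rule piece_triangle2[OF frame_\<omega>(1)[OF norm_\<zeta>]]) (simp_all add: z0_def z1_def w_def x_def y_def r_def zo_def zc_def cnj_\<omega> cnj_\<zeta> scaleR_conv_of_real algebra_simps)
  define H2 where "H2 = convex hull {z1, w, y}"
  have p2: "piece H2 6 {#z1, z1, w, w, y, y#}" unfolding H2_def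
    by (rule piece_triangle2[OF fr]) (simp_all add: z0_def z1_def w_def x_def y_def r_def zo_def zc_def cnj_\<omega> cnj_\<zeta> scaleR_conv_of_real algebra_simps)
  define H3 where "H3 = convex hull {x, v, s}"
  have p3: "piece H3 6 {#x, x, v, v, s, s#}" unfolding H3_def
    by (rule piece_triangle2[OF fx]) (simp_all add: s_def c1_def scaleR_conv_of_real field_simps)
  define H4 where "H4 = convex hull {r, v, q}"
  have p4: "piece H4 6 {#r, r, v, v, q, q#}" unfolding H4_def
    by (rule piece_triangle2[OF fq]) (simp_all add: q_def c2_def scaleR_conv_of_real field_simps)
  have i0_1: "H0 \<inter> H1 \<subseteq> {z0}" unfolding H0_def H1_def
    by (rule hull_meet_point'[where w = "Complex 4 (-3)", OF
      ball_pos(2)[OF disjI1[OF refl] near_pos[OF n_z1 n_z0] near_pos[OF n_r n_z0]]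
      ball_neg(2)[OF disjI1[OF refl] near_neg[OF n_w n_z0] near_neg[OF n_x n_z0]]]) simp_all
  have m1: "H0 \<inter> H1 \<subseteq> {z0}"
    using i0_1 by blast
  have g1: "piece (H0 \<union> H1) 8 {#r, r, w, w, x, x, z1, z1#}"
    by (rule piece_glue_point[OF p0 p1 m1]) (simp_all add: add_mset_commute)
  have i0_2: "H0 \<inter> H2 \<subseteq> {z1}" unfolding H0_def H2_def
    by (rule hull_meet_point'[where w = "Complex (-4) (-3)", OF
      ball_pos(2)[OF near_pos[OF n_z0 n_z1] disjI1[OF refl] near_pos[OF n_r n_z1]]
      ball_neg(2)[OF disjI1[OF refl] near_neg[OF n_w n_z1] near_neg[OF n_y n_z1]]]) simp_all
  have i1_2: "H1 \<inter> H2 \<subseteq> {w}" unfolding H1_def H2_def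
    by (rule hull_meet_point'[where w = "Complex (-5) 0", OF
      ball_pos(2)[OF near_pos[OF n_z0 n_w] disjI1[OF refl] near_pos[OF n_x n_w]]
      ball_neg(2)[OF near_neg[OF n_z1 n_w] disjI1[OF refl] near_neg[OF n_y n_w]]]) simp_all
  have m2: "(H0 \<union> H1) \<inter> H2 \<subseteq> {z1, w}"
    using i0_2 i1_2 by blast
  have neq2: "z1 \<noteq> w" by (rule near_neq(1)[OF n_z1 n_w]) simp
  have g2: "piece (H0 \<union> H1 \<union> H2) 12 {#r, r, x, x, y, y#}"
    by (rule piece_glue_two[OF g1 p2 m2 neq2]) (simp_all add: add_mset_commute)
  have i0_3: "H0 \<inter> H3 = {}" unfolding H0_def H3_def
    by (rule hull_disjoint'[where w = "Complex 5 0" and c = "(-3.6)", OF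
      ball_gt(2)[OF near_inner_gt[OF n_z0] near_inner_gt[OF n_z1] near_inner_gt[OF n_r]]
      ball_lt(2)[OF near_inner_lt[OF n_x] near_inner_lt[OF n_v] near_inner_lt[OF n_s]]]) simp_all
  have i1_3: "H1 \<inter> H3 \<subseteq> {x}" unfolding H1_def H3_def
    by (rule hull_meet_point'[where w = "Complex 5 2", OF
      ball_pos(2)[OF near_pos[OF n_z0 n_x] near_pos[OF n_w n_x] disjI1[OF refl]]
      ball_neg(2)[OF disjI1[OF refl] near_neg[OF n_v n_x] near_neg[OF n_s n_x]]]) simp_all
  have i2_3: "H2 \<inter> H3 = {}" unfolding H2_def H3_def
    by (rule hull_disjoint'[where w = "Complex 5 1" and c = "(-0.6)", OF
      ball_gt(2)[OF near_inner_gt[OF n_z1] near_inner_gt[OF n_w] near_inner_gt[OF n_y]]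
      ball_lt(2)[OF near_inner_lt[OF n_x] near_inner_lt[OF n_v] near_inner_lt[OF n_s]]]) simp_all
  have m3: "(H0 \<union> H1 \<union> H2) \<inter> H3 \<subseteq> {x}"
    using i0_3 i1_3 i2_3 by blast
  have g3: "piece (H0 \<union> H1 \<union> H2 \<union> H3) 17 {#r, r, s, s, v, v, y, y#}"
    by (rule piece_glue_point[OF g2 p3 m3]) (simp_all add: add_mset_commute)
  have i0_4: "H0 \<inter> H4 \<subseteq> {r}" unfolding H0_def H4_def
    by (rule hull_meet_point'[where w = "Complex 2 4", OF
      ball_pos(2)[OF near_pos[OF n_z0 n_r] near_pos[OF n_z1 n_r] disjI1[OF refl]]
      ball_neg(2)[OF disjI1[OF refl] near_neg[OF n_v n_r] near_neg[OF n_q n_r]]]) simp_all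
  have i1_4: "H1 \<inter> H4 = {}" unfolding H1_def H4_def
    by (rule hull_disjoint'[where w = "Complex 1 5" and c = "(-1.9)", OF
      ball_gt(2)[OF near_inner_gt[OF n_z0] near_inner_gt[OF n_w] near_inner_gt[OF n_x]]
      ball_lt(2)[OF near_inner_lt[OF n_r] near_inner_lt[OF n_v] near_inner_lt[OF n_q]]]) simp_all
  have i2_4: "H2 \<inter> H4 = {}" unfolding H2_def H4_def
    by (rule hull_disjoint'[where w = "Complex 2 4" and c = "(-0.2)", OF
      ball_gt(2)[OF near_inner_gt[OF n_z1] near_inner_gt[OF n_w] near_inner_gt[OF n_y]]
      ball_lt(2)[OF near_inner_lt[OF n_r] near_inner_lt[OF n_v] near_inner_lt[OF n_q]]]) simp_all
  have i3_4: "H3 \<inter> H4 \<subseteq> {v}" unfolding H3_def H4_def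
    by (rule hull_meet_point'[where w = "Complex (-3) 4", OF
      ball_pos(2)[OF near_pos[OF n_x n_v] disjI1[OF refl] near_pos[OF n_s n_v]]
      ball_neg(2)[OF near_neg[OF n_r n_v] disjI1[OF refl] near_neg[OF n_q n_v]]]) simp_all
  have m4: "(H0 \<union> H1 \<union> H2 \<union> H3) \<inter> H4 \<subseteq> {r, v}"
    using i0_4 i1_4 i2_4 i3_4 by blast
  have neq4: "r \<noteq> v" by (rule near_neq(1)[OF n_r n_v]) simp
  have g4: "piece (H0 \<union> H1 \<union> H2 \<union> H3 \<union> H4) 21 {#q, q, s, s, y, y#}"
    by (rule piece_glue_two[OF g3 p4 m4 neq4]) (simp_all add: add_mset_commute)
  define N where "N = (- (\<i> * (s - q)))"
  have n_N: "near N 2.89762 2.46281 0.000316"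
    unfolding N_def by (rule near_mono[OF near_minus[OF near_ii[OF near_diff[OF n_s n_q]]]]) simp_all
  define N' where "N' = (- N)"
  have n_N': "near N' (-2.89762) (-2.46281) 0.000316"
    unfolding N'_def by (rule near_mono[OF near_minus[OF n_N]]) simp_all
  have n_tD: "near ((complex_of_real 5) * (s - q)) (-12.314055) 14.48812 0.001556"
    by (rule near_mult[OF near_real[of "5"] near_diff[OF n_s n_q]]) simp_all
  define L where "L = (((complex_of_real 5) * (s - q)) - N)"
  have n_L: "near L (-15.21168) 12.02531 0.001877"
    unfolding L_def by (rule near_mono[OF near_diff[OF n_tD n_N]]) simp_all
  have N0: "N \<bullet> (s - q) = 0" unfolding N_def by (rule inner_ii)
  have a0: "admissible q s y 5 N H0" unfolding H0_def
    by (rule admissible_hull'[OF disjI1[OF refl] N0 N'_def L_def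
      ball_pos(2)[OF near_pos'[OF n_N n_z0 n_q] near_pos'[OF n_N n_z1 n_q] near_pos'[OF n_N n_r n_q]]
      ball_pos(2)[OF near_pos'[OF n_N' n_z0 n_y] near_pos'[OF n_N' n_z1 n_y] near_pos'[OF n_N' n_r n_y]]
      ball_pos(2)[OF near_pos'[OF n_L n_z0 n_y] near_pos'[OF n_L n_z1 n_y] near_pos'[OF n_L n_r n_y]]]) simp_all
  have a1: "admissible q s y 5 N H1" unfolding H1_def
    by (rule admissible_hull'[OF disjI1[OF refl] N0 N'_def L_def
      ball_pos(2)[OF near_pos'[OF n_N n_z0 n_q] near_pos'[OF n_N n_w n_q] near_pos'[OF n_N n_x n_q]]
      ball_pos(2)[OF near_pos'[OF n_N' n_z0 n_y] near_pos'[OF n_N' n_w n_y] near_pos'[OF n_N' n_x n_y]]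
      ball_pos(2)[OF near_pos'[OF n_L n_z0 n_y] near_pos'[OF n_L n_w n_y] near_pos'[OF n_L n_x n_y]]]) simp_all
  have a2: "admissible q s y 5 N H2" unfolding H2_def
    by (rule admissible_hull'[OF disjI1[OF refl] N0 N'_def L_def
      ball_pos(2)[OF near_pos'[OF n_N n_z1 n_q] near_pos'[OF n_N n_w n_q] near_pos'[OF n_N n_y n_q]]
      ball_pos(2)[OF near_pos'[OF n_N' n_z1 n_y] near_pos'[OF n_N' n_w n_y] disjI1[OF refl]]
      ball_pos(2)[OF near_pos'[OF n_L n_z1 n_y] near_pos'[OF n_L n_w n_y] disjI1[OF refl]]]) simp_all
  have a3: "admissible q s y 5 N H3" unfolding H3_def
    by (rule admissible_hull'[OF disjI2[OF refl] N0 N'_def L_def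
      ball_pos(2)[OF near_pos'[OF n_N n_x n_s] near_pos'[OF n_N n_v n_s] disjI1[OF refl]]
      ball_pos(2)[OF near_pos'[OF n_N' n_x n_y] near_pos'[OF n_N' n_v n_y] near_pos'[OF n_N' n_s n_y]]
      ball_pos(2)[OF near_pos'[OF n_L n_x n_y] near_pos'[OF n_L n_v n_y] near_pos'[OF n_L n_s n_y]]]) simp_all
  have a4: "admissible q s y 5 N H4" unfolding H4_def
    by (rule admissible_hull'[OF disjI1[OF refl] N0 N'_def L_def
      ball_pos(2)[OF near_pos'[OF n_N n_r n_q] near_pos'[OF n_N n_v n_q] disjI1[OF refl]]
      ball_pos(2)[OF near_pos'[OF n_N' n_r n_y] near_pos'[OF n_N' n_v n_y] near_pos'[OF n_N' n_q n_y]]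
      ball_pos(2)[OF near_pos'[OF n_L n_r n_y] near_pos'[OF n_L n_v n_y] near_pos'[OF n_L n_q n_y]]]) simp_all
  have ad: "admissible q s y 5 N (H0 \<union> H1 \<union> H2 \<union> H3 \<union> H4)"
    by (intro admissible_Un a0 a1 a2 a3 a4)
  have hb: "4.891 * cmod N \<le> N \<bullet> (y - q)" "N \<bullet> (y - q) \<le> 4.896 * cmod N"
    using height_bounds[OF n_N n_y n_q, where E = "0.0031" and m = "3.8033" and k = "3.80239" and l = "4.891" and u = "4.896"] by (simp_all add: power2_eq_square)
  have ab: "q \<noteq> s" by (rule near_neq(1)[OF n_q n_s]) simp
  have "piece (H0 \<union> H1 \<union> H2 \<union> H3 \<union> H4) 21 {#q, q, s, s, y, y#}" using g4 by (simp add: add_mset_commute)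
  from body_of_admissible'[OF this ab ad[unfolded N_def] hb[unfolded N_def norm_ii_diff]] show ?thesis .
qed

text \<open>The strips with 7 and 5 vertices carry the two opposite bars of the linkage; their ends \<open>p\<close> and \<open>q\<close> are
  joined by a triangle of side 2.\<close>

lemma body16: "\<exists>h. body 16 h 6 \<and> 3.947 \<le> h \<and> h \<le> 3.95"
proof -
  \<comment> \<open>With \<open>e = arm1 t\<close> and \<open>u = arm2 (-1) t\<close>, the end
    \<open>q\<close> of the 5-vertex strip is \<open>e - u * cnj \<omega>\<close>, and
    \<open>- \<omega>\<close> is the end \<open>p\<close> of the other strip. The two parameters
    bracket the solution of \<open>cmod (q - p) = 2\<close>; their distance limits the precision of
    everything that follows.\<close>
  have e0a: "near (arm1 0.855726) 0.855726 0.517429234 0.000000002" and e0b: "near (arm2 (-1) 0.855726) 0.892808236 0.450436959 0.000000006"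
    using near_arms[of "0.855726" "0.855726" "0.855726" "0.517429233" "0.517429236" "0.619739306" "0.619739309" "(-1)" "0.855726" "0.000000002" "0.517429234" "0.892808236" "0.000000006" "0.450436959"] by (simp_all add: power2_eq_square)
  have q0: "near (arm2 (-1) 0.855726 * (- cnj \<omega>)) (-0.836493967) 0.547976134 0.00000001"
    by (rule near_mult[OF e0b near_minus[OF near_cnj[OF near_\<omega>]]]) simp_all
  have l0: "2 \<le> cmod (arm1 0.855726 + arm2 (-1) 0.855726 * (- cnj \<omega>) + \<omega>)"
    by (rule near_norm_greater[OF near_add[OF near_add[OF e0a q0] near_\<omega>]]) (simp_all add: power2_eq_square)
  have e1a: "near (arm1 0.85573) 0.85573 0.51742262 0.000000002" and e1b: "near (arm2 (-1) 0.85573) 0.892804821 0.450443727 0.000000007"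
    using near_arms[of "0.85573" "0.85573" "0.85573" "0.517422618" "0.517422621" "0.619744496" "0.619744499" "(-1)" "0.85573" "0.000000002" "0.51742262" "0.892804821" "0.000000007" "0.450443727"] by (simp_all add: power2_eq_square)
  have q1: "near (arm2 (-1) 0.85573 * (- cnj \<omega>)) (-0.836498121) 0.547969792 0.000000012"
    by (rule near_mult[OF e1b near_minus[OF near_cnj[OF near_\<omega>]]]) simp_all
  have l1: "cmod (arm1 0.85573 + arm2 (-1) 0.85573 * (- cnj \<omega>) + \<omega>) \<le> 2"
    by (rule near_norm_less[OF near_add[OF near_add[OF e1a q1] near_\<omega>]]) (simp_all add: power2_eq_square)
  obtain t where t: "0.855726 \<le> t" "t \<le> 0.85573" "cmod (arm1 t + arm2 (-1) t * (- cnj \<omega>) + \<omega>) = 2"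
    using linkage_exists[of "0.855726" "0.85573" "(-1)" "(- cnj \<omega>)" "2"] l0 l1  by auto
  have eua: "near (arm1 t) 0.855728 0.51742592 0.00000333" and eub: "near (arm2 (-1) t) 0.89280653 0.45044034 0.00001434"
    using near_arms[OF t(1,2), of "0.5174226" "0.51742925" "0.61973929" "0.61974451" "(-1)" "0.855728" "0.00000333" "0.51742592" "0.89280653" "0.00001434" "0.45044034"] by (simp_all add: power2_eq_square)
  have tt: "1 / 4 < t" "t < 1" using t(1,2) by simp_all
  have sq: "cmod (arm1 t) = 1" "cmod (arm2 (-1) t) = 1" "cmod (arm1 t + arm2 (-1) t - 2) = 1"
    using norm_arms[OF tt, of "(-1)"] by simp_all
  define e where "e = arm1 t"
  have n_e: "near e 0.855728 0.51742592 0.00000333"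
    unfolding e_def by (rule near_mono[OF eua]) simp_all
  define u where "u = arm2 (-1) t"
  have n_u: "near u 0.89280653 0.45044034 0.00001434"
    unfolding u_def by (rule near_mono[OF eub]) simp_all
  note norms = sq[folded e_def u_def]
  \<comment> \<open>\<open>j\<close>, \<open>j2\<close> and \<open>b\<close>, \<open>b2\<close> are
    the degree-3 vertices of the two strips; the arms of the linkage are the edges
    \<open>j b\<close> and \<open>j2 b2\<close>, which raise their degrees to 4.\<close>
  define j where "j = (0::complex)"
  have n_j: "near j 0 0 0"
    unfolding j_def by (rule near_mono[OF near_numeral(3)]) simp_all
  define j2 where "j2 = (2::complex)"
  have n_j2: "near j2 2 0 0"
    unfolding j2_def by (rule near_mono[OF near_numeral(1)]) simp_all
  define p where "p = (- \<omega>)"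
  have n_p: "near p (-0.5) (-0.866025) 0.0000005"
    unfolding p_def by (rule near_mono[OF near_minus[OF near_\<omega>]]) simp_all
  define p3 where "p3 = ((3::complex) - \<omega>)"
  have n_p3: "near p3 2.5 (-0.866025) 0.0000005"
    unfolding p3_def by (rule near_mono[OF near_diff[OF near_numeral(1) near_\<omega>]]) simp_all
  define b where "b = e"
  have n_b: "near b 0.855728 0.517426 0.0000035"
    unfolding b_def by (rule near_mono[OF n_e]) simp_all
  define b2 where "b2 = (e + u)"
  have n_b2: "near b2 1.748535 0.967866 0.0000182"
    unfolding b2_def by (rule near_mono[OF near_add[OF n_e n_u]]) simp_all
  define uw where "uw = u * cnj \<omega>"
  have n_uw: "near uw 0.836496 (-0.547973) 0.0000197"
    unfolding uw_def by (rule near_mult[OF n_u near_cnj[OF near_\<omega>]]) simp_all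
  define q where "q = (e - uw)"
  have n_q: "near q 0.019232 1.065399 0.0000232"
    unfolding q_def by (rule near_mono[OF near_diff[OF n_e n_uw]]) simp_all
  define f where "f = (q + 2 * u)"
  have n_f: "near f 1.804845 1.96628 0.0000522"
    unfolding f_def by (rule near_mono[OF near_add[OF n_q near_scale2[OF n_u]]]) simp_all
  have qp: "cmod (q - p) = 2" using t(3) by (simp add: q_def p_def uw_def e_def u_def algebra_simps)
  define qw where "qw = (q - p) * \<omega>"
  have n_qw: "near qw (-1.4130462) 1.4153801 0.0000325"
    unfolding qw_def by (rule near_mult[OF near_diff[OF n_q n_p] near_\<omega>]) simp_all
  define r where "r = (p + qw)"
  have n_r: "near r (-1.913046) 0.549355 0.0000332"
    unfolding r_def by (rule near_mono[OF near_add[OF n_p n_qw]]) simp_all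
  have f7: "frame 1 (1 * \<omega>)" by (rule frame_\<omega>) (use qp in \<open>simp add: norm_mult norm_divide norm_\<zeta>\<close>)
  have f5: "frame u (u * cnj \<omega>)" by (rule frame_\<omega>) (use norms in \<open>simp add: norm_mult norm_divide norm_\<zeta>\<close>)
  have ft: "frame ((q - p) / 2) (((q - p) / 2) * \<omega>)" by (rule frame_\<omega>) (use qp in \<open>simp add: norm_mult norm_divide norm_\<zeta>\<close>)
  define H0 where "H0 = convex hull {p, p3, j2, j}"
  have p0: "piece H0 7 {#p, p, p3, p3, j, j2#}" unfolding H0_def
    by (rule piece_strip7[OF f7]) (simp_all add: j_def j2_def p_def p3_def b_def b2_def f_def q_def uw_def r_def qw_def cnj_\<omega> cnj_\<zeta> scaleR_conv_of_real algebra_simps)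
  define H1 where "H1 = convex hull {j, b}"
  have p1: "piece H1 2 {#j, j, j, b, b, b#}" unfolding H1_def
    by (rule piece_edge) (simp add: norms j_def b_def norm_minus_commute)
  define H2 where "H2 = convex hull {j2, b2}"
  have p2: "piece H2 2 {#j2, j2, j2, b2, b2, b2#}" unfolding H2_def
    by (rule piece_edge) (simp add: norms j2_def b2_def norm_minus_commute)
  define H3 where "H3 = convex hull {q, f, b2, b}"
  have p3: "piece H3 5 {#q, q, f, f, b, b2#}" unfolding H3_def
    by (rule piece_strip5[OF f5]) (simp_all add: j_def j2_def p_def p3_def b_def b2_def f_def q_def uw_def r_def qw_def cnj_\<omega> cnj_\<zeta> scaleR_conv_of_real algebra_simps)
  define H4 where "H4 = convex hull {p, q, r}"
  have p4: "piece H4 6 {#p, p, q, q, r, r#}" unfolding H4_def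
    by (rule piece_triangle2[OF ft]) (simp_all add: j_def j2_def p_def p3_def b_def b2_def f_def q_def uw_def r_def qw_def cnj_\<omega> cnj_\<zeta> scaleR_conv_of_real algebra_simps)
  have i0_1: "H0 \<inter> H1 \<subseteq> {j}" unfolding H0_def H1_def
    by (rule hull_meet_point'[where w = "Complex 1 (-5)", OF
      ball_pos(3)[OF near_pos[OF n_p n_j] near_pos[OF n_p3 n_j] near_pos[OF n_j2 n_j] disjI1[OF refl]]
      ball_neg(1)[OF disjI1[OF refl] near_neg[OF n_b n_j]]]) simp_all
  have m1: "H0 \<inter> H1 \<subseteq> {j}"
    using i0_1 by blast
  have g1: "piece (H0 \<union> H1) 8 {#b, b, b, j2, p, p, p3, p3#}"
    by (rule piece_glue_point[OF p0 p1 m1]) (simp_all add: add_mset_commute)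
  have i0_2: "H0 \<inter> H2 \<subseteq> {j2}" unfolding H0_def H2_def
    by (rule hull_meet_point'[where w = "Complex (-2) (-5)", OF
      ball_pos(3)[OF near_pos[OF n_p n_j2] near_pos[OF n_p3 n_j2] disjI1[OF refl] near_pos[OF n_j n_j2]]
      ball_neg(1)[OF disjI1[OF refl] near_neg[OF n_b2 n_j2]]]) simp_all
  have i1_2: "H1 \<inter> H2 = {}" unfolding H1_def H2_def
    by (rule hull_disjoint'[where w = "Complex (-5) (-1)" and c = "(-7.3)", OF
      ball_gt(1)[OF near_inner_gt[OF n_j] near_inner_gt[OF n_b]]
      ball_lt(1)[OF near_inner_lt[OF n_j2] near_inner_lt[OF n_b2]]]) simp_all
  have m2: "(H0 \<union> H1) \<inter> H2 \<subseteq> {j2}"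
    using i0_2 i1_2 by blast
  have g2: "piece (H0 \<union> H1 \<union> H2) 9 {#b, b, b, b2, b2, b2, p, p, p3, p3#}"
    by (rule piece_glue_point[OF g1 p2 m2]) (simp_all add: add_mset_commute)
  have i0_3: "H0 \<inter> H3 = {}" unfolding H0_def H3_def
    by (rule hull_disjoint'[where w = "Complex 0 (-5)" and c = "(-1.3)", OF
      ball_gt(3)[OF near_inner_gt[OF n_p] near_inner_gt[OF n_p3] near_inner_gt[OF n_j2] near_inner_gt[OF n_j]]
      ball_lt(3)[OF near_inner_lt[OF n_q] near_inner_lt[OF n_f] near_inner_lt[OF n_b2] near_inner_lt[OF n_b]]]) simp_all
  have i1_3: "H1 \<inter> H3 \<subseteq> {b}" unfolding H1_def H3_def
    by (rule hull_meet_point'[where w = "Complex 0 (-5)", OF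
      ball_pos(1)[OF near_pos[OF n_j n_b] disjI1[OF refl]]
      ball_neg(3)[OF near_neg[OF n_q n_b] near_neg[OF n_f n_b] near_neg[OF n_b2 n_b] disjI1[OF refl]]]) simp_all
  have i2_3: "H2 \<inter> H3 \<subseteq> {b2}" unfolding H2_def H3_def
    by (rule hull_meet_point'[where w = "Complex 4 (-3)", OF
      ball_pos(1)[OF near_pos[OF n_j2 n_b2] disjI1[OF refl]]
      ball_neg(3)[OF near_neg[OF n_q n_b2] near_neg[OF n_f n_b2] disjI1[OF refl] near_neg[OF n_b n_b2]]]) simp_all
  have m3: "(H0 \<union> H1 \<union> H2) \<inter> H3 \<subseteq> {b, b2}"
    using i0_3 i1_3 i2_3 by blast
  have neq3: "b \<noteq> b2" by (rule near_neq(1)[OF n_b n_b2]) simp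
  have g3: "piece (H0 \<union> H1 \<union> H2 \<union> H3) 12 {#f, f, p, p, p3, p3, q, q#}"
    by (rule piece_glue_two[OF g2 p3 m3 neq3]) (simp_all add: add_mset_commute)
  have i0_4: "H0 \<inter> H4 \<subseteq> {p}" unfolding H0_def H4_def
    by (rule hull_meet_point'[where w = "Complex 5 (-2)", OF
      ball_pos(3)[OF disjI1[OF refl] near_pos[OF n_p3 n_p] near_pos[OF n_j2 n_p] near_pos[OF n_j n_p]]
      ball_neg(2)[OF disjI1[OF refl] near_neg[OF n_q n_p] near_neg[OF n_r n_p]]]) simp_all
  have i1_4: "H1 \<inter> H4 = {}" unfolding H1_def H4_def
    by (rule hull_disjoint'[where w = "Complex 5 (-1)" and c = "(-0.5)", OF
      ball_gt(1)[OF near_inner_gt[OF n_j] near_inner_gt[OF n_b]]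
      ball_lt(2)[OF near_inner_lt[OF n_p] near_inner_lt[OF n_q] near_inner_lt[OF n_r]]]) simp_all
  have i2_4: "H2 \<inter> H4 = {}" unfolding H2_def H4_def
    by (rule hull_disjoint'[where w = "Complex 5 0" and c = "4.4", OF
      ball_gt(1)[OF near_inner_gt[OF n_j2] near_inner_gt[OF n_b2]]
      ball_lt(2)[OF near_inner_lt[OF n_p] near_inner_lt[OF n_q] near_inner_lt[OF n_r]]]) simp_all
  have i3_4: "H3 \<inter> H4 \<subseteq> {q}" unfolding H3_def H4_def
    by (rule hull_meet_point'[where w = "Complex 5 1", OF
      ball_pos(3)[OF disjI1[OF refl] near_pos[OF n_f n_q] near_pos[OF n_b2 n_q] near_pos[OF n_b n_q]]
      ball_neg(2)[OF near_neg[OF n_p n_q] disjI1[OF refl] near_neg[OF n_r n_q]]]) simp_all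
  have m4: "(H0 \<union> H1 \<union> H2 \<union> H3) \<inter> H4 \<subseteq> {p, q}"
    using i0_4 i1_4 i2_4 i3_4 by blast
  have neq4: "p \<noteq> q" by (rule near_neq(1)[OF n_p n_q]) simp
  have g4: "piece (H0 \<union> H1 \<union> H2 \<union> H3 \<union> H4) 16 {#f, f, p3, p3, r, r#}"
    by (rule piece_glue_two[OF g3 p4 m4 neq4]) (simp_all add: add_mset_commute)
  define N where "N = (- (\<i> * (p3 - f)))"
  have n_N: "near N (-2.8323) (-0.69516) 0.000058"
    unfolding N_def by (rule near_mono[OF near_minus[OF near_ii[OF near_diff[OF n_p3 n_f]]]]) simp_all
  define N' where "N' = (- N)"
  have n_N': "near N' 2.8323 0.69516 0.000058"
    unfolding N'_def by (rule near_mono[OF near_minus[OF n_N]]) simp_all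
  have n_tD: "near ((complex_of_real 6) * (p3 - f)) 4.17093 (-16.99383) 0.000317"
    by (rule near_mult[OF near_real[of "6"] near_diff[OF n_p3 n_f]]) simp_all
  define L where "L = (((complex_of_real 6) * (p3 - f)) - N)"
  have n_L: "near L 7.00323 (-16.29867) 0.000375"
    unfolding L_def by (rule near_mono[OF near_diff[OF n_tD n_N]]) simp_all
  have N0: "N \<bullet> (p3 - f) = 0" unfolding N_def by (rule inner_ii)
  have a0: "admissible f p3 r 6 N H0" unfolding H0_def
    by (rule admissible_hull'[OF disjI2[OF refl] N0 N'_def L_def
      ball_pos(3)[OF near_pos'[OF n_N n_p n_p3] disjI1[OF refl] near_pos'[OF n_N n_j2 n_p3] near_pos'[OF n_N n_j n_p3]]
      ball_pos(3)[OF near_pos'[OF n_N' n_p n_r] near_pos'[OF n_N' n_p3 n_r] near_pos'[OF n_N' n_j2 n_r] near_pos'[OF n_N' n_j n_r]]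
      ball_pos(3)[OF near_pos'[OF n_L n_p n_r] near_pos'[OF n_L n_p3 n_r] near_pos'[OF n_L n_j2 n_r] near_pos'[OF n_L n_j n_r]]]) simp_all
  have a1: "admissible f p3 r 6 N H1" unfolding H1_def
    by (rule admissible_hull'[OF disjI1[OF refl] N0 N'_def L_def
      ball_pos(1)[OF near_pos'[OF n_N n_j n_f] near_pos'[OF n_N n_b n_f]]
      ball_pos(1)[OF near_pos'[OF n_N' n_j n_r] near_pos'[OF n_N' n_b n_r]]
      ball_pos(1)[OF near_pos'[OF n_L n_j n_r] near_pos'[OF n_L n_b n_r]]]) simp_all
  have a2: "admissible f p3 r 6 N H2" unfolding H2_def
    by (rule admissible_hull'[OF disjI1[OF refl] N0 N'_def L_def
      ball_pos(1)[OF near_pos'[OF n_N n_j2 n_f] near_pos'[OF n_N n_b2 n_f]]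
      ball_pos(1)[OF near_pos'[OF n_N' n_j2 n_r] near_pos'[OF n_N' n_b2 n_r]]
      ball_pos(1)[OF near_pos'[OF n_L n_j2 n_r] near_pos'[OF n_L n_b2 n_r]]]) simp_all
  have a3: "admissible f p3 r 6 N H3" unfolding H3_def
    by (rule admissible_hull'[OF disjI1[OF refl] N0 N'_def L_def
      ball_pos(3)[OF near_pos'[OF n_N n_q n_f] disjI1[OF refl] near_pos'[OF n_N n_b2 n_f] near_pos'[OF n_N n_b n_f]]
      ball_pos(3)[OF near_pos'[OF n_N' n_q n_r] near_pos'[OF n_N' n_f n_r] near_pos'[OF n_N' n_b2 n_r] near_pos'[OF n_N' n_b n_r]]
      ball_pos(3)[OF near_pos'[OF n_L n_q n_r] near_pos'[OF n_L n_f n_r] near_pos'[OF n_L n_b2 n_r] near_pos'[OF n_L n_b n_r]]]) simp_all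
  have a4: "admissible f p3 r 6 N H4" unfolding H4_def
    by (rule admissible_hull'[OF disjI1[OF refl] N0 N'_def L_def
      ball_pos(2)[OF near_pos'[OF n_N n_p n_f] near_pos'[OF n_N n_q n_f] near_pos'[OF n_N n_r n_f]]
      ball_pos(2)[OF near_pos'[OF n_N' n_p n_r] near_pos'[OF n_N' n_q n_r] disjI1[OF refl]]
      ball_pos(2)[OF near_pos'[OF n_L n_p n_r] near_pos'[OF n_L n_q n_r] disjI1[OF refl]]]) simp_all
  have ad: "admissible f p3 r 6 N (H0 \<union> H1 \<union> H2 \<union> H3 \<union> H4)"
    by (intro admissible_Un a0 a1 a2 a3 a4)
  have hb: "3.947 * cmod N \<le> N \<bullet> (r - f)" "N \<bullet> (r - f) \<le> 3.95 * cmod N"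
    using height_bounds[OF n_N n_r n_f, where E = "0.0006" and m = "2.91644" and k = "2.91629" and l = "3.947" and u = "3.95"] by (simp_all add: power2_eq_square)
  have ab: "f \<noteq> p3" by (rule near_neq(1)[OF n_f n_p3]) simp
  have "piece (H0 \<union> H1 \<union> H2 \<union> H3 \<union> H4) 16 {#f, f, p3, p3, r, r#}" using g4 by (simp add: add_mset_commute)
  from body_of_admissible'[OF this ab ad[unfolded N_def] hb[unfolded N_def norm_ii_diff]] show ?thesis .
qed

text \<open>Here the shorter bar of the linkage belongs to two triangles of side 2 with a common corner \<open>w\<close>, and
  \<open>p\<close>, \<open>q\<close> are joined by a triangle of side 1.\<close>

lemma body19: "\<exists>h. body 19 h 3.76 \<and> 3.868 \<le> h \<and> h \<le> 3.87"
proof -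
  have n_zo: "near (\<zeta> * \<omega>) (-0.713525492) 0.700629269 0.000000003"
    by (rule near_mult[OF near_\<zeta> near_\<omega>]) simp_all
  \<comment> \<open>Multiplying \<open>u\<close> by \<open>2 * \<zeta>\<close> leads from
    \<open>b\<close> to the common corner \<open>w\<close>, and a further factor
    \<open>\<omega>\<close> leads to the outer corner \<open>q\<close> of the triangle on
    \<open>b w\<close>. The two parameters bracket the solution of
    \<open>cmod (q - p) = 1\<close>.\<close>
  have e0a: "near (arm1 0.985326) 0.985326 0.170682962 0.000000002" and e0b: "near (arm2 (-1) 0.985326) 0.649584453 0.760289444 0.000000006"
    using near_arms[of "0.985326" "0.985326" "0.985326" "0.170682961" "0.170682964" "0.833401589" "0.833401592" "(-1)" "0.985326" "0.000000002" "0.170682962" "0.649584453" "0.000000006" "0.760289444"] by (simp_all add: power2_eq_square)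
  have q0: "near (arm2 (-1) 0.985326 * (2 * (\<zeta> * \<omega>))) (-1.992352208) (-0.174736038) 0.000000026"
    by (rule near_mult[OF e0b near_scale2[OF n_zo]]) simp_all
  have l0: "1 \<le> cmod (arm1 0.985326 + arm2 (-1) 0.985326 * (2 * (\<zeta> * \<omega>)) + \<omega>)"
    by (rule near_norm_greater[OF near_add[OF near_add[OF e0a q0] near_\<omega>]]) (simp_all add: power2_eq_square)
  have e1a: "near (arm1 0.98533) 0.98533 0.17065987 0.000000002" and e1b: "near (arm2 (-1) 0.98533) 0.649564668 0.760306347 0.000000005"
    using near_arms[of "0.98533" "0.98533" "0.98533" "0.170659868" "0.170659871" "0.833410154" "0.833410157" "(-1)" "0.98533" "0.000000002" "0.17065987" "0.649564668" "0.000000005" "0.760306347"] by (simp_all add: power2_eq_square)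
  have q1: "near (arm2 (-1) 0.98533 * (2 * (\<zeta> * \<omega>))) (-1.992347659) (-0.174787884) 0.000000023"
    by (rule near_mult[OF e1b near_scale2[OF n_zo]]) simp_all
  have l1: "cmod (arm1 0.98533 + arm2 (-1) 0.98533 * (2 * (\<zeta> * \<omega>)) + \<omega>) \<le> 1"
    by (rule near_norm_less[OF near_add[OF near_add[OF e1a q1] near_\<omega>]]) (simp_all add: power2_eq_square)
  obtain t where t: "0.985326 \<le> t" "t \<le> 0.98533" "cmod (arm1 t + arm2 (-1) t * (2 * (\<zeta> * \<omega>)) + \<omega>) = 1"
    using linkage_exists[of "0.985326" "0.98533" "(-1)" "(2 * (\<zeta> * \<omega>))" "1"] l0 l1  by auto
  have eua: "near (arm1 t) 0.985328 0.17067142 0.00001157" and eub: "near (arm2 (-1) t) 0.64957456 0.7602979 0.00003212"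
    using near_arms[OF t(1,2), of "0.17065985" "0.17068298" "0.83340158" "0.83341017" "(-1)" "0.985328" "0.00001157" "0.17067142" "0.64957456" "0.00003212" "0.7602979"] by (simp_all add: power2_eq_square)
  have tt: "1 / 4 < t" "t < 1" using t(1,2) by simp_all
  have sq: "cmod (arm1 t) = 1" "cmod (arm2 (-1) t) = 1" "cmod (arm1 t + arm2 (-1) t - 2) = 1"
    using norm_arms[OF tt, of "(-1)"] by simp_all
  define e where "e = arm1 t"
  have n_e: "near e 0.985328 0.17067142 0.00001157"
    unfolding e_def by (rule near_mono[OF eua]) simp_all
  define u where "u = arm2 (-1) t"
  have n_u: "near u 0.64957456 0.7602979 0.00003212"
    unfolding u_def by (rule near_mono[OF eub]) simp_all
  note norms = sq[folded e_def u_def]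
  define j where "j = (0::complex)"
  have n_j: "near j 0 0 0"
    unfolding j_def by (rule near_mono[OF near_numeral(3)]) simp_all
  define j2 where "j2 = (2::complex)"
  have n_j2: "near j2 2 0 0"
    unfolding j2_def by (rule near_mono[OF near_numeral(1)]) simp_all
  define p where "p = (- \<omega>)"
  have n_p: "near p (-0.5) (-0.866025) 0.0000005"
    unfolding p_def by (rule near_mono[OF near_minus[OF near_\<omega>]]) simp_all
  define p3 where "p3 = ((3::complex) - \<omega>)"
  have n_p3: "near p3 2.5 (-0.866025) 0.0000005"
    unfolding p3_def by (rule near_mono[OF near_diff[OF near_numeral(1) near_\<omega>]]) simp_all
  define b where "b = e"
  have n_b: "near b 0.985328 0.170671 0.000012"
    unfolding b_def by (rule near_mono[OF n_e]) simp_all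
  define b2 where "b2 = (e + u)"
  have n_b2: "near b2 1.634903 0.930969 0.0000442"
    unfolding b2_def by (rule near_mono[OF near_add[OF n_e n_u]]) simp_all
  define uz where "uz = u * \<zeta>"
  have n_uz: "near uz (-0.5737616) 0.8190223 0.0000392"
    unfolding uz_def by (rule near_mult[OF n_u near_\<zeta>]) simp_all
  define w where "w = (e + 2 * uz)"
  have n_w: "near w (-0.162195) 1.808716 0.0000902"
    unfolding w_def by (rule near_mono[OF near_add[OF n_e near_scale2[OF n_uz]]]) simp_all
  define uzw where "uzw = uz * \<omega>"
  have n_uzw: "near uzw (-0.9961749) (-0.087381) 0.0000536"
    unfolding uzw_def by (rule near_mult[OF n_uz near_\<omega>]) simp_all
  define q where "q = (e + 2 * uzw)"
  have n_q: "near q (-1.007022) (-0.004091) 0.0001192"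
    unfolding q_def by (rule near_mono[OF near_add[OF n_e near_scale2[OF n_uzw]]]) simp_all
  define uy where "uy = u * cnj \<zeta>"
  have n_uy: "near uy 0.8985489 (-0.4388734) 0.0000392"
    unfolding uy_def by (rule near_mult[OF n_u near_cnj[OF near_\<zeta>]]) simp_all
  define uyw where "uyw = uy * cnj \<omega>"
  have n_uyw: "near uyw 0.0691989 (-0.9976029) 0.0000536"
    unfolding uyw_def by (rule near_mult[OF n_uy near_cnj[OF near_\<omega>]]) simp_all
  define y where "y = ((e + u) - 2 * uyw)"
  have n_y: "near y 1.496505 2.926175 0.0001512"
    unfolding y_def by (rule near_mono[OF near_diff[OF near_add[OF n_e n_u] near_scale2[OF n_uyw]]]) simp_all
  have qp: "cmod (q - p) = 1" using t(3) by (simp add: q_def p_def uz_def uzw_def e_def u_def algebra_simps)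
  define qw where "qw = (q - p) * \<omega>"
  have n_qw: "near qw (-0.9999677) (-0.0081269) 0.0001636"
    unfolding qw_def by (rule near_mult[OF near_diff[OF n_q n_p] near_\<omega>]) simp_all
  define r where "r = (p + qw)"
  have n_r: "near r (-1.499968) (-0.874152) 0.0001644"
    unfolding r_def by (rule near_mono[OF near_add[OF n_p n_qw]]) simp_all
  have f7: "frame 1 (1 * \<omega>)" by (rule frame_\<omega>) (use qp in \<open>simp add: norm_mult norm_divide norm_\<zeta>\<close>)
  have fz: "frame uz (uz * \<omega>)" by (rule frame_\<omega>) (use norms in \<open>simp add: uz_def norm_mult norm_\<zeta>\<close>)
  have fy: "frame (- uy) ((- uy) * cnj \<omega>)" by (rule frame_\<omega>) (use norms in \<open>simp add: uy_def norm_mult norm_\<zeta>\<close>)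
  have ft: "frame (q - p) ((q - p) * \<omega>)" by (rule frame_\<omega>) (use qp in \<open>simp add: norm_mult norm_divide norm_\<zeta>\<close>)
  define H0 where "H0 = convex hull {p, p3, j2, j}"
  have p0: "piece H0 7 {#p, p, p3, p3, j, j2#}" unfolding H0_def
    by (rule piece_strip7[OF f7]) (simp_all add: j_def j2_def p_def p3_def b_def b2_def w_def q_def uz_def uzw_def uy_def uyw_def y_def r_def qw_def cnj_\<omega> cnj_\<zeta> scaleR_conv_of_real algebra_simps)
  define H1 where "H1 = convex hull {j, b}"
  have p1: "piece H1 2 {#j, j, j, b, b, b#}" unfolding H1_def
    by (rule piece_edge) (simp add: norms j_def b_def norm_minus_commute)
  define H2 where "H2 = convex hull {j2, b2}"
  have p2: "piece H2 2 {#j2, j2, j2, b2, b2, b2#}" unfolding H2_def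
    by (rule piece_edge) (simp add: norms j2_def b2_def norm_minus_commute)
  define H3 where "H3 = convex hull {b, w, q}"
  have p3: "piece H3 6 {#b, b, w, w, q, q#}" unfolding H3_def
    by (rule piece_triangle2[OF fz]) (simp_all add: j_def j2_def p_def p3_def b_def b2_def w_def q_def uz_def uzw_def uy_def uyw_def y_def r_def qw_def cnj_\<omega> cnj_\<zeta> scaleR_conv_of_real algebra_simps)
  \<comment> \<open>The triangles of side 2 supply only the legs of the inner triangle
    \<open>b\<close>, \<open>b2\<close>, \<open>w\<close>; its base, the short bar of the linkage,
    is a separate edge.\<close>
  define H4 where "H4 = convex hull {b, b2}"
  have p4: "piece H4 2 {#b, b, b, b2, b2, b2#}" unfolding H4_def
    by (rule piece_edge) (simp add: norms b_def b2_def norm_minus_commute)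
  define H5 where "H5 = convex hull {b2, w, y}"
  have p5: "piece H5 6 {#b2, b2, w, w, y, y#}" unfolding H5_def
    by (rule piece_triangle2[OF fy]) (simp_all add: j_def j2_def p_def p3_def b_def b2_def w_def q_def uz_def uzw_def uy_def uyw_def y_def r_def qw_def cnj_\<omega> cnj_\<zeta> scaleR_conv_of_real algebra_simps)
  define H6 where "H6 = convex hull {p, q, r}"
  have p6: "piece H6 3 {#p, p, q, q, r, r#}" unfolding H6_def
    by (rule piece_triangle[OF ft]) (simp_all add: j_def j2_def p_def p3_def b_def b2_def w_def q_def uz_def uzw_def uy_def uyw_def y_def r_def qw_def cnj_\<omega> cnj_\<zeta> scaleR_conv_of_real algebra_simps)
  have i0_1: "H0 \<inter> H1 \<subseteq> {j}" unfolding H0_def H1_def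
    by (rule hull_meet_point'[where w = "Complex 1 (-12)", OF
      ball_pos(3)[OF near_pos[OF n_p n_j] near_pos[OF n_p3 n_j] near_pos[OF n_j2 n_j] disjI1[OF refl]]
      ball_neg(1)[OF disjI1[OF refl] near_neg[OF n_b n_j]]]) simp_all
  have m1: "H0 \<inter> H1 \<subseteq> {j}"
    using i0_1 by blast
  have g1: "piece (H0 \<union> H1) 8 {#b, b, b, j2, p, p, p3, p3#}"
    by (rule piece_glue_point[OF p0 p1 m1]) (simp_all add: add_mset_commute)
  have i0_2: "H0 \<inter> H2 \<subseteq> {j2}" unfolding H0_def H2_def
    by (rule hull_meet_point'[where w = "Complex (-2) (-5)", OF
      ball_pos(3)[OF near_pos[OF n_p n_j2] near_pos[OF n_p3 n_j2] disjI1[OF refl] near_pos[OF n_j n_j2]]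
      ball_neg(1)[OF disjI1[OF refl] near_neg[OF n_b2 n_j2]]]) simp_all
  have i1_2: "H1 \<inter> H2 = {}" unfolding H1_def H2_def
    by (rule hull_disjoint'[where w = "Complex (-5) (-2)" and c = "(-7.6)", OF
      ball_gt(1)[OF near_inner_gt[OF n_j] near_inner_gt[OF n_b]]
      ball_lt(1)[OF near_inner_lt[OF n_j2] near_inner_lt[OF n_b2]]]) simp_all
  have m2: "(H0 \<union> H1) \<inter> H2 \<subseteq> {j2}"
    using i0_2 i1_2 by blast
  have g2: "piece (H0 \<union> H1 \<union> H2) 9 {#b, b, b, b2, b2, b2, p, p, p3, p3#}"
    by (rule piece_glue_point[OF g1 p2 m2]) (simp_all add: add_mset_commute)
  have i0_3: "H0 \<inter> H3 = {}" unfolding H0_def H3_def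
    by (rule hull_disjoint'[where w = "Complex 1 (-12)" and c = "(-0.5)", OF
      ball_gt(3)[OF near_inner_gt[OF n_p] near_inner_gt[OF n_p3] near_inner_gt[OF n_j2] near_inner_gt[OF n_j]]
      ball_lt(2)[OF near_inner_lt[OF n_b] near_inner_lt[OF n_w] near_inner_lt[OF n_q]]]) simp_all
  have i1_3: "H1 \<inter> H3 \<subseteq> {b}" unfolding H1_def H3_def
    by (rule hull_meet_point'[where w = "Complex 4 (-30)", OF
      ball_pos(1)[OF near_pos[OF n_j n_b] disjI1[OF refl]]
      ball_neg(2)[OF disjI1[OF refl] near_neg[OF n_w n_b] near_neg[OF n_q n_b]]]) simp_all
  have i2_3: "H2 \<inter> H3 = {}" unfolding H2_def H3_def
    by (rule hull_disjoint'[where w = "Complex 5 2" and c = "7.6", OF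
      ball_gt(1)[OF near_inner_gt[OF n_j2] near_inner_gt[OF n_b2]]
      ball_lt(2)[OF near_inner_lt[OF n_b] near_inner_lt[OF n_w] near_inner_lt[OF n_q]]]) simp_all
  have m3: "(H0 \<union> H1 \<union> H2) \<inter> H3 \<subseteq> {b}"
    using i0_3 i1_3 i2_3 by blast
  have g3: "piece (H0 \<union> H1 \<union> H2 \<union> H3) 14 {#b, b2, b2, b2, p, p, p3, p3, q, q, w, w#}"
    by (rule piece_glue_point[OF g2 p3 m3]) (simp_all add: add_mset_commute)
  have i0_4: "H0 \<inter> H4 = {}" unfolding H0_def H4_def
    by (rule hull_disjoint'[where w = "Complex 0 (-5)" and c = "(-0.4)", OF
      ball_gt(3)[OF near_inner_gt[OF n_p] near_inner_gt[OF n_p3] near_inner_gt[OF n_j2] near_inner_gt[OF n_j]]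
      ball_lt(1)[OF near_inner_lt[OF n_b] near_inner_lt[OF n_b2]]]) simp_all
  have i1_4: "H1 \<inter> H4 \<subseteq> {b}" unfolding H1_def H4_def
    by (rule hull_meet_point'[where w = "Complex (-4) (-2)", OF
      ball_pos(1)[OF near_pos[OF n_j n_b] disjI1[OF refl]]
      ball_neg(1)[OF disjI1[OF refl] near_neg[OF n_b2 n_b]]]) simp_all
  have i2_4: "H2 \<inter> H4 \<subseteq> {b2}" unfolding H2_def H4_def
    by (rule hull_meet_point'[where w = "Complex 5 (-1)", OF
      ball_pos(1)[OF near_pos[OF n_j2 n_b2] disjI1[OF refl]]
      ball_neg(1)[OF near_neg[OF n_b n_b2] disjI1[OF refl]]]) simp_all
  have i3_4: "H3 \<inter> H4 \<subseteq> {b}" unfolding H3_def H4_def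
    by (rule hull_meet_point'[where w = "Complex (-5) (-1)", OF
      ball_pos(2)[OF disjI1[OF refl] near_pos[OF n_w n_b] near_pos[OF n_q n_b]]
      ball_neg(1)[OF disjI1[OF refl] near_neg[OF n_b2 n_b]]]) simp_all
  have m4: "(H0 \<union> H1 \<union> H2 \<union> H3) \<inter> H4 \<subseteq> {b, b2}"
    using i0_4 i1_4 i2_4 i3_4 by blast
  have neq4: "b \<noteq> b2" by (rule near_neq(1)[OF n_b n_b2]) simp
  have g4: "piece (H0 \<union> H1 \<union> H2 \<union> H3 \<union> H4) 14 {#b2, b2, p, p, p3, p3, q, q, w, w#}"
    by (rule piece_glue_two[OF g3 p4 m4 neq4]) (simp_all add: add_mset_commute)
  have i0_5: "H0 \<inter> H5 = {}" unfolding H0_def H5_def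
    by (rule hull_disjoint'[where w = "Complex 0 (-5)" and c = "(-2.3)", OF
      ball_gt(3)[OF near_inner_gt[OF n_p] near_inner_gt[OF n_p3] near_inner_gt[OF n_j2] near_inner_gt[OF n_j]]
      ball_lt(2)[OF near_inner_lt[OF n_b2] near_inner_lt[OF n_w] near_inner_lt[OF n_y]]]) simp_all
  have i1_5: "H1 \<inter> H5 = {}" unfolding H1_def H5_def
    by (rule hull_disjoint'[where w = "Complex (-2) (-4)" and c = "(-4.8)", OF
      ball_gt(1)[OF near_inner_gt[OF n_j] near_inner_gt[OF n_b]]
      ball_lt(2)[OF near_inner_lt[OF n_b2] near_inner_lt[OF n_w] near_inner_lt[OF n_y]]]) simp_all
  have i2_5: "H2 \<inter> H5 \<subseteq> {b2}" unfolding H2_def H5_def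
    by (rule hull_meet_point'[where w = "Complex 2 (-5)", OF
      ball_pos(1)[OF near_pos[OF n_j2 n_b2] disjI1[OF refl]]
      ball_neg(2)[OF disjI1[OF refl] near_neg[OF n_w n_b2] near_neg[OF n_y n_b2]]]) simp_all
  have i3_5: "H3 \<inter> H5 \<subseteq> {w}" unfolding H3_def H5_def
    by (rule hull_meet_point'[where w = "Complex (-3) (-4)", OF
      ball_pos(2)[OF near_pos[OF n_b n_w] disjI1[OF refl] near_pos[OF n_q n_w]]
      ball_neg(2)[OF near_neg[OF n_b2 n_w] disjI1[OF refl] near_neg[OF n_y n_w]]]) simp_all
  have i4_5: "H4 \<inter> H5 \<subseteq> {b2}" unfolding H4_def H5_def
    by (rule hull_meet_point'[where w = "Complex 0 (-5)", OF
      ball_pos(1)[OF near_pos[OF n_b n_b2] disjI1[OF refl]]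
      ball_neg(2)[OF disjI1[OF refl] near_neg[OF n_w n_b2] near_neg[OF n_y n_b2]]]) simp_all
  have m5: "(H0 \<union> H1 \<union> H2 \<union> H3 \<union> H4) \<inter> H5 \<subseteq> {b2, w}"
    using i0_5 i1_5 i2_5 i3_5 i4_5 by blast
  have neq5: "b2 \<noteq> w" by (rule near_neq(1)[OF n_b2 n_w]) simp
  have g5: "piece (H0 \<union> H1 \<union> H2 \<union> H3 \<union> H4 \<union> H5) 18 {#p, p, p3, p3, q, q, y, y#}"
    by (rule piece_glue_two[OF g4 p5 m5 neq5]) (simp_all add: add_mset_commute)
  have i0_6: "H0 \<inter> H6 \<subseteq> {p}" unfolding H0_def H6_def
    by (rule hull_meet_point'[where w = "Complex 5 0", OF
      ball_pos(3)[OF disjI1[OF refl] near_pos[OF n_p3 n_p] near_pos[OF n_j2 n_p] near_pos[OF n_j n_p]]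
      ball_neg(2)[OF disjI1[OF refl] near_neg[OF n_q n_p] near_neg[OF n_r n_p]]]) simp_all
  have i1_6: "H1 \<inter> H6 = {}" unfolding H1_def H6_def
    by (rule hull_disjoint'[where w = "Complex 4 2" and c = "(-1.9)", OF
      ball_gt(1)[OF near_inner_gt[OF n_j] near_inner_gt[OF n_b]]
      ball_lt(2)[OF near_inner_lt[OF n_p] near_inner_lt[OF n_q] near_inner_lt[OF n_r]]]) simp_all
  have i2_6: "H2 \<inter> H6 = {}" unfolding H2_def H6_def
    by (rule hull_disjoint'[where w = "Complex 5 2" and c = "2.9", OF
      ball_gt(1)[OF near_inner_gt[OF n_j2] near_inner_gt[OF n_b2]]
      ball_lt(2)[OF near_inner_lt[OF n_p] near_inner_lt[OF n_q] near_inner_lt[OF n_r]]]) simp_all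
  have i3_6: "H3 \<inter> H6 \<subseteq> {q}" unfolding H3_def H6_def
    by (rule hull_meet_point'[where w = "Complex 2 5", OF
      ball_pos(2)[OF near_pos[OF n_b n_q] near_pos[OF n_w n_q] disjI1[OF refl]]
      ball_neg(2)[OF near_neg[OF n_p n_q] disjI1[OF refl] near_neg[OF n_r n_q]]]) simp_all
  have i4_6: "H4 \<inter> H6 = {}" unfolding H4_def H6_def
    by (rule hull_disjoint'[where w = "Complex 4 2" and c = "0.3", OF
      ball_gt(1)[OF near_inner_gt[OF n_b] near_inner_gt[OF n_b2]]
      ball_lt(2)[OF near_inner_lt[OF n_p] near_inner_lt[OF n_q] near_inner_lt[OF n_r]]]) simp_all
  have i5_6: "H5 \<inter> H6 = {}" unfolding H5_def H6_def
    by (rule hull_disjoint'[where w = "Complex 2 4" and c = "2.4", OF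
      ball_gt(2)[OF near_inner_gt[OF n_b2] near_inner_gt[OF n_w] near_inner_gt[OF n_y]]
      ball_lt(2)[OF near_inner_lt[OF n_p] near_inner_lt[OF n_q] near_inner_lt[OF n_r]]]) simp_all
  have m6: "(H0 \<union> H1 \<union> H2 \<union> H3 \<union> H4 \<union> H5) \<inter> H6 \<subseteq> {p, q}"
    using i0_6 i1_6 i2_6 i3_6 i4_6 i5_6 by blast
  have neq6: "p \<noteq> q" by (rule near_neq(1)[OF n_p n_q]) simp
  have g6: "piece (H0 \<union> H1 \<union> H2 \<union> H3 \<union> H4 \<union> H5 \<union> H6) 19 {#p3, p3, r, r, y, y#}"
    by (rule piece_glue_two[OF g5 p6 m6 neq6]) (simp_all add: add_mset_commute)
  define N where "N = (\<i> * (y - p3))"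
  have n_N: "near N (-3.7922) (-1.0035) 0.000157"
    unfolding N_def by (rule near_mono[OF near_ii[OF near_diff[OF n_y n_p3]]]) simp_all
  define N' where "N' = (- N)"
  have n_N': "near N' 3.7922 1.0035 0.000157"
    unfolding N'_def by (rule near_mono[OF near_minus[OF n_N]]) simp_all
  \<comment> \<open>The window for \<open>\<tau>\<close> is narrow: above about 3.81 the vertex
    \<open>p3\<close> violates the slope condition, and below about 3.754 the bar no longer fits the
    circle of radius 4.005.\<close>
  have n_tD: "near ((complex_of_real 3.76) * (y - p3)) (-3.773141) 14.258672 0.000571"
    by (rule near_mult[OF near_real[of "3.76"] near_diff[OF n_y n_p3]]) simp_all
  define L where "L = (((complex_of_real 3.76) * (y - p3)) - N)"
  have n_L: "near L 0.01906 15.26217 0.00073"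
    unfolding L_def by (rule near_mono[OF near_diff[OF n_tD n_N]]) simp_all
  have N0: "N \<bullet> (y - p3) = 0" unfolding N_def by (rule inner_ii)
  have a0: "admissible p3 y r 3.76 N H0" unfolding H0_def
    by (rule admissible_hull'[OF disjI1[OF refl] N0 N'_def L_def
      ball_pos(3)[OF near_pos'[OF n_N n_p n_p3] disjI1[OF refl] near_pos'[OF n_N n_j2 n_p3] near_pos'[OF n_N n_j n_p3]]
      ball_pos(3)[OF near_pos'[OF n_N' n_p n_r] near_pos'[OF n_N' n_p3 n_r] near_pos'[OF n_N' n_j2 n_r] near_pos'[OF n_N' n_j n_r]]
      ball_pos(3)[OF near_pos'[OF n_L n_p n_r] near_pos'[OF n_L n_p3 n_r] near_pos'[OF n_L n_j2 n_r] near_pos'[OF n_L n_j n_r]]]) simp_all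
  have a1: "admissible p3 y r 3.76 N H1" unfolding H1_def
    by (rule admissible_hull'[OF disjI1[OF refl] N0 N'_def L_def
      ball_pos(1)[OF near_pos'[OF n_N n_j n_p3] near_pos'[OF n_N n_b n_p3]]
      ball_pos(1)[OF near_pos'[OF n_N' n_j n_r] near_pos'[OF n_N' n_b n_r]]
      ball_pos(1)[OF near_pos'[OF n_L n_j n_r] near_pos'[OF n_L n_b n_r]]]) simp_all
  have a2: "admissible p3 y r 3.76 N H2" unfolding H2_def
    by (rule admissible_hull'[OF disjI1[OF refl] N0 N'_def L_def
      ball_pos(1)[OF near_pos'[OF n_N n_j2 n_p3] near_pos'[OF n_N n_b2 n_p3]]
      ball_pos(1)[OF near_pos'[OF n_N' n_j2 n_r] near_pos'[OF n_N' n_b2 n_r]]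
      ball_pos(1)[OF near_pos'[OF n_L n_j2 n_r] near_pos'[OF n_L n_b2 n_r]]]) simp_all
  have a3: "admissible p3 y r 3.76 N H3" unfolding H3_def
    by (rule admissible_hull'[OF disjI1[OF refl] N0 N'_def L_def
      ball_pos(2)[OF near_pos'[OF n_N n_b n_p3] near_pos'[OF n_N n_w n_p3] near_pos'[OF n_N n_q n_p3]]
      ball_pos(2)[OF near_pos'[OF n_N' n_b n_r] near_pos'[OF n_N' n_w n_r] near_pos'[OF n_N' n_q n_r]]
      ball_pos(2)[OF near_pos'[OF n_L n_b n_r] near_pos'[OF n_L n_w n_r] near_pos'[OF n_L n_q n_r]]]) simp_all
  have a4: "admissible p3 y r 3.76 N H4" unfolding H4_def
    by (rule admissible_hull'[OF disjI1[OF refl] N0 N'_def L_def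
      ball_pos(1)[OF near_pos'[OF n_N n_b n_p3] near_pos'[OF n_N n_b2 n_p3]]
      ball_pos(1)[OF near_pos'[OF n_N' n_b n_r] near_pos'[OF n_N' n_b2 n_r]]
      ball_pos(1)[OF near_pos'[OF n_L n_b n_r] near_pos'[OF n_L n_b2 n_r]]]) simp_all
  have a5: "admissible p3 y r 3.76 N H5" unfolding H5_def
    by (rule admissible_hull'[OF disjI2[OF refl] N0 N'_def L_def
      ball_pos(2)[OF near_pos'[OF n_N n_b2 n_y] near_pos'[OF n_N n_w n_y] disjI1[OF refl]]
      ball_pos(2)[OF near_pos'[OF n_N' n_b2 n_r] near_pos'[OF n_N' n_w n_r] near_pos'[OF n_N' n_y n_r]]
      ball_pos(2)[OF near_pos'[OF n_L n_b2 n_r] near_pos'[OF n_L n_w n_r] near_pos'[OF n_L n_y n_r]]]) simp_all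
  have a6: "admissible p3 y r 3.76 N H6" unfolding H6_def
    by (rule admissible_hull'[OF disjI1[OF refl] N0 N'_def L_def
      ball_pos(2)[OF near_pos'[OF n_N n_p n_p3] near_pos'[OF n_N n_q n_p3] near_pos'[OF n_N n_r n_p3]]
      ball_pos(2)[OF near_pos'[OF n_N' n_p n_r] near_pos'[OF n_N' n_q n_r] disjI1[OF refl]]
      ball_pos(2)[OF near_pos'[OF n_L n_p n_r] near_pos'[OF n_L n_q n_r] disjI1[OF refl]]]) simp_all
  have ad: "admissible p3 y r 3.76 N (H0 \<union> H1 \<union> H2 \<union> H3 \<union> H4 \<union> H5 \<union> H6)"
    by (intro admissible_Un a0 a1 a2 a3 a4 a5 a6)
  have hb: "3.868 * cmod N \<le> N \<bullet> (r - p3)" "N \<bullet> (r - p3) \<le> 3.87 * cmod N"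
    using height_bounds[OF n_N n_r n_p3, where E = "0.0015" and m = "3.92293" and k = "3.92253" and l = "3.868" and u = "3.87"] by (simp_all add: power2_eq_square)
  have ab: "p3 \<noteq> y" by (rule near_neq(1)[OF n_p3 n_y]) simp
  have "piece (H0 \<union> H1 \<union> H2 \<union> H3 \<union> H4 \<union> H5 \<union> H6) 19 {#p3, p3, y, y, r, r#}" using g6 by (simp add: add_mset_commute)
  from body_of_admissible[OF this ab ad[unfolded N_def] hb[unfolded N_def norm_ii_diff]] show ?thesis .
qed

text \<open>The two strips as before, but with \<open>p\<close> and \<open>q\<close> joined by a copy of the body with 12 vertices, turned
  by the unit vector \<open>v\<close>; now the linkage is on its other branch.\<close>

lemma body22: "\<exists>h. body 22 h 3.35 \<and> 4.793 \<le> h \<and> h \<le> 4.795"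
proof -
  have n_zc: "near (cnj \<zeta> * cnj \<omega>) (-0.713525492) (-0.700629269) 0.000000003"
    by (rule near_mult[OF near_cnj[OF near_\<zeta>] near_cnj[OF near_\<omega>]]) simp_all
  \<comment> \<open>\<open>k\<close> is the vector from corner \<open>r\<close> to corner
    \<open>x\<close> of the 12-vertex body after conjugation. Its irrational length is the target
    for the linkage, so rational bounds for it are compared with the values at both ends of the
    interval.\<close>
  define k where "k = (2 * (cnj \<zeta> * cnj \<omega>) - \<omega>)"
  have n_k: "near k (-1.927050984) (-2.267283942) 0.0000000072"
    unfolding k_def by (rule near_mono[OF near_diff[OF near_scale2[OF n_zc] near_\<omega>]]) simp_all
  have k_less: "cmod k \<le> 2.97558433" by (rule near_norm_less[OF n_k]) (simp_all add: power2_eq_square)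
  have k_greater: "2.97558428 \<le> cmod k" by (rule near_norm_greater[OF n_k]) (simp_all add: power2_eq_square)
  have e0a: "near (arm1 0.302686) 0.302686 0.953090334 0.000000002" and e0b: "near (arm2 1 0.302686) 0.736272943 (-0.676684678) 0.00000001"
    using near_arms[of "0.302686" "0.302686" "0.302686" "0.953090333" "0.953090336" "0.117915429" "0.117915432" "1" "0.302686" "0.000000002" "0.953090334" "0.736272943" "0.00000001" "(-0.676684678)"] by (simp_all add: power2_eq_square)
  have q0: "near (arm2 1 0.302686 * (- cnj \<omega>)) 0.21788965 0.975973412 0.000000016"
    by (rule near_mult[OF e0b near_minus[OF near_cnj[OF near_\<omega>]]]) simp_all
  have l0: "cmod (arm1 0.302686 + arm2 1 0.302686 * (- cnj \<omega>) + \<omega>) \<le> 2.97558428"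
    by (rule near_norm_less[OF near_add[OF near_add[OF e0a q0] near_\<omega>]]) (simp_all add: power2_eq_square)
  have e1a: "near (arm1 0.30269) 0.30269 0.953089064 0.000000002" and e1b: "near (arm2 1 0.30269) 0.73626659 (-0.676691591) 0.000000011"
    using near_arms[of "0.30269" "0.30269" "0.30269" "0.953089062" "0.953089065" "0.117920154" "0.117920157" "1" "0.30269" "0.000000002" "0.953089064" "0.73626659" "0.000000011" "(-0.676691591)"] by (simp_all add: power2_eq_square)
  have q1: "near (arm2 1 0.30269 * (- cnj \<omega>)) 0.217898813 0.975971366 0.000000017"
    by (rule near_mult[OF e1b near_minus[OF near_cnj[OF near_\<omega>]]]) simp_all
  have l1: "2.97558433 \<le> cmod (arm1 0.30269 + arm2 1 0.30269 * (- cnj \<omega>) + \<omega>)"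
    by (rule near_norm_greater[OF near_add[OF near_add[OF e1a q1] near_\<omega>]]) (simp_all add: power2_eq_square)
  obtain t where t: "0.302686 \<le> t" "t \<le> 0.30269" "cmod (arm1 t + arm2 1 t * (- cnj \<omega>) + \<omega>) = cmod k"
    using linkage_exists[of "0.302686" "0.30269" "1" "(- cnj \<omega>)" "cmod k"] l0 l1 k_less k_greater by auto
  have eua: "near (arm1 t) 0.302688 0.9530897 0.000002" and eub: "near (arm2 1 t) 0.73626977 (-0.67668813) 0.00001377"
    using near_arms[OF t(1,2), of "0.95308905" "0.95309035" "0.11791542" "0.11792017" "1" "0.302688" "0.000002" "0.9530897" "0.73626977" "0.00001377" "(-0.67668813)"] by (simp_all add: power2_eq_square)
  have tt: "1 / 4 < t" "t < 1" using t(1,2) by simp_all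
  have sq: "cmod (arm1 t) = 1" "cmod (arm2 1 t) = 1" "cmod (arm1 t + arm2 1 t - 2) = 1"
    using norm_arms[OF tt, of "1"] by simp_all
  define e where "e = arm1 t"
  have n_e: "near e 0.302688 0.9530897 0.000002"
    unfolding e_def by (rule near_mono[OF eua]) simp_all
  define u where "u = arm2 1 t"
  have n_u: "near u 0.73626977 (-0.67668813) 0.00001377"
    unfolding u_def by (rule near_mono[OF eub]) simp_all
  note norms = sq[folded e_def u_def]
  define j where "j = (0::complex)"
  have n_j: "near j 0 0 0"
    unfolding j_def by (rule near_mono[OF near_numeral(3)]) simp_all
  define j2 where "j2 = (2::complex)"
  have n_j2: "near j2 2 0 0"
    unfolding j2_def by (rule near_mono[OF near_numeral(1)]) simp_all
  define p where "p = (- \<omega>)"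
  have n_p: "near p (-0.5) (-0.866025) 0.0000005"
    unfolding p_def by (rule near_mono[OF near_minus[OF near_\<omega>]]) simp_all
  define p3 where "p3 = ((3::complex) - \<omega>)"
  have n_p3: "near p3 2.5 (-0.866025) 0.0000005"
    unfolding p3_def by (rule near_mono[OF near_diff[OF near_numeral(1) near_\<omega>]]) simp_all
  define b where "b = e"
  have n_b: "near b 0.302688 0.95309 0.0000023"
    unfolding b_def by (rule near_mono[OF n_e]) simp_all
  define b2 where "b2 = (e + u)"
  have n_b2: "near b2 1.038958 0.276402 0.0000162"
    unfolding b2_def by (rule near_mono[OF near_add[OF n_e n_u]]) simp_all
  define uw where "uw = u * cnj \<omega>"
  have n_uw: "near uw (-0.2178942) (-0.9759724) 0.0000189"
    unfolding uw_def by (rule near_mult[OF n_u near_cnj[OF near_\<omega>]]) simp_all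
  define q where "q = (e - uw)"
  have n_q: "near q 0.520582 1.929062 0.0000211"
    unfolding q_def by (rule near_mono[OF near_diff[OF n_e n_uw]]) simp_all
  define f where "f = (q + 2 * u)"
  have n_f: "near f 1.993122 0.575686 0.0000491"
    unfolding f_def by (rule near_mono[OF near_add[OF n_q near_scale2[OF n_u]]]) simp_all
  have k0: "k \<noteq> 0" using k_greater by auto
  \<comment> \<open>Since \<open>cmod (q - p) = cmod k\<close>, this quotient has modulus 1 and is
    the rotation that fits the conjugated copy between \<open>p\<close> and
    \<open>q\<close>.\<close>
  define v where "v = (q - p) / k"
  have n_v: "near v (-0.93787) (-0.34699) 0.000041"
    unfolding v_def by (rule near_divide[OF near_diff[OF n_q n_p] n_k, where m = "1.927" and k = "0.000039"]) simp_all
  have qp: "cmod (q - p) = cmod k" using t(3) by (simp add: q_def p_def uw_def e_def u_def algebra_simps)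
  hence nv: "cmod v = 1" using k0 by (simp add: v_def norm_divide)
  have qv: "q = p + v * k" using k0 by (simp add: v_def)
  define vw where "vw = v * \<omega>"
  have n_vw: "near vw (-0.1684328) (-0.9857142) 0.0000561"
    unfolding vw_def by (rule near_mult[OF n_v near_\<omega>]) simp_all
  define z0 where "z0 = (p - vw)"
  have n_z0: "near z0 (-0.331567) 0.119689 0.0000568"
    unfolding z0_def by (rule near_mono[OF near_diff[OF n_p n_vw]]) simp_all
  define z1 where "z1 = (z0 + v)"
  have n_z1: "near z1 (-1.269437) (-0.227301) 0.0000978"
    unfolding z1_def by (rule near_mono[OF near_add[OF n_z0 n_v]]) simp_all
  define vz where "vz = v * cnj \<zeta>"
  have n_vz: "near vz (-0.5704391) 0.8213412 0.00005"
    unfolding vz_def by (rule near_mult[OF n_v near_cnj[OF near_\<zeta>]]) simp_all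
  define w where "w = (z0 + 2 * vz)"
  have n_w: "near w (-1.472445) 1.762371 0.0001572"
    unfolding w_def by (rule near_mono[OF near_add[OF n_z0 near_scale2[OF n_vz]]]) simp_all
  define vx where "vx = v * \<zeta>"
  have n_vx: "near vx 0.1015041 (-0.9948362) 0.00005"
    unfolding vx_def by (rule near_mult[OF n_v near_\<zeta>]) simp_all
  define vxw where "vxw = vx * \<omega>"
  have n_vxw: "near vxw 0.9123055 (-0.409513) 0.0000684"
    unfolding vxw_def by (rule near_mult[OF n_vx near_\<omega>]) simp_all
  define y where "y = (z1 - 2 * vxw)"
  have n_y: "near y (-3.094048) 0.591725 0.0002346"
    unfolding y_def by (rule near_mono[OF near_diff[OF n_z1 near_scale2[OF n_vxw]]]) simp_all
  have f7: "frame 1 (1 * \<omega>)" by (rule frame_\<omega>) (use nv in \<open>simp add: norm_mult norm_divide norm_\<zeta>\<close>)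
  have f5: "frame u (u * cnj \<omega>)" by (rule frame_\<omega>) (use norms in \<open>simp add: norm_mult norm_divide norm_\<zeta>\<close>)
  have fv: "frame v (v * \<omega>)" by (rule frame_\<omega>) (use nv in \<open>simp add: norm_mult norm_divide norm_\<zeta>\<close>)
  have fz: "frame vz (vz * cnj \<omega>)" by (rule frame_\<omega>) (use nv in \<open>simp add: vz_def norm_mult norm_\<zeta>\<close>)
  have fx: "frame (- vx) ((- vx) * \<omega>)" by (rule frame_\<omega>) (use nv in \<open>simp add: vx_def norm_mult norm_\<zeta>\<close>)
  have eqs: "p = z0 + v * \<omega>" "z1 = z0 + v" "w = z0 + 2 * vz" "q = z0 + 2 * (vz * cnj \<omega>)" "w = z1 - 2 * vx" "y = z1 - 2 * (vx * \<omega>)"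
    unfolding qv by (simp_all add: z0_def vw_def z1_def w_def y_def vxw_def vz_def vx_def k_def cnj_\<omega> cnj_\<zeta> algebra_simps)
  define H0 where "H0 = convex hull {p, p3, j2, j}"
  have p0: "piece H0 7 {#p, p, p3, p3, j, j2#}" unfolding H0_def
    by (rule piece_strip7[OF f7]) (simp_all add: j_def j2_def p_def p3_def b_def b2_def f_def uw_def cnj_\<omega> cnj_\<zeta> scaleR_conv_of_real algebra_simps)
  define H1 where "H1 = convex hull {j, b}"
  have p1: "piece H1 2 {#j, j, j, b, b, b#}" unfolding H1_def
    by (rule piece_edge) (simp add: norms j_def b_def norm_minus_commute)
  define H2 where "H2 = convex hull {j2, b2}"
  have p2: "piece H2 2 {#j2, j2, j2, b2, b2, b2#}" unfolding H2_def
    by (rule piece_edge) (simp add: norms j2_def b2_def norm_minus_commute)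
  define H3 where "H3 = convex hull {q, f, b2, b}"
  have p3: "piece H3 5 {#q, q, f, f, b, b2#}" unfolding H3_def
    by (rule piece_strip5[OF f5]) (simp_all add: q_def j_def j2_def p_def p3_def b_def b2_def f_def uw_def cnj_\<omega> cnj_\<zeta> scaleR_conv_of_real algebra_simps)
  define H4 where "H4 = convex hull {z0, z1, p}"
  have p4: "piece H4 3 {#z0, z0, z1, z1, p, p#}" unfolding H4_def
    by (rule piece_triangle[OF fv]) (rule eqs)+
  define H5 where "H5 = convex hull {z0, w, q}"
  have p5: "piece H5 6 {#z0, z0, w, w, q, q#}" unfolding H5_def
    by (rule piece_triangle2[OF fz]) (simp_all only: eqs(3,4) scaleR_conv_of_real of_real_numeral)
  define H6 where "H6 = convex hull {z1, w, y}"
  have p6: "piece H6 6 {#z1, z1, w, w, y, y#}" unfolding H6_def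
    by (rule piece_triangle2[OF fx]) (simp_all add: eqs(5,6) scaleR_conv_of_real)
  have i0_1: "H0 \<inter> H1 \<subseteq> {j}" unfolding H0_def H1_def
    by (rule hull_meet_point'[where w = "Complex 2 (-5)", OF
      ball_pos(3)[OF near_pos[OF n_p n_j] near_pos[OF n_p3 n_j] near_pos[OF n_j2 n_j] disjI1[OF refl]]
      ball_neg(1)[OF disjI1[OF refl] near_neg[OF n_b n_j]]]) simp_all
  have m1: "H0 \<inter> H1 \<subseteq> {j}"
    using i0_1 by blast
  have g1: "piece (H0 \<union> H1) 8 {#b, b, b, j2, p, p, p3, p3#}"
    by (rule piece_glue_point[OF p0 p1 m1]) (simp_all add: add_mset_commute)
  have i0_2: "H0 \<inter> H2 \<subseteq> {j2}" unfolding H0_def H2_def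
    by (rule hull_meet_point'[where w = "Complex (-1) (-5)", OF
      ball_pos(3)[OF near_pos[OF n_p n_j2] near_pos[OF n_p3 n_j2] disjI1[OF refl] near_pos[OF n_j n_j2]]
      ball_neg(1)[OF disjI1[OF refl] near_neg[OF n_b2 n_j2]]]) simp_all
  have i1_2: "H1 \<inter> H2 = {}" unfolding H1_def H2_def
    by (rule hull_disjoint'[where w = "Complex (-5) 2" and c = "(-2.3)", OF
      ball_gt(1)[OF near_inner_gt[OF n_j] near_inner_gt[OF n_b]]
      ball_lt(1)[OF near_inner_lt[OF n_j2] near_inner_lt[OF n_b2]]]) simp_all
  have m2: "(H0 \<union> H1) \<inter> H2 \<subseteq> {j2}"
    using i0_2 i1_2 by blast
  have g2: "piece (H0 \<union> H1 \<union> H2) 9 {#b, b, b, b2, b2, b2, p, p, p3, p3#}"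
    by (rule piece_glue_point[OF g1 p2 m2]) (simp_all add: add_mset_commute)
  have i0_3: "H0 \<inter> H3 = {}" unfolding H0_def H3_def
    by (rule hull_disjoint'[where w = "Complex 0 (-5)" and c = "(-0.7)", OF
      ball_gt(3)[OF near_inner_gt[OF n_p] near_inner_gt[OF n_p3] near_inner_gt[OF n_j2] near_inner_gt[OF n_j]]
      ball_lt(3)[OF near_inner_lt[OF n_q] near_inner_lt[OF n_f] near_inner_lt[OF n_b2] near_inner_lt[OF n_b]]]) simp_all
  have i1_3: "H1 \<inter> H3 \<subseteq> {b}" unfolding H1_def H3_def
    by (rule hull_meet_point'[where w = "Complex (-5) (-2)", OF
      ball_pos(1)[OF near_pos[OF n_j n_b] disjI1[OF refl]]
      ball_neg(3)[OF near_neg[OF n_q n_b] near_neg[OF n_f n_b] near_neg[OF n_b2 n_b] disjI1[OF refl]]]) simp_all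
  have i2_3: "H2 \<inter> H3 \<subseteq> {b2}" unfolding H2_def H3_def
    by (rule hull_meet_point'[where w = "Complex 0 (-5)", OF
      ball_pos(1)[OF near_pos[OF n_j2 n_b2] disjI1[OF refl]]
      ball_neg(3)[OF near_neg[OF n_q n_b2] near_neg[OF n_f n_b2] disjI1[OF refl] near_neg[OF n_b n_b2]]]) simp_all
  have m3: "(H0 \<union> H1 \<union> H2) \<inter> H3 \<subseteq> {b, b2}"
    using i0_3 i1_3 i2_3 by blast
  have neq3: "b \<noteq> b2" by (rule near_neq(1)[OF n_b n_b2]) simp
  have g3: "piece (H0 \<union> H1 \<union> H2 \<union> H3) 12 {#f, f, p, p, p3, p3, q, q#}"
    by (rule piece_glue_two[OF g2 p3 m3 neq3]) (simp_all add: add_mset_commute)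
  have i0_4: "H0 \<inter> H4 \<subseteq> {p}" unfolding H0_def H4_def
    by (rule hull_meet_point'[where w = "Complex 5 (-2)", OF
      ball_pos(3)[OF disjI1[OF refl] near_pos[OF n_p3 n_p] near_pos[OF n_j2 n_p] near_pos[OF n_j n_p]]
      ball_neg(2)[OF near_neg[OF n_z0 n_p] near_neg[OF n_z1 n_p] disjI1[OF refl]]]) simp_all
  have i1_4: "H1 \<inter> H4 = {}" unfolding H1_def H4_def
    by (rule hull_disjoint'[where w = "Complex 5 0" and c = "(-0.8)", OF
      ball_gt(1)[OF near_inner_gt[OF n_j] near_inner_gt[OF n_b]]
      ball_lt(2)[OF near_inner_lt[OF n_z0] near_inner_lt[OF n_z1] near_inner_lt[OF n_p]]]) simp_all
  have i2_4: "H2 \<inter> H4 = {}" unfolding H2_def H4_def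
    by (rule hull_disjoint'[where w = "Complex 5 1" and c = "2", OF
      ball_gt(1)[OF near_inner_gt[OF n_j2] near_inner_gt[OF n_b2]]
      ball_lt(2)[OF near_inner_lt[OF n_z0] near_inner_lt[OF n_z1] near_inner_lt[OF n_p]]]) simp_all
  have i3_4: "H3 \<inter> H4 = {}" unfolding H3_def H4_def
    by (rule hull_disjoint'[where w = "Complex 4 4" and c = "2.1", OF
      ball_gt(3)[OF near_inner_gt[OF n_q] near_inner_gt[OF n_f] near_inner_gt[OF n_b2] near_inner_gt[OF n_b]]
      ball_lt(2)[OF near_inner_lt[OF n_z0] near_inner_lt[OF n_z1] near_inner_lt[OF n_p]]]) simp_all
  have m4: "(H0 \<union> H1 \<union> H2 \<union> H3) \<inter> H4 \<subseteq> {p}"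
    using i0_4 i1_4 i2_4 i3_4 by blast
  have g4: "piece (H0 \<union> H1 \<union> H2 \<union> H3 \<union> H4) 14 {#f, f, p3, p3, q, q, z0, z0, z1, z1#}"
    by (rule piece_glue_point[OF g3 p4 m4]) (simp_all add: add_mset_commute)
  have i0_5: "H0 \<inter> H5 = {}" unfolding H0_def H5_def
    by (rule hull_disjoint'[where w = "Complex 4 (-3)" and c = "(-0.8)", OF
      ball_gt(3)[OF near_inner_gt[OF n_p] near_inner_gt[OF n_p3] near_inner_gt[OF n_j2] near_inner_gt[OF n_j]]
      ball_lt(2)[OF near_inner_lt[OF n_z0] near_inner_lt[OF n_w] near_inner_lt[OF n_q]]]) simp_all
  have i1_5: "H1 \<inter> H5 = {}" unfolding H1_def H5_def
    by (rule hull_disjoint'[where w = "Complex 4 (-2)" and c = "(-1.1)", OF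
      ball_gt(1)[OF near_inner_gt[OF n_j] near_inner_gt[OF n_b]]
      ball_lt(2)[OF near_inner_lt[OF n_z0] near_inner_lt[OF n_w] near_inner_lt[OF n_q]]]) simp_all
  have i2_5: "H2 \<inter> H5 = {}" unfolding H2_def H5_def
    by (rule hull_disjoint'[where w = "Complex 4 (-2)" and c = "1", OF
      ball_gt(1)[OF near_inner_gt[OF n_j2] near_inner_gt[OF n_b2]]
      ball_lt(2)[OF near_inner_lt[OF n_z0] near_inner_lt[OF n_w] near_inner_lt[OF n_q]]]) simp_all
  have i3_5: "H3 \<inter> H5 \<subseteq> {q}" unfolding H3_def H5_def
    by (rule hull_meet_point'[where w = "Complex 5 (-2)", OF
      ball_pos(3)[OF disjI1[OF refl] near_pos[OF n_f n_q] near_pos[OF n_b2 n_q] near_pos[OF n_b n_q]]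
      ball_neg(2)[OF near_neg[OF n_z0 n_q] near_neg[OF n_w n_q] disjI1[OF refl]]]) simp_all
  have i4_5: "H4 \<inter> H5 \<subseteq> {z0}" unfolding H4_def H5_def
    by (rule hull_meet_point'[where w = "Complex (-2) (-4)", OF
      ball_pos(2)[OF disjI1[OF refl] near_pos[OF n_z1 n_z0] near_pos[OF n_p n_z0]]
      ball_neg(2)[OF disjI1[OF refl] near_neg[OF n_w n_z0] near_neg[OF n_q n_z0]]]) simp_all
  have m5: "(H0 \<union> H1 \<union> H2 \<union> H3 \<union> H4) \<inter> H5 \<subseteq> {z0, q}"
    using i0_5 i1_5 i2_5 i3_5 i4_5 by blast
  have neq5: "z0 \<noteq> q" by (rule near_neq(1)[OF n_z0 n_q]) simp
  have g5: "piece (H0 \<union> H1 \<union> H2 \<union> H3 \<union> H4 \<union> H5) 18 {#f, f, p3, p3, w, w, z1, z1#}"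
    by (rule piece_glue_two[OF g4 p5 m5 neq5]) (simp_all add: add_mset_commute)
  have i0_6: "H0 \<inter> H6 = {}" unfolding H0_def H6_def
    by (rule hull_disjoint'[where w = "Complex 4 (-2)" and c = "(-2.4)", OF
      ball_gt(3)[OF near_inner_gt[OF n_p] near_inner_gt[OF n_p3] near_inner_gt[OF n_j2] near_inner_gt[OF n_j]]
      ball_lt(2)[OF near_inner_lt[OF n_z1] near_inner_lt[OF n_w] near_inner_lt[OF n_y]]]) simp_all
  have i1_6: "H1 \<inter> H6 = {}" unfolding H1_def H6_def
    by (rule hull_disjoint'[where w = "Complex 5 0" and c = "(-3.2)", OF
      ball_gt(1)[OF near_inner_gt[OF n_j] near_inner_gt[OF n_b]]
      ball_lt(2)[OF near_inner_lt[OF n_z1] near_inner_lt[OF n_w] near_inner_lt[OF n_y]]]) simp_all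
  have i2_6: "H2 \<inter> H6 = {}" unfolding H2_def H6_def
    by (rule hull_disjoint'[where w = "Complex 5 0" and c = "(-0.6)", OF
      ball_gt(1)[OF near_inner_gt[OF n_j2] near_inner_gt[OF n_b2]]
      ball_lt(2)[OF near_inner_lt[OF n_z1] near_inner_lt[OF n_w] near_inner_lt[OF n_y]]]) simp_all
  have i3_6: "H3 \<inter> H6 = {}" unfolding H3_def H6_def
    by (rule hull_disjoint'[where w = "Complex 5 1" and c = "(-1.6)", OF
      ball_gt(3)[OF near_inner_gt[OF n_q] near_inner_gt[OF n_f] near_inner_gt[OF n_b2] near_inner_gt[OF n_b]]
      ball_lt(2)[OF near_inner_lt[OF n_z1] near_inner_lt[OF n_w] near_inner_lt[OF n_y]]]) simp_all
  have i4_6: "H4 \<inter> H6 \<subseteq> {z1}" unfolding H4_def H6_def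
    by (rule hull_meet_point'[where w = "Complex 5 (-2)", OF
      ball_pos(2)[OF near_pos[OF n_z0 n_z1] disjI1[OF refl] near_pos[OF n_p n_z1]]
      ball_neg(2)[OF disjI1[OF refl] near_neg[OF n_w n_z1] near_neg[OF n_y n_z1]]]) simp_all
  have i5_6: "H5 \<inter> H6 \<subseteq> {w}" unfolding H5_def H6_def
    by (rule hull_meet_point'[where w = "Complex 5 2", OF
      ball_pos(2)[OF near_pos[OF n_z0 n_w] disjI1[OF refl] near_pos[OF n_q n_w]]
      ball_neg(2)[OF near_neg[OF n_z1 n_w] disjI1[OF refl] near_neg[OF n_y n_w]]]) simp_all
  have m6: "(H0 \<union> H1 \<union> H2 \<union> H3 \<union> H4 \<union> H5) \<inter> H6 \<subseteq> {z1, w}"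
    using i0_6 i1_6 i2_6 i3_6 i4_6 i5_6 by blast
  have neq6: "z1 \<noteq> w" by (rule near_neq(1)[OF n_z1 n_w]) simp
  have g6: "piece (H0 \<union> H1 \<union> H2 \<union> H3 \<union> H4 \<union> H5 \<union> H6) 22 {#f, f, p3, p3, y, y#}"
    by (rule piece_glue_two[OF g5 p6 m6 neq6]) (simp_all add: add_mset_commute)
  define N where "N = (- (\<i> * (p3 - f)))"
  have n_N: "near N (-1.44171) (-0.50688) 0.000052"
    unfolding N_def by (rule near_mono[OF near_minus[OF near_ii[OF near_diff[OF n_p3 n_f]]]]) simp_all
  define N' where "N' = (- N)"
  have n_N': "near N' 1.44171 0.50688 0.000052"
    unfolding N'_def by (rule near_mono[OF near_minus[OF n_N]]) simp_all
  \<comment> \<open>Again a narrow window: above about 3.385 the vertex \<open>w\<close> violates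
    the slope condition, and below about 3.343 the bar does not fit the circle of radius
    5.005.\<close>
  have n_tD: "near ((complex_of_real 3.35) * (p3 - f)) 1.698041 (-4.829732) 0.000167"
    by (rule near_mult[OF near_real[of "3.35"] near_diff[OF n_p3 n_f]]) simp_all
  define L where "L = (((complex_of_real 3.35) * (p3 - f)) - N)"
  have n_L: "near L 3.13975 (-4.32285) 0.000221"
    unfolding L_def by (rule near_mono[OF near_diff[OF n_tD n_N]]) simp_all
  have N0: "N \<bullet> (p3 - f) = 0" unfolding N_def by (rule inner_ii)
  have a0: "admissible f p3 y 3.35 N H0" unfolding H0_def
    by (rule admissible_hull'[OF disjI2[OF refl] N0 N'_def L_def
      ball_pos(3)[OF near_pos'[OF n_N n_p n_p3] disjI1[OF refl] near_pos'[OF n_N n_j2 n_p3] near_pos'[OF n_N n_j n_p3]]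
      ball_pos(3)[OF near_pos'[OF n_N' n_p n_y] near_pos'[OF n_N' n_p3 n_y] near_pos'[OF n_N' n_j2 n_y] near_pos'[OF n_N' n_j n_y]]
      ball_pos(3)[OF near_pos'[OF n_L n_p n_y] near_pos'[OF n_L n_p3 n_y] near_pos'[OF n_L n_j2 n_y] near_pos'[OF n_L n_j n_y]]]) simp_all
  have a1: "admissible f p3 y 3.35 N H1" unfolding H1_def
    by (rule admissible_hull'[OF disjI1[OF refl] N0 N'_def L_def
      ball_pos(1)[OF near_pos'[OF n_N n_j n_f] near_pos'[OF n_N n_b n_f]]
      ball_pos(1)[OF near_pos'[OF n_N' n_j n_y] near_pos'[OF n_N' n_b n_y]]
      ball_pos(1)[OF near_pos'[OF n_L n_j n_y] near_pos'[OF n_L n_b n_y]]]) simp_all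
  have a2: "admissible f p3 y 3.35 N H2" unfolding H2_def
    by (rule admissible_hull'[OF disjI1[OF refl] N0 N'_def L_def
      ball_pos(1)[OF near_pos'[OF n_N n_j2 n_f] near_pos'[OF n_N n_b2 n_f]]
      ball_pos(1)[OF near_pos'[OF n_N' n_j2 n_y] near_pos'[OF n_N' n_b2 n_y]]
      ball_pos(1)[OF near_pos'[OF n_L n_j2 n_y] near_pos'[OF n_L n_b2 n_y]]]) simp_all
  have a3: "admissible f p3 y 3.35 N H3" unfolding H3_def
    by (rule admissible_hull'[OF disjI1[OF refl] N0 N'_def L_def
      ball_pos(3)[OF near_pos'[OF n_N n_q n_f] disjI1[OF refl] near_pos'[OF n_N n_b2 n_f] near_pos'[OF n_N n_b n_f]]
      ball_pos(3)[OF near_pos'[OF n_N' n_q n_y] near_pos'[OF n_N' n_f n_y] near_pos'[OF n_N' n_b2 n_y] near_pos'[OF n_N' n_b n_y]]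
      ball_pos(3)[OF near_pos'[OF n_L n_q n_y] near_pos'[OF n_L n_f n_y] near_pos'[OF n_L n_b2 n_y] near_pos'[OF n_L n_b n_y]]]) simp_all
  have a4: "admissible f p3 y 3.35 N H4" unfolding H4_def
    by (rule admissible_hull'[OF disjI1[OF refl] N0 N'_def L_def
      ball_pos(2)[OF near_pos'[OF n_N n_z0 n_f] near_pos'[OF n_N n_z1 n_f] near_pos'[OF n_N n_p n_f]]
      ball_pos(2)[OF near_pos'[OF n_N' n_z0 n_y] near_pos'[OF n_N' n_z1 n_y] near_pos'[OF n_N' n_p n_y]]
      ball_pos(2)[OF near_pos'[OF n_L n_z0 n_y] near_pos'[OF n_L n_z1 n_y] near_pos'[OF n_L n_p n_y]]]) simp_all
  have a5: "admissible f p3 y 3.35 N H5" unfolding H5_def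
    by (rule admissible_hull'[OF disjI1[OF refl] N0 N'_def L_def
      ball_pos(2)[OF near_pos'[OF n_N n_z0 n_f] near_pos'[OF n_N n_w n_f] near_pos'[OF n_N n_q n_f]]
      ball_pos(2)[OF near_pos'[OF n_N' n_z0 n_y] near_pos'[OF n_N' n_w n_y] near_pos'[OF n_N' n_q n_y]]
      ball_pos(2)[OF near_pos'[OF n_L n_z0 n_y] near_pos'[OF n_L n_w n_y] near_pos'[OF n_L n_q n_y]]]) simp_all
  have a6: "admissible f p3 y 3.35 N H6" unfolding H6_def
    by (rule admissible_hull'[OF disjI1[OF refl] N0 N'_def L_def
      ball_pos(2)[OF near_pos'[OF n_N n_z1 n_f] near_pos'[OF n_N n_w n_f] near_pos'[OF n_N n_y n_f]]
      ball_pos(2)[OF near_pos'[OF n_N' n_z1 n_y] near_pos'[OF n_N' n_w n_y] disjI1[OF refl]]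
      ball_pos(2)[OF near_pos'[OF n_L n_z1 n_y] near_pos'[OF n_L n_w n_y] disjI1[OF refl]]]) simp_all
  have ad: "admissible f p3 y 3.35 N (H0 \<union> H1 \<union> H2 \<union> H3 \<union> H4 \<union> H5 \<union> H6)"
    by (intro admissible_Un a0 a1 a2 a3 a4 a5 a6)
  have hb: "4.793 * cmod N \<le> N \<bullet> (y - f)" "N \<bullet> (y - f) \<le> 4.795 * cmod N"
    using height_bounds[OF n_N n_y n_f, where E = "0.0009" and m = "1.52829" and k = "1.52815" and l = "4.793" and u = "4.795"] by (simp_all add: power2_eq_square)
  have ab: "f \<noteq> p3" by (rule near_neq(1)[OF n_f n_p3]) simp
  have "piece (H0 \<union> H1 \<union> H2 \<union> H3 \<union> H4 \<union> H5 \<union> H6) 22 {#f, f, p3, p3, y, y#}" using g6 by (simp add: add_mset_commute)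
  from body_of_admissible'[OF this ab ad[unfolded N_def] hb[unfolded N_def norm_ii_diff]] show ?thesis .
qed

section \<open>Closed polygons\<close>

text \<open>The slope condition asks for \<open>R0\<close> to be at least
  \<open>u * sqrt (1 + 1 / \<tau>^2)\<close>, about 4.0045 for both the 16- and the 19-vertex body;
  this explains 4.005. The angles are the values \<open>arcsin (l / R0)\<close> rounded
  down.\<close>

lemma links_small:
  shows "link 4.005 21 0.822" and "link 4.005 29 1.4" and "link 4.005 35 1.308"
proof -
  show "link 4.005 21 0.822"
    using body12 link_of_body[of 12 _ "2" "2.936" "2.937" "4.005" "0.822"] by (auto simp: power2_eq_square power_numeral_reduce)
  show "link 4.005 29 1.4"
    using body16 link_of_body[of 16 _ "6" "3.947" "3.95" "4.005" "1.4"] by (auto simp: power2_eq_square power_numeral_reduce)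
  show "link 4.005 35 1.308"
    using body19 link_of_body[of 19 _ "3.76" "3.868" "3.87" "4.005" "1.308"] by (auto simp: power2_eq_square power_numeral_reduce)
qed

text \<open>The 21- and 22-vertex bodies have heights above 4.005 and need a larger circle; the
  slope condition of the latter requires a radius of about 5.0041.\<close>

lemma links_large:
  shows "link 5.005 21 0.626" and "link 5.005 29 0.908" and "link 5.005 35 0.883" and "link 5.005 39 1.356" and "link 5.005 41 1.278"
proof -
  show "link 5.005 21 0.626"
    using body12 link_of_body[of 12 _ "2" "2.936" "2.937" "5.005" "0.626"] by (auto simp: power2_eq_square power_numeral_reduce)
  show "link 5.005 29 0.908"
    using body16 link_of_body[of 16 _ "6" "3.947" "3.95" "5.005" "0.908"] by (auto simp: power2_eq_square power_numeral_reduce)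
  show "link 5.005 35 0.883"
    using body19 link_of_body[of 19 _ "3.76" "3.868" "3.87" "5.005" "0.883"] by (auto simp: power2_eq_square power_numeral_reduce)
  show "link 5.005 39 1.356"
    using body21 link_of_body[of 21 _ "5" "4.891" "4.896" "5.005" "1.356"] by (auto simp: power2_eq_square power_numeral_reduce)
  show "link 5.005 41 1.278"
    using body22 link_of_body[of 22 _ "3.35" "4.793" "4.795" "5.005" "1.278"] by (auto simp: power2_eq_square power_numeral_reduce)
qed

text \<open>Further 12-vertex bars only raise the angle sum, and the circumradius grows accordingly;
  each adds 21 vertices.\<close>

lemma ring_small:
  fixes L :: "(nat \<times> real) list"
  assumes "set L \<subseteq> {(21, 0.822), (29, 1.4), (35, 1.308)}" "3.1416 \<le> sum_list (map snd L)"
  shows "\<exists>S :: complex set. piece S (sum_list (map fst L) + 21 * k) {#}"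
proof -
  have "\<exists>S :: complex set. piece S (sum_list (map fst (L @ replicate k (21, 0.822 :: real)))) {#}"
  proof (rule ring_of_links[of "4.005"])
    show "link 4.005 c \<theta>" if "(c, \<theta>) \<in> set (L @ replicate k (21, 0.822 :: real))" for c \<theta>
    proof -
      have "(c, \<theta>) \<in> {(21, 0.822), (29, 1.4), (35, 1.308)}" using that assms(1) by auto
      thus ?thesis by (elim insertE emptyE Pair_inject) (simp_all only: links_small)
    qed
    show "3.1416 \<le> sum_list (map snd (L @ replicate k (21, 0.822 :: real)))"
      using assms(2) by (simp add: sum_list_replicate)
  qed simp
  thus ?thesis by (simp add: sum_list_replicate mult.commute)
qed

lemma ring_large:
  fixes L :: "(nat \<times> real) list"
  assumes "set L \<subseteq> {(21, 0.626), (29, 0.908), (35, 0.883), (39, 1.356), (41, 1.278)}" "3.1416 \<le> sum_list (map snd L)"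
  shows "\<exists>S :: complex set. piece S (sum_list (map fst L) + 21 * k) {#}"
proof -
  have "\<exists>S :: complex set. piece S (sum_list (map fst (L @ replicate k (21, 0.626 :: real)))) {#}"
  proof (rule ring_of_links[of "5.005"])
    show "link 5.005 c \<theta>" if "(c, \<theta>) \<in> set (L @ replicate k (21, 0.626 :: real))" for c \<theta>
    proof -
      have "(c, \<theta>) \<in> {(21, 0.626), (29, 0.908), (35, 0.883), (39, 1.356), (41, 1.278)}" using that assms(1) by auto
      thus ?thesis by (elim insertE emptyE Pair_inject) (simp_all only: links_large)
    qed
    show "3.1416 \<le> sum_list (map snd (L @ replicate k (21, 0.626 :: real)))"
      using assms(2) by (simp add: sum_list_replicate)
  qed simp
  thus ?thesis by (simp add: sum_list_replicate mult.commute)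
qed

text \<open>Both circles are needed: 100 as 21 + 21 + 29 + 29 has angle sum only 3.068 on the large
  one, while 97 as 29 + 29 + 39 uses a bar too long for the small one. The tightest case is 104,
  with sum 3.156. The value 96 is out of reach of these five bars: their number would be even, two
  give at most 82, six at least 126, and four would need an excess of 12 over 84 made up of the
  excesses 8, 14, 18, 20.\<close>

lemma closed_piece_exists:
  assumes "97 \<le> n"
  shows "\<exists>S :: complex set. piece S n {#}"
proof -
  define k where "k = (n - 97) div 21"
  define r where "r = (n - 97) mod 21"
  have n: "n = (97 + r) + 21 * k" using assms unfolding k_def r_def by simp

  have n97: "\<exists>S :: complex set. piece S (97 + 21 * k) {#}"
    using ring_large[of "[(29, 0.908), (29, 0.908), (39, 1.356)]" k] by simp
  have n98: "\<exists>S :: complex set. piece S (98 + 21 * k) {#}"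
    using ring_small[of "[(21, 0.822), (21, 0.822), (21, 0.822), (35, 1.308)]" k] by simp
  have n99: "\<exists>S :: complex set. piece S (99 + 21 * k) {#}"
    using ring_small[of "[(29, 1.4), (35, 1.308), (35, 1.308)]" k] by simp
  have n100: "\<exists>S :: complex set. piece S (100 + 21 * k) {#}"
    using ring_small[of "[(21, 0.822), (21, 0.822), (29, 1.4), (29, 1.4)]" k] by simp
  have n101: "\<exists>S :: complex set. piece S (101 + 21 * k) {#}"
    using ring_large[of "[(21, 0.626), (39, 1.356), (41, 1.278)]" k] by simp
  have n102: "\<exists>S :: complex set. piece S (102 + 21 * k) {#}"
    using ring_large[of "[(21, 0.626), (21, 0.626), (21, 0.626), (39, 1.356)]" k] by simp
  have n103: "\<exists>S :: complex set. piece S (103 + 21 * k) {#}"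
    using ring_large[of "[(21, 0.626), (41, 1.278), (41, 1.278)]" k] by simp
  have n104: "\<exists>S :: complex set. piece S (104 + 21 * k) {#}"
    using ring_large[of "[(21, 0.626), (21, 0.626), (21, 0.626), (41, 1.278)]" k] by simp
  have n105: "\<exists>S :: complex set. piece S (105 + 21 * k) {#}"
    using ring_small[of "[(35, 1.308), (35, 1.308), (35, 1.308)]" k] by simp
  have n106: "\<exists>S :: complex set. piece S (106 + 21 * k) {#}"
    using ring_small[of "[(21, 0.822), (21, 0.822), (29, 1.4), (35, 1.308)]" k] by simp
  have n107: "\<exists>S :: complex set. piece S (107 + 21 * k) {#}"
    using ring_large[of "[(29, 0.908), (39, 1.356), (39, 1.356)]" k] by simp
  have n108: "\<exists>S :: complex set. piece S (108 + 21 * k) {#}"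
    using ring_small[of "[(21, 0.822), (29, 1.4), (29, 1.4), (29, 1.4)]" k] by simp
  have n109: "\<exists>S :: complex set. piece S (109 + 21 * k) {#}"
    using ring_large[of "[(29, 0.908), (39, 1.356), (41, 1.278)]" k] by simp
  have n110: "\<exists>S :: complex set. piece S (110 + 21 * k) {#}"
    using ring_large[of "[(21, 0.626), (21, 0.626), (29, 0.908), (39, 1.356)]" k] by simp
  have n111: "\<exists>S :: complex set. piece S (111 + 21 * k) {#}"
    using ring_large[of "[(29, 0.908), (41, 1.278), (41, 1.278)]" k] by simp
  have n112: "\<exists>S :: complex set. piece S (112 + 21 * k) {#}"
    using ring_small[of "[(21, 0.822), (21, 0.822), (35, 1.308), (35, 1.308)]" k] by simp
  have n113: "\<exists>S :: complex set. piece S (113 + 21 * k) {#}"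
    using ring_large[of "[(35, 0.883), (39, 1.356), (39, 1.356)]" k] by simp
  have n114: "\<exists>S :: complex set. piece S (114 + 21 * k) {#}"
    using ring_small[of "[(21, 0.822), (29, 1.4), (29, 1.4), (35, 1.308)]" k] by simp
  have n115: "\<exists>S :: complex set. piece S (115 + 21 * k) {#}"
    using ring_large[of "[(35, 0.883), (39, 1.356), (41, 1.278)]" k] by simp
  have n116: "\<exists>S :: complex set. piece S (116 + 21 * k) {#}"
    using ring_small[of "[(29, 1.4), (29, 1.4), (29, 1.4), (29, 1.4)]" k] by simp
  have n117: "\<exists>S :: complex set. piece S (117 + 21 * k) {#}"
    using ring_large[of "[(35, 0.883), (41, 1.278), (41, 1.278)]" k] by simp
  have "r < 21" unfolding r_def by simp
  hence "r \<in> {0, 1, 2, 3, 4, 5, 6, 7, 8, 9, 10, 11, 12, 13, 14, 15, 16, 17, 18, 19, 20}" unfolding insert_iff empty_iff by presburger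
  thus ?thesis unfolding n
    using n97 n98 n99 n100 n101 n102 n103 n104 n105 n106 n107 n108 n109 n110 n111 n112 n113 n114 n115 n116 n117
    by auto
qed

lemma four_regular_of_piece:
  fixes S :: "(real ^ 2) set"
  assumes "piece S n {#}"
  shows "\<exists>V E. four_regular_matchstick_graph V E \<and> card V = n"
proof -
  obtain V :: "(real ^ 2) set" and E where G: "unit_graph V E" "card V = n" "\<forall>v\<in>V. 0 < deg E v \<and> deg E v + count {#} v = 4"
    using assms unfolding piece_def by blast
  have "matchstick_graph V E"
    unfolding matchstick_graph_def
  proof (intro conjI ballI allI impI)
    show "finite V" by (rule unit_graphD(1)[OF G(1)])
    show "\<exists>u v. e = {u, v} \<and> u \<in> V \<and> v \<in> V \<and> u \<noteq> v \<and> dist u v = 1" if e: "e \<in> E" for e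
      using unit_graphD(2)[OF G(1) e] by fastforce
    show "closed_segment u v \<inter> closed_segment x y \<subseteq> e \<inter> f"
      if "e \<in> E" "f \<in> E" "e \<noteq> f" "e = {u, v}" "f = {x, y}" for e f u v x y
      using unit_graphD(3)[OF G(1) that(1-3)] unfolding segment_convex_hull that(4,5) .
  qed
  moreover have "\<forall>v\<in>V. degree E v = 4" using G(3) by (simp add: degree_def deg_def)
  ultimately show ?thesis using G(2) unfolding four_regular_matchstick_graph_def by blast
qed

theorem theorem5p2:
  fixes n :: nat
  assumes "n \<ge> 97"
  shows "\<exists>V E. four_regular_matchstick_graph V E \<and> card V = n"
proof -
  obtain S :: "complex set" where "piece S n {#}" using closed_piece_exists[OF assms] by blast
  from piece_to_vec[OF this] show ?thesis by (intro four_regular_of_piece) simp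
qed

end
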